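(* There is a linear-time algorithm that, given an embedded planar $st$-graph $G$, decides whether $G$ admits a bitonic $st$-ordering, and, if it does, computes such an ordering $\pi$ (also in linear time).
   Context: A planar $st$-graph is a planar, acyclic directed graph without parallel edges with exactly one source $s$ and exactly one sink $t$ (the edge $(s,t)$ need not be present); embedded means a fixed planar embedding with $s$ and $t$ on the outer face. For a vertex $u$ its successor list $S(u)=\{v_1,\dots,v_m\}$ lists the heads of the outgoing edges $(u,v_1),\dots,(u,v_m)$ in the clockwise order in which they appear around $u$ in the embedding (the outgoing edges of each vertex are consecutive in the embedding); for $u=s$, $v_1$ and $v_m$ are chosen so that $v_m,s,v_1$ appear clockwise on the outer face. An $st$-ordering is a bijection $\pi:V\to\{1,\dots,|V|\}$ with $\pi(u)<\pi(v)$ for every edge $(u,v)$. It is a bitonic $st$-ordering if for every vertex $u$ with $S(u)=\{v_1,\dots,v_m\}$ there is $1\le h\le m$ with $\pi(v_1)<\dots<\pi(v_h)>\dots>\pi(v_m)$. *)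

theory Defs
  imports "Graph_Theory.Digraph_Component" "HOL-Combinatorics.Cycles" "HOL-Combinatorics.Orbits"
begin

section \<open>Planar embeddings\<close>

text \<open>
  Embeddings are combinatorial: a rotation system \<open>\<rho>\<close> lists, for every vertex, the incident arcs in
  clockwise order. These lists are cyclic, so their starting points carry no meaning.
\<close>

definition rotation_system :: "('a, 'b) pre_digraph \<Rightarrow> ('a \<Rightarrow> 'b list) \<Rightarrow> bool" where
  "rotation_system G \<rho> \<longleftrightarrow>
     (\<forall>v\<in>verts G. distinct (\<rho> v) \<and> set (\<rho> v) = in_arcs G v \<union> out_arcs G v)"

text \<open>
  A dart is an arc with a direction of traversal, \<open>True\<close> meaning from tail to head.
\<close>

type_synonym 'b dart = "'b \<times> bool"

definition darts :: "('a, 'b) pre_digraph \<Rightarrow> 'b dart set" where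
  "darts G = arcs G \<times> UNIV"

definition dart_start :: "('a, 'b) pre_digraph \<Rightarrow> 'b dart \<Rightarrow> 'a" where
  "dart_start G d = (if snd d then tail G (fst d) else head G (fst d))"

definition dart_end :: "('a, 'b) pre_digraph \<Rightarrow> 'b dart \<Rightarrow> 'a" where
  "dart_end G d = (if snd d then head G (fst d) else tail G (fst d))"

text \<open>
  The walk along a face leaves a vertex on the arc that follows the arc of arrival clockwise, so the
  face lies to the left of its darts. Hence inner faces are traversed counterclockwise, and the
  boundary of the drawing is traversed clockwise by the darts of the outer face.
\<close>

definition face_succ :: "('a, 'b) pre_digraph \<Rightarrow> ('a \<Rightarrow> 'b list) \<Rightarrow> 'b dart \<Rightarrow> 'b dart" where
  "face_succ G \<rho> d =
     (let v = dart_end G d; a = cycle_of_list (\<rho> v) (fst d) in (a, tail G a = v))"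

definition face_of :: "('a, 'b) pre_digraph \<Rightarrow> ('a \<Rightarrow> 'b list) \<Rightarrow> 'b dart \<Rightarrow> 'b dart set" where
  "face_of G \<rho> d = orbit (face_succ G \<rho>) d"

definition faces :: "('a, 'b) pre_digraph \<Rightarrow> ('a \<Rightarrow> 'b list) \<Rightarrow> 'b dart set set" where
  "faces G \<rho> = face_of G \<rho> ` darts G"

text \<open>
  A rotation system of a connected graph with at least one arc describes an embedding into the
  plane (equivalently, the sphere) iff its genus, given by Euler's formula, is zero.
\<close>

definition planar_embedding :: "('a, 'b) pre_digraph \<Rightarrow> ('a \<Rightarrow> 'b list) \<Rightarrow> bool" where
  "planar_embedding G \<rho> \<longleftrightarrow>
     connected G \<and> rotation_system G \<rho> \<and>
     card (verts G) + card (faces G \<rho>) = card (arcs G) + 2"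

text \<open>
  The outer face is named by the arc \<open>a\<^sub>0\<close> on which it leaves \<open>s\<close>: it is the face to the left
  of \<open>a\<^sub>0\<close>. If \<open>a\<close> is the arc preceding \<open>a\<^sub>0\<close> clockwise around \<open>s\<close>, then \<open>(a, False)\<close> and
  \<open>(a\<^sub>0, True)\<close> are consecutive on that face, that is, \<open>head a\<close>, \<open>s\<close>, \<open>head a\<^sub>0\<close> appear
  clockwise on it.
\<close>

locale embedded_planar_st_graph = digraph G
  for G :: "('a, 'b) pre_digraph" and s t :: 'a and \<rho> :: "'a \<Rightarrow> 'b list" and a\<^sub>0 :: 'b +
  assumes acyclic: "acyclic (arcs_ends G)"
    and source: "{v \<in> verts G. in_degree G v = 0} = {s}"
    and sink: "{v \<in> verts G. out_degree G v = 0} = {t}"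
    and planar: "planar_embedding G \<rho>"
    and outer_source: "a\<^sub>0 \<in> out_arcs G s"
    and outer_sink: "\<exists>d \<in> face_of G \<rho> (a\<^sub>0, True). dart_start G d = t"

section \<open>Bitonic st-orderings\<close>

text \<open>
  The arcs to the successors of \<open>u\<close> in clockwise order. In an embedded planar st-graph the outgoing
  arcs of every vertex are consecutive, so that there is exactly one such list.
\<close>

definition succ_arcs ::
  "('a, 'b) pre_digraph \<Rightarrow> 'a \<Rightarrow> ('a \<Rightarrow> 'b list) \<Rightarrow> 'b \<Rightarrow> 'a \<Rightarrow> 'b list" where
  "succ_arcs G s \<rho> a\<^sub>0 u =
     (THE xs. \<exists>k ys. rotate k (\<rho> u) = xs @ ys \<and> set xs = out_arcs G u \<and> set ys = in_arcs G u \<and>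
                     (u = s \<longrightarrow> hd xs = a\<^sub>0))"

definition successors ::
  "('a, 'b) pre_digraph \<Rightarrow> 'a \<Rightarrow> ('a \<Rightarrow> 'b list) \<Rightarrow> 'b \<Rightarrow> 'a \<Rightarrow> 'a list" where
  "successors G s \<rho> a\<^sub>0 u = map (head G) (succ_arcs G s \<rho> a\<^sub>0 u)"

definition st_ordering :: "('a, 'b) pre_digraph \<Rightarrow> ('a \<Rightarrow> nat) \<Rightarrow> bool" where
  "st_ordering G \<pi> \<longleftrightarrow>
     bij_betw \<pi> (verts G) {1..card (verts G)} \<and> (\<forall>a\<in>arcs G. \<pi> (tail G a) < \<pi> (head G a))"

text \<open>Strictly increasing up to the \<open>h\<close>-th entry (counting from 1), strictly decreasing from it.\<close>

definition bitonic :: "nat list \<Rightarrow> bool" where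
  "bitonic xs \<longleftrightarrow>
     (\<exists>h\<in>{1..length xs}. sorted_wrt (<) (take h xs) \<and> sorted_wrt (>) (drop (h - 1) xs))"

text \<open>The sink has no successors; the condition concerns the other vertices only.\<close>

definition bitonic_st_ordering ::
  "('a, 'b) pre_digraph \<Rightarrow> 'a \<Rightarrow> ('a \<Rightarrow> 'b list) \<Rightarrow> 'b \<Rightarrow> ('a \<Rightarrow> nat) \<Rightarrow> bool" where
  "bitonic_st_ordering G s \<rho> a\<^sub>0 \<pi> \<longleftrightarrow>
     st_ordering G \<pi> \<and>
     (\<forall>u\<in>verts G. out_arcs G u \<noteq> {} \<longrightarrow> bitonic (map \<pi> (successors G s \<rho> a\<^sub>0 u)))"

section \<open>Algorithms and their running time\<close>

text \<open>
  Algorithms are programs of a random access machine with unit costs. The memory consists of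
  arrays of natural numbers; as the array in an access is a fixed constant, a program uses only
  finitely many of them. The only arithmetic operations are increment and decrement (truncated
  at 0). Hence a computation of \<open>T\<close> steps creates no number exceeding the largest number in the
  input and the program by more than \<open>T\<close>, and unit costs cannot be abused by means of large numbers.
\<close>

type_synonym store = "nat \<Rightarrow> nat \<Rightarrow> nat"

datatype exp = Const nat | Cell nat exp | Inc exp | Dec exp

datatype test = Less exp exp | Eq exp exp | Not test | And test test

datatype prog =
    Skip
  | Write nat exp exp
  | Seq prog prog
  | If test prog prog
  | While test prog

primrec exp_val :: "exp \<Rightarrow> store \<Rightarrow> nat" where
  "exp_val (Const n) \<sigma> = n"
| "exp_val (Cell k e) \<sigma> = \<sigma> k (exp_val e \<sigma>)"
| "exp_val (Inc e) \<sigma> = exp_val e \<sigma> + 1"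
| "exp_val (Dec e) \<sigma> = exp_val e \<sigma> - 1"

primrec exp_cost :: "exp \<Rightarrow> nat" where
  "exp_cost (Const n) = 1"
| "exp_cost (Cell k e) = exp_cost e + 1"
| "exp_cost (Inc e) = exp_cost e + 1"
| "exp_cost (Dec e) = exp_cost e + 1"

primrec test_val :: "test \<Rightarrow> store \<Rightarrow> bool" where
  "test_val (Less e f) \<sigma> \<longleftrightarrow> exp_val e \<sigma> < exp_val f \<sigma>"
| "test_val (Eq e f) \<sigma> \<longleftrightarrow> exp_val e \<sigma> = exp_val f \<sigma>"
| "test_val (Not b) \<sigma> \<longleftrightarrow> \<not> test_val b \<sigma>"
| "test_val (And b c) \<sigma> \<longleftrightarrow> test_val b \<sigma> \<and> test_val c \<sigma>"

primrec test_cost :: "test \<Rightarrow> nat" where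
  "test_cost (Less e f) = exp_cost e + exp_cost f + 1"
| "test_cost (Eq e f) = exp_cost e + exp_cost f + 1"
| "test_cost (Not b) = test_cost b + 1"
| "test_cost (And b c) = test_cost b + test_cost c + 1"

text \<open>\<open>exec p \<sigma> T \<sigma>'\<close>: started in \<open>\<sigma>\<close>, the program \<open>p\<close> halts in \<open>\<sigma>'\<close> after \<open>T\<close> steps.\<close>

inductive exec :: "prog \<Rightarrow> store \<Rightarrow> nat \<Rightarrow> store \<Rightarrow> bool" where
  Skip: "exec Skip \<sigma> 1 \<sigma>"
| Write: "exec (Write k e f) \<sigma> (exp_cost e + exp_cost f + 1)
            (\<sigma>(k := (\<sigma> k)(exp_val e \<sigma> := exp_val f \<sigma>)))"
| Seq: "exec p \<sigma> T \<sigma>' \<Longrightarrow> exec q \<sigma>' U \<sigma>'' \<Longrightarrow> exec (Seq p q) \<sigma> (T + U) \<sigma>''"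
| IfTrue: "test_val b \<sigma> \<Longrightarrow> exec p \<sigma> T \<sigma>' \<Longrightarrow> exec (If b p q) \<sigma> (test_cost b + T) \<sigma>'"
| IfFalse: "\<not> test_val b \<sigma> \<Longrightarrow> exec q \<sigma> T \<sigma>' \<Longrightarrow> exec (If b p q) \<sigma> (test_cost b + T) \<sigma>'"
| WhileFalse: "\<not> test_val b \<sigma> \<Longrightarrow> exec (While b p) \<sigma> (test_cost b) \<sigma>"
| WhileTrue: "test_val b \<sigma> \<Longrightarrow> exec p \<sigma> T \<sigma>' \<Longrightarrow> exec (While b p) \<sigma>' U \<sigma>'' \<Longrightarrow>
    exec (While b p) \<sigma> (test_cost b + T + U) \<sigma>''"

inductive_cases exec_SkipE: "exec Skip \<sigma> T \<sigma>'"
inductive_cases exec_WriteE: "exec (Write k e f) \<sigma> T \<sigma>'"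
inductive_cases exec_SeqE: "exec (Seq p q) \<sigma> T \<sigma>'"
inductive_cases exec_IfE: "exec (If b p q) \<sigma> T \<sigma>'"
inductive_cases exec_WhileE: "exec (While b p) \<sigma> T \<sigma>'"

lemma exec_deterministic:
  "exec p \<sigma> T \<sigma>' \<Longrightarrow> exec p \<sigma> U \<sigma>'' \<Longrightarrow> U = T \<and> \<sigma>'' = \<sigma>'"
proof (induction arbitrary: U \<sigma>'' rule: exec.induct)
  case Skip then show ?case by (auto elim: exec_SkipE)
next
  case Write then show ?case by (auto elim: exec_WriteE)
next
  case Seq from Seq.prems Seq.IH show ?case by (blast elim: exec_SeqE)
next
  case IfTrue from IfTrue.prems IfTrue.IH IfTrue.hyps show ?case by (blast elim: exec_IfE)
next
  case IfFalse from IfFalse.prems IfFalse.IH IfFalse.hyps show ?case by (blast elim: exec_IfE)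
next
  case WhileFalse then show ?case by (blast elim: exec_WhileE)
next
  case WhileTrue from WhileTrue.prems WhileTrue.IH WhileTrue.hyps show ?case
    by (blast elim: exec_WhileE)
qed

section \<open>Input\<close>

definition numbered :: "(nat, nat) pre_digraph \<Rightarrow> bool" where
  "numbered G \<longleftrightarrow> verts G = {..<card (verts G)} \<and> arcs G = {..<card (arcs G)}"

definition array_of :: "nat list \<Rightarrow> nat \<Rightarrow> nat" where
  "array_of xs i = (if i < length xs then xs ! i else 0)"

text \<open>
  Array 4 holds the rotations of all vertices one after the other, and array 3 the position at
  which the rotation of each vertex starts. All other cells are 0.
\<close>

definition input_store :: "(nat, nat) pre_digraph \<Rightarrow> (nat \<Rightarrow> nat list) \<Rightarrow> nat \<Rightarrow> store" where
  "input_store G \<rho> a\<^sub>0 =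
     (let n = card (verts G); m = card (arcs G) in
      (\<lambda>_ _. 0)
        (0 := array_of [n, m, a\<^sub>0],
         1 := array_of (map (tail G) [0..<m]),
         2 := array_of (map (head G) [0..<m]),
         3 := array_of (map (\<lambda>v. length (concat (map \<rho> [0..<v]))) [0..<n + 1]),
         4 := array_of (concat (map \<rho> [0..<n]))))"

end

theory Submission
  imports Defs
begin

text \<open>
  Between consecutive successors \<open>v\<^sub>i\<close>, \<open>v\<^sub>i\<^sub>+\<^sub>1\<close> of a vertex lies a face with one sink \<open>w\<close>. If \<open>v\<^sub>i = w\<close>,
  the face contains a path that forces \<open>\<pi>\<close> to decrease from \<open>v\<^sub>i\<close> to \<open>v\<^sub>i\<^sub>+\<^sub>1\<close>; if \<open>v\<^sub>i\<^sub>+\<^sub>1 = w\<close>, it is forced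
  to increase. A bitonic ordering exists iff in no successor list a forced descent comes before a forced
  ascent. For sufficiency, insert an edge between all pairs of consecutive successors, directed by the
  greedy rule that descends from the first forced descent on. A topological order of this graph is
  bitonic, and the graph is acyclic for the following reason. Consider a cycle closed by an edge inside
  a face with source \<open>u\<close> and sink \<open>w\<close>. Modulo 2 it bounds a set of faces and parts of faces that contains
  exactly one of \<open>u\<close> and \<open>w\<close>, hence, as no path from \<open>s\<close> to \<open>u\<close> or from \<open>w\<close> to \<open>t\<close> meets the cycle, exactly one
  of \<open>s\<close> and \<open>t\<close>; but these lie on a common face that no inserted edge crosses. Forced descents and
  ascents are visible in the rotations at the heads, so that everything is computed in linear time.
\<close>

section \<open>Darts and faces\<close>

text \<open>The embedding is a rotation system, so no curve is at hand that would separate the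
  plane. A count replaces the Jordan curve theorem: over the field with two elements, Euler's
  formula makes the cycle space as large as the space of face boundaries. Counting corners with the
  same formula shows that each face has one sink. The other obstacle is that inserted edges are not
  arcs of the embedding; updating rotations and faces after each insertion would mean redoing this
  theory for the larger graph. Therefore \<open>G\<close> and its faces stay fixed: an inserted edge
  is pushed across its face onto the two arcs from their common tail, and the corner between these
  arcs is remembered as cut off. Sides of a closed walk are then assigned to corners instead of
  faces. Edges are inserted one at a time, because acyclicity before the insertion is what keeps the
  two paths to \<open>s\<close> and \<open>t\<close> off the closed walk. The argument asks only
  that an inserted edge does not leave the sink of its face.\<close>

lemma distinct_rotate1_cycle:
  assumes "distinct xs" and "i < length xs"
  shows "cycle_of_list xs (xs ! i) = xs ! (Suc i mod length xs)"
proof -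
  have "map (cycle_of_list xs) xs = rotate1 xs"
    using cyclic_rotation[OF assms(1), of 1] by simp
  then have "cycle_of_list xs (xs ! i) = rotate1 xs ! i"
    using assms(2) by (metis nth_map)
  then show ?thesis using assms(2) by (simp add: nth_rotate1)
qed

lemma cycle_of_list_mem: "x \<in> set xs \<Longrightarrow> cycle_of_list xs x \<in> set xs"
  using cycle_permutes[of xs] by (metis permutes_in_image)

lemma cycle_of_list_inj: "cycle_of_list xs x = cycle_of_list xs y \<Longrightarrow> x = y"
  using cycle_permutes[of xs] by (metis permutes_inverses(2))

text \<open>The cycle of a distinct list is transitive on its entries. This is the induction
  principle for going once around a vertex.\<close>

lemma cycle_of_list_closed_eq:
  assumes d: "distinct xs" and x: "x \<in> A" "x \<in> set xs"
    and step: "\<And>y. y \<in> A \<Longrightarrow> y \<in> set xs \<Longrightarrow> cycle_of_list xs y \<in> A"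
  shows "set xs \<subseteq> A"
proof -
  obtain i where i: "i < length xs" "xs ! i = x" using x by (metis in_set_conv_nth)
  have *: "xs ! ((i + k) mod length xs) \<in> A" for k
  proof (induction k)
    case 0 then show ?case using i x by simp
  next
    case (Suc k)
    have lt: "(i + k) mod length xs < length xs" using i by (intro mod_less_divisor) auto
    have "cycle_of_list xs (xs ! ((i + k) mod length xs)) = xs ! (Suc (i + k) mod length xs)"
      using distinct_rotate1_cycle[OF d lt] by (simp add: mod_Suc_eq)
    then show ?case using step[OF Suc nth_mem[OF lt]] by simp
  qed
  show ?thesis
  proof
    fix y assume "y \<in> set xs"
    then obtain j where j: "j < length xs" "xs ! j = y" by (metis in_set_conv_nth)
    have "(i + (length xs - i + j)) mod length xs = j" using i j by simp
    then show "y \<in> A" using *[of "length xs - i + j"] j by simp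
  qed
qed

text \<open>The number of strict predecessors grows along every edge. Ranks turn arguments along
  directed paths into the choice of a minimum or maximum.\<close>

lemma finite_acyclic_rank:
  assumes "finite R" "acyclic R"
  shows "\<exists>r::'a \<Rightarrow> nat. \<forall>(x, y) \<in> R. r x < r y"
proof -
  define r where "r y = card {x. (x, y) \<in> R\<^sup>+}" for y
  have fin: "finite {x. (x, y) \<in> R\<^sup>+}" for y
  proof (rule finite_subset)
    show "{x. (x, y) \<in> R\<^sup>+} \<subseteq> fst ` (R\<^sup>+)" by force
    show "finite (fst ` (R\<^sup>+))" using assms by (simp add: finite_trancl)
  qed
  have "r x < r y" if "(x, y) \<in> R" for x y
    unfolding r_def
  proof (rule psubset_card_mono[OF fin])
    have "x \<notin> {z. (z, x) \<in> R\<^sup>+}" using assms(2) by (auto simp: acyclic_def)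
    moreover have "x \<in> {z. (z, y) \<in> R\<^sup>+}" using that by auto
    moreover have "{z. (z, x) \<in> R\<^sup>+} \<subseteq> {z. (z, y) \<in> R\<^sup>+}" using that by auto
    ultimately show "{z. (z, x) \<in> R\<^sup>+} \<subset> {z. (z, y) \<in> R\<^sup>+}" by blast
  qed
  then show ?thesis by blast
qed

context embedded_planar_st_graph
begin

abbreviation nx :: "'a \<Rightarrow> 'b \<Rightarrow> 'b" where "nx v \<equiv> cycle_of_list (\<rho> v)"
abbreviation fs :: "'b dart \<Rightarrow> 'b dart" where "fs \<equiv> face_succ G \<rho>"
abbreviation face :: "'b dart \<Rightarrow> 'b dart set" where "face \<equiv> face_of G \<rho>"
abbreviation dstart :: "'b dart \<Rightarrow> 'a" where "dstart \<equiv> dart_start G"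
abbreviation dend :: "'b dart \<Rightarrow> 'a" where "dend \<equiv> dart_end G"

lemma dend_simps [simp]: "dend (a, True) = head G a" "dend (a, False) = tail G a"
  by (auto simp: dart_end_def)

lemma dstart_simps [simp]: "dstart (a, True) = tail G a" "dstart (a, False) = head G a"
  by (auto simp: dart_start_def)

lemma fst_dart [simp]: "d \<in> darts G \<Longrightarrow> fst d \<in> arcs G"
  by (auto simp: darts_def)

lemma mem_darts [simp]: "(a, b) \<in> darts G \<longleftrightarrow> a \<in> arcs G"
  by (auto simp: darts_def)

lemma finite_darts [simp]: "finite (darts G)"
  by (simp add: darts_def)

lemma card_darts: "card (darts G) = 2 * card (arcs G)"
  by (simp add: darts_def card_cartesian_product)

lemma rotation: "rotation_system G \<rho>"
  using planar by (simp add: planar_embedding_def)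

lemma distinct_rho [simp]: "v \<in> verts G \<Longrightarrow> distinct (\<rho> v)"
  using rotation by (simp add: rotation_system_def)

lemma set_rho: "v \<in> verts G \<Longrightarrow> set (\<rho> v) = in_arcs G v \<union> out_arcs G v"
  using rotation by (simp add: rotation_system_def)

lemma set_rho_iff: "v \<in> verts G \<Longrightarrow> a \<in> set (\<rho> v) \<longleftrightarrow> a \<in> arcs G \<and> (head G a = v \<or> tail G a = v)"
  by (auto simp: set_rho)

lemma dend_verts [simp]: "d \<in> darts G \<Longrightarrow> dend d \<in> verts G"
  by (auto simp: dart_end_def darts_def)

lemma dart_in_rho: "d \<in> darts G \<Longrightarrow> fst d \<in> set (\<rho> (dend d))"
  by (cases d; cases "snd d") (auto simp: set_rho_iff)

lemma nx_in_rho: "d \<in> darts G \<Longrightarrow> nx (dend d) (fst d) \<in> set (\<rho> (dend d))"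
  by (rule cycle_of_list_mem[OF dart_in_rho])

lemma fs_eq: "fs d = (nx (dend d) (fst d), tail G (nx (dend d) (fst d)) = dend d)"
  by (simp add: face_succ_def Let_def)

lemma fs_darts [simp]: "d \<in> darts G \<Longrightarrow> fs d \<in> darts G"
  using nx_in_rho[of d] by (simp add: fs_eq set_rho_iff)

lemma dstart_fs [simp]: "d \<in> darts G \<Longrightarrow> dstart (fs d) = dend d"
  using nx_in_rho[of d] by (auto simp: fs_eq dart_start_def set_rho_iff)

text \<open>As there are no loops, only one dart of an arc arrives at a given vertex; so the darts
  ending at \<open>v\<close> correspond to the entries of \<open>\<rho> v\<close>.\<close>

lemma dart_eqI:
  assumes "d \<in> darts G" "d' \<in> darts G" "fst d = fst d'" "dend d = dend d'"
  shows "d = d'"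
  using assms no_loops[of "fst d"]
  by (cases d; cases d') (auto simp: dart_end_def split: if_splits)

lemma fs_inj: "inj_on fs (darts G)"
proof (rule inj_onI)
  fix d d' assume d: "d \<in> darts G" "d' \<in> darts G" and e: "fs d = fs d'"
  then have v: "dend d = dend d'" using dstart_fs by metis
  have "nx (dend d) (fst d) = nx (dend d) (fst d')" using e v by (simp add: fs_eq)
  then have "fst d = fst d'" by (rule cycle_of_list_inj)
  then show "d = d'" using d v by (intro dart_eqI)
qed

lemma fs_bij: "bij_betw fs (darts G) (darts G)"
  unfolding bij_betw_def using fs_inj
  by (metis endo_inj_surj finite_darts fs_darts image_subsetI)

text \<open>Extended by the identity to the whole type, so that it is a permutation and its orbits
  partition the darts.\<close>

definition fs' :: "'b dart \<Rightarrow> 'b dart" where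
  "fs' d = (if d \<in> darts G then fs d else d)"

lemma fs'_permutes: "fs' permutes darts G"
proof (rule bij_imp_permutes)
  show "bij_betw fs' (darts G) (darts G)"
    using fs_bij by (subst bij_betw_cong[where g=fs]) (auto simp: fs'_def)
qed (simp add: fs'_def)

lemma orbit_fs': "d \<in> darts G \<Longrightarrow> orbit fs d = orbit fs' d"
  by (rule orbit_cong0[of _ "darts G"]) (auto simp: fs'_def)

lemma fs'_permutation: "permutation fs'"
  using fs'_permutes permutation_permutes finite_darts by blast

lemma face_self [simp]: "d \<in> darts G \<Longrightarrow> d \<in> face d"
  using permutation_self_in_orbit[OF fs'_permutation] by (simp add: face_of_def orbit_fs')

lemma face_darts: "d \<in> darts G \<Longrightarrow> d' \<in> face d \<Longrightarrow> d' \<in> darts G"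
  using permutes_orbit_subset[OF fs'_permutes, of d] by (auto simp: face_of_def orbit_fs')

lemma face_eq:
  assumes "d \<in> darts G" "d' \<in> face d"
  shows "face d' = face d"
proof -
  have "orbit fs' d' = orbit fs' d"
    using orbit_cyclic_eq3[OF cyclic_on_orbit[OF fs'_permutes finite_darts], of d' d] assms
    by (simp add: face_of_def orbit_fs')
  then show ?thesis using assms face_darts[OF assms] by (simp add: face_of_def orbit_fs')
qed

lemma fs_in_face: "fs d \<in> face d"
  by (simp add: face_of_def orbit.base)

lemma face_fs [simp]: "d \<in> darts G \<Longrightarrow> face (fs d) = face d"
  by (rule face_eq[OF _ fs_in_face])

lemma face_pred:
  assumes "d \<in> darts G"
  obtains d' where "d' \<in> darts G" "fs d' = d" "face d' = face d"
proof -
  obtain d' where "d' \<in> darts G" "fs d' = d"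
    using fs_bij assms by (metis bij_betw_imp_surj_on imageE)
  then show ?thesis using that face_fs by metis
qed

lemma face_iff: "d \<in> darts G \<Longrightarrow> d' \<in> face d \<longleftrightarrow> d' \<in> darts G \<and> face d' = face d"
  using face_eq face_darts face_self by blast

lemma finite_faces [simp]: "finite (faces G \<rho>)"
  by (simp add: faces_def)

lemma face_in_faces [simp]: "d \<in> darts G \<Longrightarrow> face d \<in> faces G \<rho>"
  by (simp add: faces_def)

section \<open>Ranks of vertices, the source and the sink\<close>

definition rank :: "'a \<Rightarrow> nat" where
  "rank = (SOME r. \<forall>(x, y) \<in> arcs_ends G. r x < r y)"

lemma rank: "a \<in> arcs G \<Longrightarrow> rank (tail G a) < rank (head G a)"
proof -
  assume a: "a \<in> arcs G"
  have "finite (arcs_ends G)" by (simp add: arcs_ends_conv)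
  then have "\<exists>r::'a \<Rightarrow> nat. \<forall>(x, y) \<in> arcs_ends G. r x < r y"
    using finite_acyclic_rank acyclic by blast
  then have "\<forall>(x, y) \<in> arcs_ends G. rank x < rank y"
    unfolding rank_def by (rule someI_ex)
  then show ?thesis using a by (auto simp: arcs_ends_conv)
qed

lemma s_verts: "s \<in> verts G" and s_no_in: "in_arcs G s = {}"
proof -
  have "s \<in> {v \<in> verts G. in_degree G v = 0}" using source by simp
  then show "s \<in> verts G" "in_arcs G s = {}" by (auto simp: in_degree_def card_eq_0_iff in_arcs_def)
qed

lemma t_verts: "t \<in> verts G" and t_no_out: "out_arcs G t = {}"
proof -
  have "t \<in> {v \<in> verts G. out_degree G v = 0}" using sink by simp
  then show "t \<in> verts G" "out_arcs G t = {}" by (auto simp: out_degree_def card_eq_0_iff out_arcs_def)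
qed

lemma head_neq_s: "a \<in> arcs G \<Longrightarrow> head G a \<noteq> s"
  using s_no_in by (metis empty_iff in_in_arcs_conv)

lemma tail_neq_t: "a \<in> arcs G \<Longrightarrow> tail G a \<noteq> t"
  using t_no_out by (metis empty_iff in_out_arcs_conv)

lemma a0: "a\<^sub>0 \<in> arcs G" "tail G a\<^sub>0 = s"
  using outer_source by auto

lemma s_neq_t: "s \<noteq> t"
  using tail_neq_t a0 by blast

lemma ex_in_arc: "v \<in> verts G \<Longrightarrow> v \<noteq> s \<Longrightarrow> \<exists>a\<in>arcs G. head G a = v"
proof -
  assume v: "v \<in> verts G" "v \<noteq> s"
  then have "v \<notin> {v \<in> verts G. in_degree G v = 0}" using source by simp
  then have "in_arcs G v \<noteq> {}" using v by (auto simp: in_degree_def)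
  then show ?thesis by auto
qed

lemma ex_out_arc: "v \<in> verts G \<Longrightarrow> v \<noteq> t \<Longrightarrow> \<exists>a\<in>arcs G. tail G a = v"
proof -
  assume v: "v \<in> verts G" "v \<noteq> t"
  then have "v \<notin> {v \<in> verts G. out_degree G v = 0}" using sink by simp
  then have "out_arcs G v \<noteq> {}" using v by (auto simp: out_degree_def)
  then show ?thesis by auto
qed

end

section \<open>Counting corners\<close>

lemma inj_on_of_card_le:
  assumes "finite A" "g ` A \<supseteq> B" "card A \<le> card B"
  shows "inj_on g A"
proof -
  have "card (g ` A) \<ge> card B" using assms by (intro card_mono) auto
  then have "card (g ` A) = card A" using assms card_image_le[of A g] by linarith
  then show ?thesis using assms(1) by (simp add: eq_card_imp_inj_on)
qed

lemma finite_has_max: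
  fixes f :: "'a \<Rightarrow> nat"
  assumes "finite X" "X \<noteq> {}"
  obtains x where "x \<in> X" "\<And>y. y \<in> X \<Longrightarrow> f y \<le> f x"
proof -
  have "Max (f ` X) \<in> f ` X" using assms by simp
  then obtain x where "x \<in> X" "f x = Max (f ` X)" by auto
  then show ?thesis using that assms by simp
qed

lemma finite_has_min:
  fixes f :: "'a \<Rightarrow> nat"
  assumes "finite X" "X \<noteq> {}"
  obtains x where "x \<in> X" "\<And>y. y \<in> X \<Longrightarrow> f x \<le> f y"
proof -
  have "Min (f ` X) \<in> f ` X" using assms by simp
  then obtain x where "x \<in> X" "f x = Min (f ` X)" by auto
  then show ?thesis using that assms by simp
qed

context embedded_planar_st_graph
begin

text \<open>
  The corner of a face between a dart and its successor is classified by the directions of the two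
  darts: sinks of the face are corners \<open>TF\<close>, its sources are corners \<open>FT\<close>.
\<close>

definition TF :: "'b dart set" where "TF = {d \<in> darts G. snd d \<and> \<not> snd (fs d)}"
definition FT :: "'b dart set" where "FT = {d \<in> darts G. \<not> snd d \<and> snd (fs d)}"
definition TT :: "'b dart set" where "TT = {d \<in> darts G. snd d \<and> snd (fs d)}"
definition FF :: "'b dart set" where "FF = {d \<in> darts G. \<not> snd d \<and> \<not> snd (fs d)}"

lemma rank_dart: "d \<in> darts G \<Longrightarrow> snd d \<longleftrightarrow> rank (dstart d) < rank (dend d)"
  using rank[of "fst d"] by (cases d) (auto simp: dart_start_def dart_end_def)

lemma rank_neq: "d \<in> darts G \<Longrightarrow> rank (dstart d) \<noteq> rank (dend d)"
  using rank[of "fst d"] by (cases d) (auto simp: dart_start_def dart_end_def)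

text \<open>A dart of \<open>X\<close> whose end has maximal rank points forward and is followed by
  a backward one, since otherwise a neighbour on the face lies in \<open>X\<close> and ends higher.
  Only ascending steps need to stay in \<open>X\<close>, so that \<open>X\<close> can be a whole
  face as well as the part of a face reachable from a vertex.\<close>

lemma closed_has_TF:
  assumes X: "X \<subseteq> darts G" "X \<noteq> {}" and c: "\<And>d. d \<in> X \<Longrightarrow> snd d \<Longrightarrow> snd (fs d) \<Longrightarrow> fs d \<in> X"
    and c': "\<And>d d'. d \<in> X \<Longrightarrow> \<not> snd d \<Longrightarrow> d' \<in> darts G \<Longrightarrow> fs d' = d \<Longrightarrow> d' \<in> X"
  shows "X \<inter> TF \<noteq> {}"
proof -
  have fin: "finite X" using finite_subset[OF X(1) finite_darts] .
  obtain d where d: "d \<in> X" and m: "\<And>e. e \<in> X \<Longrightarrow> rank (dend e) \<le> rank (dend d)"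
    by (rule finite_has_max[OF fin X(2), of "\<lambda>e. rank (dend e)"]) blast
  have dd: "d \<in> darts G" using d X by auto
  have "snd d"
  proof (rule ccontr)
    assume n: "\<not> snd d"
    obtain d' where d': "d' \<in> darts G" "fs d' = d" by (rule face_pred[OF dd]) blast
    then have "d' \<in> X" using c'[OF d n] by simp
    then have "rank (dstart d) \<le> rank (dend d)" using m[of d'] dstart_fs[OF d'(1)] d' by simp
    then show False using n rank_dart[OF dd] rank_neq[OF dd] by simp
  qed
  moreover have "\<not> snd (fs d)"
  proof
    assume f: "snd (fs d)"
    have "rank (dend (fs d)) \<le> rank (dend d)" using m[OF c[OF d \<open>snd d\<close> f]] .
    then show False using f rank_dart[OF fs_darts[OF dd]] dstart_fs[OF dd] by simp
  qed
  ultimately show ?thesis using d dd by (auto simp: TF_def)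
qed

lemma face_has_TF: "d \<in> darts G \<Longrightarrow> \<exists>e\<in>TF. face e = face d"
proof -
  assume d: "d \<in> darts G"
  have "face d \<inter> TF \<noteq> {}"
  proof (rule closed_has_TF)
    show "face d \<subseteq> darts G" using face_darts[OF d] by blast
    show "face d \<noteq> {}" using face_self[OF d] by blast
    show "fs e \<in> face d" if "e \<in> face d" for e
      using that d by (simp add: face_iff)
    show "d' \<in> face d" if "e \<in> face d" "d' \<in> darts G" "fs d' = e" for e d'
      using that d face_fs[of d'] by (simp add: face_iff)
  qed
  then show ?thesis using d by (auto simp: face_iff)
qed

lemma face_has_FT: "d \<in> darts G \<Longrightarrow> \<exists>e\<in>FT. face e = face d"
proof -
  assume d: "d \<in> darts G"
  have fin: "finite (face d)" using face_darts[OF d] finite_subset[OF _ finite_darts] by blast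
  have "face d \<noteq> {}" using face_self[OF d] by blast
  then obtain e where e: "e \<in> face d" and m: "\<And>e'. e' \<in> face d \<Longrightarrow> rank (dend e) \<le> rank (dend e')"
    by (rule finite_has_min[OF fin, of "\<lambda>e. rank (dend e)"]) blast
  have ed: "e \<in> darts G" using face_darts[OF d e] .
  obtain d' where d': "d' \<in> darts G" "fs d' = e" "face d' = face e" by (rule face_pred[OF ed]) blast
  then have "d' \<in> face d" using e d by (simp add: face_iff)
  then have "rank (dend e) \<le> rank (dstart e)" using m[of d'] dstart_fs[OF d'(1)] d' by simp
  then have "\<not> snd e" using rank_dart[OF ed] by simp
  moreover have "fs e \<in> face d" using e d by (simp add: face_iff)
  then have "rank (dend e) \<le> rank (dend (fs e))" by (rule m)
  then have "snd (fs e)"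
    using rank_dart[OF fs_darts[OF ed]] rank_neq[OF fs_darts[OF ed]] dstart_fs[OF ed] by simp
  ultimately have "e \<in> FT" using ed by (simp add: FT_def)
  then show ?thesis using e d by (auto simp: face_iff)
qed

lemma snd_fs: "d \<in> darts G \<Longrightarrow> snd (fs d) \<longleftrightarrow> tail G (fst (fs d)) = dend d"
  by (simp add: fs_eq)

text \<open>Such a vertex has incoming and outgoing arcs, so its cyclic rotation turns from incoming
  to outgoing somewhere and back elsewhere. Without one of the turns,
  \<open>cycle_of_list_closed_eq\<close> would give all its arcs the same direction.\<close>

lemma vertex_has_TT_FF:
  assumes v: "v \<in> verts G" "v \<noteq> s" "v \<noteq> t"
  shows "\<exists>d\<in>TT. dend d = v" and "\<exists>d\<in>FF. dend d = v"
proof -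
  obtain a where a: "a \<in> arcs G" "head G a = v" using ex_in_arc v by blast
  obtain b where b: "b \<in> arcs G" "tail G b = v" using ex_out_arc v by blast
  have ar: "a \<in> set (\<rho> v)" and br: "b \<in> set (\<rho> v)" using a b v by (simp_all add: set_rho_iff)
  have nh: "\<not> (head G x = v \<and> tail G x = v)" if "x \<in> arcs G" for x using no_loops[OF that] by auto
  show "\<exists>d\<in>TT. dend d = v"
  proof (rule ccontr)
    assume n: "\<not> (\<exists>d\<in>TT. dend d = v)"
    have "set (\<rho> v) \<subseteq> in_arcs G v"
    proof (rule cycle_of_list_closed_eq[of _ a])
      fix y assume y: "y \<in> in_arcs G v" "y \<in> set (\<rho> v)"
      then have yd: "(y, True) \<in> darts G" "dend (y, True) = v" by auto
      then have "\<not> snd (fs (y, True))" using n by (force simp: TT_def)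
      moreover have "nx v y \<in> set (\<rho> v)" using cycle_of_list_mem[OF y(2)] .
      ultimately show "nx v y \<in> in_arcs G v" using yd v by (auto simp: fs_eq set_rho_iff)
    qed (use v a ar in auto)
    then show False using br b nh[of b] by auto
  qed
  show "\<exists>d\<in>FF. dend d = v"
  proof (rule ccontr)
    assume n: "\<not> (\<exists>d\<in>FF. dend d = v)"
    have "set (\<rho> v) \<subseteq> out_arcs G v"
    proof (rule cycle_of_list_closed_eq[of _ b])
      fix y assume y: "y \<in> out_arcs G v" "y \<in> set (\<rho> v)"
      then have yd: "(y, False) \<in> darts G" "dend (y, False) = v" by auto
      then have "snd (fs (y, False))" using n by (force simp: FF_def)
      moreover have "nx v y \<in> set (\<rho> v)" using cycle_of_list_mem[OF y(2)] .
      ultimately show "nx v y \<in> out_arcs G v" using yd v by (auto simp: fs_eq set_rho_iff)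
    qed (use v b br in auto)
    then show False using ar a nh[of a] by auto
  qed
qed

lemma euler: "card (verts G) + card (faces G \<rho>) = card (arcs G) + 2"
  using planar by (simp add: planar_embedding_def)

text \<open>
  By Euler's formula, the lower bounds on the numbers of corners of each kind are tight: every face
  has only one sink, and the outgoing arcs of every vertex are consecutive.
\<close>

lemma TF_inj: "inj_on face TF" and TT_inj: "inj_on dend TT"
proof -
  have fin: "finite TF" "finite FT" "finite TT" "finite FF"
    by (auto simp: TF_def FT_def TT_def FF_def)
  let ?W = "verts G - {s, t}"
  have "faces G \<rho> \<subseteq> face ` TF" "faces G \<rho> \<subseteq> face ` FT"
    unfolding faces_def using face_has_TF face_has_FT by (metis image_subsetI image_eqI)+
  note f = this
  have "?W \<subseteq> dend ` TT" "?W \<subseteq> dend ` FF"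
    using vertex_has_TT_FF by auto
  note w = this
  have c: "card (faces G \<rho>) \<le> card TF" "card (faces G \<rho>) \<le> card FT"
    "card ?W \<le> card TT" "card ?W \<le> card FF"
    using f w fin by (meson surj_card_le)+
  have "card ?W = card (verts G) - 2"
    using s_verts t_verts s_neq_t by (simp add: card_Diff_subset)
  moreover have "card (verts G) \<ge> 2"
    using s_verts t_verts s_neq_t card_mono[of "verts G" "{s, t}"] by auto
  ultimately have W: "card ?W + 2 = card (verts G)" by simp
  have u: "darts G = (TF \<union> FT) \<union> (TT \<union> FF)"
    by (auto simp: TF_def FT_def TT_def FF_def)
  have "card (darts G) = card TF + card FT + (card TT + card FF)"
    unfolding u using fin
    by (subst card_Un_disjoint[of "TF \<union> FT"], simp, simp, force simp: TF_def FT_def TT_def FF_def,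
        subst card_Un_disjoint[of TF], simp, simp, force simp: TF_def FT_def,
        subst card_Un_disjoint[of TT], simp, simp, force simp: TT_def FF_def, simp)
  then have "card TF + card FT + (card TT + card FF) = 2 * card (arcs G)" by (simp add: card_darts)
  \<comment> \<open>The four bounds in \<open>c\<close> add up to twice the number of faces plus
    twice the number of vertices minus 4. By Euler's formula this is the number of darts, so all
    four are equalities.\<close>
  then have "card TF \<le> card (faces G \<rho>)" "card TT \<le> card ?W"
    using c W euler by linarith+
  then show "inj_on face TF" "inj_on dend TT"
    using f w fin by (auto intro: inj_on_of_card_le)
qed

lemma TF_darts: "d \<in> TF \<Longrightarrow> d \<in> darts G" by (simp add: TF_def)

lemma arc_edge: "a \<in> arcs G \<Longrightarrow> (tail G a, head G a) \<in> arcs_ends G"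
  by (auto simp: arcs_ends_conv)

text \<open>The darts of the face whose ends are reachable from \<open>dend d\<close> are closed
  under ascending steps, so a sink corner is among them; by \<open>TF_inj\<close> it can only be
  \<open>w\<close>.\<close>

lemma reach_face_sink:
  assumes d: "d \<in> darts G" and w: "w \<in> TF" "face w = face d"
  shows "(dend d, dend w) \<in> (arcs_ends G)\<^sup>*"
proof -
  let ?X = "{e \<in> face d. (dend d, dend e) \<in> (arcs_ends G)\<^sup>*}"
  have "?X \<inter> TF \<noteq> {}"
  proof (rule closed_has_TF)
    show "?X \<subseteq> darts G" using face_darts[OF d] by blast
    show "?X \<noteq> {}" using face_self[OF d] by blast
  next
    fix e assume e: "e \<in> ?X" "snd e" "snd (fs e)"
    then have ed: "e \<in> darts G" using face_darts[OF d] by blast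
    have "(dstart (fs e), dend (fs e)) \<in> arcs_ends G"
      using e(3) fs_darts[OF ed] by (cases "fs e") (auto intro: arc_edge)
    then have "(dend e, dend (fs e)) \<in> arcs_ends G" by (simp add: ed)
    then show "fs e \<in> ?X" using e d ed by (auto simp: face_iff intro: rtrancl_into_rtrancl)
  next
    fix e d' assume e: "e \<in> ?X" "\<not> snd e" and d': "d' \<in> darts G" "fs d' = e"
    have ed: "e \<in> darts G" using e face_darts[OF d] by blast
    have "(dend e, dstart e) \<in> arcs_ends G"
      using e ed by (cases e) (auto intro: arc_edge)
    moreover have "dstart e = dend d'" using d' dstart_fs by metis
    moreover have "d' \<in> face d" using d' e d face_fs[of d'] by (auto simp: face_iff)
    ultimately show "d' \<in> ?X" using e by (auto intro: rtrancl_into_rtrancl)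
  qed
  then obtain e where e: "e \<in> ?X" "e \<in> TF" by blast
  then have "e = w" using w d inj_onD[OF TF_inj, of e w] by (auto simp: face_iff)
  then show ?thesis using e by simp
qed

end

section \<open>Cycles are boundaries\<close>

lemma even_card_sym_diff:
  assumes "finite A" "finite B"
  shows "even (card ((A - B) \<union> (B - A))) \<longleftrightarrow> (even (card A) \<longleftrightarrow> even (card B))"
proof -
  have "card A = card (A - B) + card (A \<inter> B)"
    using assms by (metis card_Int_Diff add.commute)
  moreover have "card B = card (B - A) + card (A \<inter> B)"
    using assms by (metis card_Int_Diff Int_commute add.commute)
  moreover have "card ((A - B) \<union> (B - A)) = card (A - B) + card (B - A)"
    using assms by (intro card_Un_disjoint) auto
  ultimately show ?thesis by auto
qed

context embedded_planar_st_graph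
begin

section \<open>Boundaries of sets of faces\<close>

definition rev_dart :: "'b dart \<Rightarrow> 'b dart" where "rev_dart d = (fst d, \<not> snd d)"

lemma rev_dart_darts [simp]: "rev_dart d \<in> darts G \<longleftrightarrow> d \<in> darts G"
  by (cases d) (auto simp: rev_dart_def)

lemma dend_rev [simp]: "dend (rev_dart d) = dstart d"
  by (auto simp: rev_dart_def dart_end_def dart_start_def)

lemma rev_rev [simp]: "rev_dart (rev_dart d) = d"
  by (simp add: rev_dart_def)

lemma fst_rev [simp]: "fst (rev_dart d) = fst d"
  by (simp add: rev_dart_def)

definition boundary :: "'b dart set set \<Rightarrow> 'b set" where
  "boundary X = {c \<in> arcs G. (face (c, True) \<in> X) \<noteq> (face (c, False) \<in> X)}"

lemma in_boundary_dart:
  "d \<in> darts G \<Longrightarrow> fst d \<in> boundary X \<longleftrightarrow> (face d \<in> X) \<noteq> (face (rev_dart d) \<in> X)"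
  by (cases d; cases "snd d") (auto simp: boundary_def rev_dart_def)

text \<open>\<open>rev_dart (fs d)\<close> is the dart that arrives at \<open>v\<close> on the arc
  following \<open>fst d\<close> clockwise, so the hypothesis carries \<open>Q\<close> once around
  \<open>v\<close>.\<close>

lemma const_at_vertex:
  assumes step: "\<And>d. d \<in> darts G \<Longrightarrow> dend d = v \<Longrightarrow> Q d \<longleftrightarrow> Q (rev_dart (fs d))"
    and d: "d \<in> darts G" "dend d = v" and d': "d' \<in> darts G" "dend d' = v"
  shows "Q d \<longleftrightarrow> Q d'"
proof -
  have v: "v \<in> verts G" using d by auto
  have "set (\<rho> v) \<subseteq> {x. \<exists>e. e \<in> darts G \<and> dend e = v \<and> fst e = x \<and> (Q e \<longleftrightarrow> Q d)}" (is "_ \<subseteq> ?A")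
  proof (rule cycle_of_list_closed_eq)
    show "distinct (\<rho> v)" using v by simp
    show "fst d \<in> ?A" using d by blast
    show "fst d \<in> set (\<rho> v)" using dart_in_rho d by blast
    fix y assume "y \<in> ?A"
    then obtain e where e: "e \<in> darts G" "dend e = v" "fst e = y" "Q e \<longleftrightarrow> Q d" by blast
    have "rev_dart (fs e) \<in> darts G" "dend (rev_dart (fs e)) = v" using e by simp_all
    moreover have "fst (rev_dart (fs e)) = nx v y" using e by (simp add: fs_eq)
    moreover have "Q (rev_dart (fs e)) \<longleftrightarrow> Q d" using step e by simp
    ultimately show "nx v y \<in> ?A" by blast
  qed
  moreover have "fst d' \<in> set (\<rho> v)" using dart_in_rho d' by blast
  ultimately obtain e where "e \<in> darts G" "dend e = v" "fst e = fst d'" "Q e \<longleftrightarrow> Q d" by blast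
  moreover have "e = d'" using calculation d' by (intro dart_eqI) auto
  ultimately show ?thesis by simp
qed

definition inc :: "'b \<Rightarrow> 'a \<Rightarrow> bool" where
  "inc c v \<longleftrightarrow> tail G c = v \<or> head G c = v"

text \<open>In a full turn around \<open>v\<close>, membership of the current face in
  \<open>X\<close> switches an even number of times. The turn is the permutation \<open>?p\<close>
  of the darts that arrive at \<open>v\<close>, and the arc of \<open>?p d\<close> separates the
  faces of \<open>d\<close> and \<open>?p d\<close>.\<close>

lemma boundary_even:
  assumes v: "v \<in> verts G"
  shows "even (card {c \<in> boundary X. inc c v})"
proof -
  define I where "I = {d \<in> darts G. dend d = v}"
  have fin: "finite I" by (simp add: I_def)
  let ?p = "\<lambda>d. rev_dart (fs d)"
  have "inj_on ?p I"
  proof (rule inj_onI)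
    fix d e assume "d \<in> I" "e \<in> I" "?p d = ?p e"
    then have "fs d = fs e" by (metis rev_rev)
    then show "d = e" using inj_onD[OF fs_inj] \<open>d \<in> I\<close> \<open>e \<in> I\<close> by (simp add: I_def)
  qed
  moreover have "?p ` I \<subseteq> I" by (auto simp: I_def)
  ultimately have p: "bij_betw ?p I I" using fin by (simp add: bij_betw_def endo_inj_surj)
  have "bij_betw fst {d \<in> I. fst d \<in> boundary X} {c \<in> boundary X. inc c v}"
  proof (rule bij_betwI')
    fix d e assume "d \<in> {d \<in> I. fst d \<in> boundary X}" "e \<in> {d \<in> I. fst d \<in> boundary X}"
    then show "(fst d = fst e) = (d = e)" using dart_eqI[of d e] by (auto simp: I_def)
  next
    fix d assume "d \<in> {d \<in> I. fst d \<in> boundary X}"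
    then show "fst d \<in> {c \<in> boundary X. inc c v}"
      by (auto simp: I_def inc_def dart_end_def)
  next
    fix c assume c: "c \<in> {c \<in> boundary X. inc c v}"
    then have "(c, head G c = v) \<in> {d \<in> I. fst d \<in> boundary X}"
      by (auto simp: I_def inc_def boundary_def dart_end_def)
    then show "\<exists>d\<in>{d \<in> I. fst d \<in> boundary X}. c = fst d" by force
  qed
  then have "card {c \<in> boundary X. inc c v} = card {d \<in> I. fst d \<in> boundary X}"
    by (simp add: bij_betw_same_card)
  also have "\<dots> = (\<Sum>d\<in>I. of_bool (fst d \<in> boundary X))"
    using fin by (simp add: Int_def)
  also have "\<dots> = (\<Sum>d\<in>I. of_bool (fst (?p d) \<in> boundary X))"
    by (rule sum.reindex_bij_betw[OF p, symmetric])
  finally have c: "card {c \<in> boundary X. inc c v} = (\<Sum>d\<in>I. of_bool (fst (?p d) \<in> boundary X))" .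
  have "(\<Sum>d\<in>I. of_bool (face d \<in> X) + of_bool (face (?p d) \<in> X))
      = (\<Sum>d\<in>I. of_bool (face d \<in> X)) + (\<Sum>d\<in>I. of_bool (face d \<in> X) :: nat)"
    using sum.reindex_bij_betw[OF p, of "\<lambda>d. of_bool (face d \<in> X) :: nat"] by (simp add: sum.distrib)
  then have ev: "even (\<Sum>d\<in>I. of_bool (face d \<in> X) + of_bool (face (?p d) \<in> X) :: nat)" by simp
  have "(\<Sum>d\<in>I. of_bool (face d \<in> X) + of_bool (face (?p d) \<in> X))
      = (\<Sum>d\<in>I. of_bool (fst (?p d) \<in> boundary X) + 2 * of_bool (face d \<in> X \<and> face (?p d) \<in> X) :: nat)"
  proof (rule sum.cong)
    fix d assume "d \<in> I"
    then have "d \<in> darts G" by (simp add: I_def)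
    then have "fst (?p d) \<in> boundary X \<longleftrightarrow> (face (?p d) \<in> X) \<noteq> (face d \<in> X)"
      using in_boundary_dart[of "?p d" X] by simp
    then show "of_bool (face d \<in> X) + of_bool (face (?p d) \<in> X)
        = (of_bool (fst (?p d) \<in> boundary X) + 2 * of_bool (face d \<in> X \<and> face (?p d) \<in> X) :: nat)"
      by auto
  qed simp
  then have "even ((\<Sum>d\<in>I. of_bool (fst (?p d) \<in> boundary X)) + 2 * (\<Sum>d\<in>I. of_bool (face d \<in> X \<and> face (?p d) \<in> X)) :: nat)"
    using ev by (simp only: sum.distrib sum_distrib_left)
  then show ?thesis using c by simp
qed

text \<open>Connectedness of the dual graph. All faces around one vertex are linked by crossing its
  arcs, and the faces around a vertex other than \<open>s\<close> are linked to those around a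
  vertex of smaller rank by an incoming arc.\<close>

lemma dual_connected:
  assumes inv: "\<And>c. c \<in> arcs G \<Longrightarrow> face (c, True) \<in> Y \<longleftrightarrow> face (c, False) \<in> Y"
    and d: "d \<in> darts G"
  shows "face d \<in> Y \<longleftrightarrow> face (a\<^sub>0, True) \<in> Y"
proof -
  have rv: "face (rev_dart e) \<in> Y \<longleftrightarrow> face e \<in> Y" if "e \<in> darts G" for e
    using that inv by (cases e; cases "snd e") (auto simp: rev_dart_def)
  have *: "\<forall>d\<in>darts G. dend d = v \<longrightarrow> (face d \<in> Y \<longleftrightarrow> face (a\<^sub>0, True) \<in> Y)" if "v \<in> verts G" for v
    using that
  proof (induction "rank v" arbitrary: v rule: less_induct)
    case less
    have ex: "\<exists>e\<in>darts G. dend e = v \<and> (face e \<in> Y \<longleftrightarrow> face (a\<^sub>0, True) \<in> Y)"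
    proof (cases "v = s")
      case True
      then show ?thesis using a0 inv[OF a0(1)] by (intro bexI[of _ "(a\<^sub>0, False)"]) auto
    next
      case False
      then obtain a where a: "a \<in> arcs G" "head G a = v" using ex_in_arc less.prems by blast
      then have "face (a, False) \<in> Y \<longleftrightarrow> face (a\<^sub>0, True) \<in> Y"
        using less.hyps[of "tail G a"] rank[OF a(1)] by force
      then show ?thesis using a inv[OF a(1)] by (intro bexI[of _ "(a, True)"]) auto
    qed
    show ?case
    proof (intro ballI impI)
      fix e assume e: "e \<in> darts G" "dend e = v"
      obtain e0 where e0: "e0 \<in> darts G" "dend e0 = v" "face e0 \<in> Y \<longleftrightarrow> face (a\<^sub>0, True) \<in> Y"
        using ex by blast
      have "face e \<in> Y \<longleftrightarrow> face e0 \<in> Y"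
        by (rule const_at_vertex[of v _ e e0]) (use e e0 rv in auto)
      then show "face e \<in> Y \<longleftrightarrow> face (a\<^sub>0, True) \<in> Y" using e0 by simp
    qed
  qed
  show ?thesis using *[of "dend d"] d by auto
qed

section \<open>The cycle space modulo 2\<close>

definition cycles :: "'b set set" where
  "cycles = {A. A \<subseteq> arcs G \<and> (\<forall>v\<in>verts G. even (card {c \<in> A. inc c v}))}"

text \<open>Two sets of faces with the same boundary differ by a set whose boundary is empty; by
  \<open>dual_connected\<close> it contains all faces or none. Leaving out one face excludes the
  former.\<close>

lemma boundary_inj: "inj_on boundary (Pow (faces G \<rho> - {face (a\<^sub>0, True)}))"
proof (rule inj_onI)
  fix X Y
  assume X: "X \<in> Pow (faces G \<rho> - {face (a\<^sub>0, True)})" and Y: "Y \<in> Pow (faces G \<rho> - {face (a\<^sub>0, True)})"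
    and e: "boundary X = boundary Y"
  let ?D = "(X - Y) \<union> (Y - X)"
  have "face (c, True) \<in> ?D \<longleftrightarrow> face (c, False) \<in> ?D" if "c \<in> arcs G" for c
  proof -
    have "c \<in> boundary X \<longleftrightarrow> c \<in> boundary Y" using e by simp
    then show ?thesis using that by (auto simp: boundary_def)
  qed
  then have "face d \<notin> ?D" if "d \<in> darts G" for d
    using dual_connected[of ?D d] that X Y by blast
  then have "f \<notin> ?D" if "f \<in> faces G \<rho>" for f using that by (auto simp: faces_def)
  then show "X = Y" using X Y by blast
qed

text \<open>One incoming arc chosen at every vertex except \<open>s\<close> gives a spanning tree
  \<open>T\<close>, and a cycle is determined by its arcs outside the tree.\<close>

lemma cycles_card_le:
  "finite cycles" "card cycles \<le> 2 ^ (card (arcs G) - (card (verts G) - 1))"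
proof -
  define ch where "ch v = (SOME a. a \<in> arcs G \<and> head G a = v)" for v
  have ch: "ch v \<in> arcs G \<and> head G (ch v) = v" if "v \<in> verts G" "v \<noteq> s" for v
    unfolding ch_def using ex_in_arc[OF that] by (metis (mono_tags, lifting) someI_ex)
  define T where "T = ch ` (verts G - {s})"
  have Tsub: "T \<subseteq> arcs G" using ch by (auto simp: T_def)
  have "inj_on ch (verts G - {s})" by (rule inj_onI) (metis DiffD1 DiffD2 ch singletonI)
  then have cT: "card T = card (verts G) - 1" using s_verts by (simp add: T_def card_image)
  show fin: "finite cycles"
    by (rule finite_subset[of _ "Pow (arcs G)"]) (auto simp: cycles_def)
  have inj: "inj_on (\<lambda>A. A - T) cycles"
  proof (rule inj_onI)
    fix A B assume A: "A \<in> cycles" and B: "B \<in> cycles" and e: "A - T = B - T"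
    let ?D = "(A - B) \<union> (B - A)"
    have DT: "?D \<subseteq> T" using e by blast
    have finD: "finite ?D" using DT Tsub finite_subset[OF _ finite_arcs] by blast
    have ev: "even (card {c \<in> ?D. inc c v})" if v: "v \<in> verts G" for v
    proof -
      have "finite A" "finite B" using A B finite_subset[OF _ finite_arcs] by (auto simp: cycles_def)
      moreover have "{c \<in> ?D. inc c v} = ({c \<in> A. inc c v} - {c \<in> B. inc c v}) \<union> ({c \<in> B. inc c v} - {c \<in> A. inc c v})"
        by auto
      ultimately show ?thesis
        using even_card_sym_diff[of "{c \<in> A. inc c v}" "{c \<in> B. inc c v}"] A B v
        by (simp add: cycles_def)
    qed
    \<comment> \<open>An arc of \<open>?D\<close> whose head has maximal rank is the only one at its
      head: other arcs of \<open>T\<close> have other heads, and an arc leaving that head would end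
      higher. This contradicts even degree.\<close>
    have "?D = {}"
    proof (rule ccontr)
      assume "?D \<noteq> {}"
      then obtain c where c: "c \<in> ?D" and m: "\<And>x. x \<in> ?D \<Longrightarrow> rank (head G x) \<le> rank (head G c)"
        by (rule finite_has_max[OF finD, of "\<lambda>x. rank (head G x)"]) blast
      let ?v = "head G c"
      have cT: "c \<in> T" using c DT by blast
      then have ca: "c \<in> arcs G" using Tsub by blast
      have "x = c" if x: "x \<in> ?D" "inc x ?v" for x
      proof (cases "head G x = ?v")
        case True
        have "x \<in> T" using x DT by blast
        then obtain u u' where "x = ch u" "c = ch u'" "u \<in> verts G - {s}" "u' \<in> verts G - {s}"
          using cT by (auto simp: T_def)
        then show ?thesis using True ch[of u] ch[of u'] by simp
      next
        case False
        then have "tail G x = ?v" using x by (simp add: inc_def)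
        moreover have "x \<in> arcs G" using x DT Tsub by blast
        ultimately show ?thesis using rank[of x] m[OF x(1)] by simp
      qed
      then have "{x \<in> ?D. inc x ?v} = {c}" using c by (auto simp: inc_def)
      then show False using ev[of ?v] ca by simp
    qed
    then show "A = B" by blast
  qed
  have "card cycles \<le> card (Pow (arcs G - T))"
    using inj by (rule card_inj_on_le) (auto simp: cycles_def)
  also have "\<dots> = 2 ^ (card (arcs G) - (card (verts G) - 1))"
    using Tsub cT finite_subset[OF Tsub finite_arcs] by (simp add: card_Pow card_Diff_subset)
  finally show "card cycles \<le> 2 ^ (card (arcs G) - (card (verts G) - 1))" .
qed

text \<open>
  A plane graph has no homology: the dimensions of the cycle space and of the boundary space agree
  by Euler's formula.
\<close>

lemma cycle_is_boundary:
  assumes "A \<in> cycles"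
  shows "\<exists>X. A = boundary X"
proof -
  let ?P = "Pow (faces G \<rho> - {face (a\<^sub>0, True)})"
  have sub: "boundary ` ?P \<subseteq> cycles"
    using boundary_even by (auto simp: cycles_def) (auto simp: boundary_def)
  have f0: "face (a\<^sub>0, True) \<in> faces G \<rho>" using a0 by simp
  have "card (boundary ` ?P) = 2 ^ (card (faces G \<rho>) - 1)"
    using boundary_inj f0 by (simp add: card_image card_Pow)
  moreover have "card (verts G) \<ge> 1" "card (faces G \<rho>) \<ge> 1"
    using s_verts f0 by (simp_all add: Suc_le_eq card_gt_0_iff, blast+)
  then have "card (arcs G) - (card (verts G) - 1) = card (faces G \<rho>) - 1"
    using euler by simp
  ultimately have "boundary ` ?P = cycles"
    using cycles_card_le sub by (intro card_seteq) auto
  then show ?thesis using assms by blast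
qed

text \<open>Degree with multiplicities, since a walk may repeat arcs; chains are reduced modulo 2
  only in \<open>even_chain_boundary\<close>.\<close>

definition deg :: "('b \<Rightarrow> nat) \<Rightarrow> 'a \<Rightarrow> nat" where
  "deg A v = (\<Sum>c\<in>arcs G. if inc c v then A c else 0)"

lemma even_sum_iff_card:
  fixes f :: "'c \<Rightarrow> nat"
  shows "finite S \<Longrightarrow> even (sum f S) \<longleftrightarrow> even (card {x \<in> S. odd (f x)})"
proof (induction S rule: finite_induct)
  case (insert x S)
  have "{y \<in> insert x S. odd (f y)} = (if odd (f x) then insert x {y \<in> S. odd (f y)} else {y \<in> S. odd (f y)})"
    by auto
  then show ?case using insert by auto
qed simp

lemma even_chain_boundary:
  assumes "\<And>v. v \<in> verts G \<Longrightarrow> even (deg A v)"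
  obtains X where "\<And>c. c \<in> arcs G \<Longrightarrow> odd (A c) \<longleftrightarrow> (face (c, True) \<in> X) \<noteq> (face (c, False) \<in> X)"
proof -
  have "{c \<in> arcs G. odd (A c)} \<in> cycles"
    unfolding cycles_def
  proof (intro CollectI conjI ballI)
    fix v assume "v \<in> verts G"
    then have "even (card {c \<in> arcs G. odd (if inc c v then A c else 0)})"
      using assms by (simp add: deg_def even_sum_iff_card)
    moreover have "{c \<in> arcs G. odd (if inc c v then A c else 0)} = {c \<in> {c \<in> arcs G. odd (A c)}. inc c v}"
      by auto
    ultimately show "even (card {c \<in> {c \<in> arcs G. odd (A c)}. inc c v})" by simp
  qed blast
  then obtain X where "{c \<in> arcs G. odd (A c)} = boundary X" using cycle_is_boundary by blast
  then show ?thesis using that[of X] by (auto simp: boundary_def)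
qed

end

section \<open>Edges between siblings\<close>

context embedded_planar_st_graph
begin

abbreviation nxt :: "'b \<Rightarrow> 'b" where "nxt a \<equiv> nx (tail G a) a"

text \<open>
  \<open>a \<in> siblings\<close> means that \<open>a\<close> and \<open>nxt a\<close> are consecutive in the list of arcs to the successors of
  \<open>tail G a\<close>. The inner face between them has its sink at the head of \<open>a\<close> iff \<open>sink_left a\<close>, and at
  the head of \<open>nxt a\<close> iff \<open>sink_right (nxt a)\<close>; then it contains a path between the two heads.
\<close>

definition siblings :: "'b set" where
  "siblings = {a \<in> arcs G. (a, False) \<in> FT \<and> nxt a \<noteq> a\<^sub>0}"

definition sink_left :: "'b \<Rightarrow> bool" where
  "sink_left a \<longleftrightarrow> (\<exists>d\<in>TF. fs d = (a, False))"

definition sink_right :: "'b \<Rightarrow> bool" where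
  "sink_right b \<longleftrightarrow> (b, True) \<in> TF"

lemma fs_False: "a \<in> arcs G \<Longrightarrow> fs (a, False) = (nxt a, tail G (nxt a) = tail G a)"
  by (simp add: fs_eq)

lemma siblings_fs: "a \<in> siblings \<Longrightarrow> fs (a, False) = (nxt a, True)"
  by (auto simp: siblings_def FT_def fs_False)

lemma siblings_arcs [simp]: "a \<in> siblings \<Longrightarrow> a \<in> arcs G"
  by (simp add: siblings_def)

lemma siblings_tail: "a \<in> siblings \<Longrightarrow> tail G (nxt a) = tail G a"
  using siblings_fs[of a] fs_False[of a] by simp

lemma siblings_nxt [simp]: "a \<in> siblings \<Longrightarrow> nxt a \<in> arcs G"
  using siblings_fs[of a] fs_darts[of "(a, False)"] by simp

lemma nxt_inj: "a \<in> siblings \<Longrightarrow> b \<in> siblings \<Longrightarrow> nxt a = nxt b \<Longrightarrow> a = b"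
  using inj_onD[OF fs_inj, of "(a, False)" "(b, False)"] siblings_fs by simp

lemma rank_reach: "(x, y) \<in> (arcs_ends G)\<^sup>* \<Longrightarrow> rank x \<le> rank y"
  by (induction rule: rtrancl_induct) (auto simp: arcs_ends_conv dest!: rank)

text \<open>\<open>TF_inj\<close> makes the sink corner unique; here the face is seen to pass the
  vertex of its sink only once. Every end on the face reaches that vertex, so \<open>dend d\<close>
  has maximal rank on the face, which forces \<open>d\<close> to be a sink corner too.\<close>

lemma face_sink_unique:
  assumes d: "d \<in> darts G" and w: "w \<in> TF" "face w = face d" and e: "dend d = dend w"
  shows "d = w"
proof -
  have *: "rank (dend d') \<le> rank (dend d)" if "d' \<in> darts G" "face d' = face d" for d'
    using reach_face_sink[OF that(1) w(1)] that(2) w(2) e rank_reach by simp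
  obtain d' where d': "d' \<in> darts G" "fs d' = d" "face d' = face d" by (rule face_pred[OF d]) blast
  have "rank (dstart d) \<le> rank (dend d)" using *[OF d'(1,3)] dstart_fs[OF d'(1)] d'(2) by simp
  then have "snd d" using rank_dart[OF d] rank_neq[OF d] by simp
  moreover have "rank (dend (fs d)) \<le> rank (dend d)" using * d by simp
  then have "\<not> snd (fs d)" using rank_dart[OF fs_darts[OF d]] dstart_fs[OF d] by simp
  ultimately have "d \<in> TF" using d by (simp add: TF_def)
  then show ?thesis using inj_onD[OF TF_inj, of d w] w by simp
qed

text \<open>Translates the tests at corners, which can be read off the rotations, into equality with
  the sink of the face. Both the insertion of edges and the necessity of the criterion rest on
  it.\<close>

lemma siblings_sink:
  assumes a: "a \<in> siblings"
  obtains w where "w \<in> TF" "face w = face (a, False)"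
    "(head G a, dend w) \<in> (arcs_ends G)\<^sup>*" "(head G (nxt a), dend w) \<in> (arcs_ends G)\<^sup>*"
    "sink_left a \<longleftrightarrow> head G a = dend w" "sink_right (nxt a) \<longleftrightarrow> head G (nxt a) = dend w"
proof -
  have ad: "(a, False) \<in> darts G" using a by simp
  have bd: "(nxt a, True) \<in> darts G" using a by simp
  have bf: "face (nxt a, True) = face (a, False)" using face_fs[OF ad] siblings_fs[OF a] by simp
  obtain w where w: "w \<in> TF" "face w = face (a, False)" using face_has_TF[OF ad] by blast
  obtain d where d: "d \<in> darts G" "fs d = (a, False)" "face d = face (a, False)"
    by (rule face_pred[OF ad]) blast
  have dh: "dend d = head G a" using dstart_fs[OF d(1)] d(2) by simp
  have "sink_left a \<longleftrightarrow> d \<in> TF"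
    unfolding sink_left_def using d inj_onD[OF fs_inj] TF_darts by metis
  also have "\<dots> \<longleftrightarrow> head G a = dend w"
    using face_sink_unique[OF d(1) w(1)] w d dh inj_onD[OF TF_inj, of d w] by auto
  finally have l: "sink_left a \<longleftrightarrow> head G a = dend w" .
  have r: "sink_right (nxt a) \<longleftrightarrow> head G (nxt a) = dend w"
    unfolding sink_right_def
    using face_sink_unique[OF bd w(1)] w bf inj_onD[OF TF_inj, of "(nxt a, True)" w] by auto
  show ?thesis
    using that[OF w _ _ l r] reach_face_sink[OF d(1) w(1)] reach_face_sink[OF bd w(1)] w d bf dh by simp
qed

lemma s_reaches: "v \<in> verts G \<Longrightarrow> (s, v) \<in> (arcs_ends G)\<^sup>*"
proof (induction "rank v" arbitrary: v rule: less_induct)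
  case less
  show ?case
  proof (cases "v = s")
    case False
    then obtain a where a: "a \<in> arcs G" "head G a = v" using ex_in_arc less.prems by blast
    then have "(s, tail G a) \<in> (arcs_ends G)\<^sup>*" using less.hyps[of "tail G a"] rank[OF a(1)] by simp
    then show ?thesis using arc_edge[OF a(1)] a by (auto intro: rtrancl_into_rtrancl)
  qed simp
qed

lemma reaches_t: assumes v: "v \<in> verts G" shows "(v, t) \<in> (arcs_ends G)\<^sup>*"
proof -
  let ?X = "{z \<in> verts G. (v, z) \<in> (arcs_ends G)\<^sup>*}"
  have "?X \<noteq> {}" "finite ?X" using v by auto
  then obtain z where z: "z \<in> ?X" and m: "\<And>y. y \<in> ?X \<Longrightarrow> rank y \<le> rank z"
    using finite_has_max[of ?X rank] by blast
  have "z = t"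
  proof (rule ccontr)
    assume "z \<noteq> t"
    then obtain a where a: "a \<in> arcs G" "tail G a = z" using ex_out_arc z by blast
    then have "head G a \<in> ?X" using z arc_edge[OF a(1)] by (auto intro: rtrancl_into_rtrancl)
    then show False using m rank[OF a(1)] a by fastforce
  qed
  then show ?thesis using z by simp
qed

text \<open>An arc can receive a contribution from the inserted edge on either side of it; by
  \<open>nxt_inj\<close> the sum has at most one term.\<close>

definition chain :: "('b \<Rightarrow> nat) \<Rightarrow> ('b \<Rightarrow> nat) \<Rightarrow> 'b \<Rightarrow> nat" where
  "chain N m c = N c + m c + (\<Sum>b\<in>{b \<in> siblings. nxt b = c}. m b)"

lemma deg_add: "c \<in> arcs G \<Longrightarrow> deg (\<lambda>x. A x + of_bool (x = c)) v = deg A v + of_bool (inc c v)"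
proof -
  assume c: "c \<in> arcs G"
  have "deg (\<lambda>x. A x + of_bool (x = c)) v
      = (\<Sum>x\<in>arcs G. (if inc x v then A x else 0) + (if x = c then of_bool (inc c v) else 0))"
    unfolding deg_def by (rule sum.cong) auto
  also have "\<dots> = deg A v + of_bool (inc c v)"
    using c by (simp add: sum.distrib deg_def)
  finally show ?thesis .
qed

lemma chain_0: "chain (\<lambda>_. 0) (\<lambda>_. 0) = (\<lambda>_. 0)"
  by (simp add: chain_def fun_eq_iff)

lemma chain_add_arc: "chain (N(c := Suc (N c))) m = (\<lambda>x. chain N m x + of_bool (x = c))"
  by (auto simp: chain_def)

lemma pre_nxt: "b \<in> siblings \<Longrightarrow> {b' \<in> siblings. nxt b' = nxt b} = {b}"
  using nxt_inj by auto

lemma chain_add_sibling: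
  assumes b: "b \<in> siblings"
  shows "chain N (m(b := Suc (m b)))
    = (\<lambda>x. (chain N m x + of_bool (x = b)) + of_bool (x = nxt b))"
proof
  fix x
  have "(\<Sum>b'\<in>{b' \<in> siblings. nxt b' = x}. (m(b := Suc (m b))) b')
      = (\<Sum>b'\<in>{b' \<in> siblings. nxt b' = x}. m b') + of_bool (x = nxt b)"
  proof (cases "x = nxt b")
    case True
    then show ?thesis using pre_nxt[OF b] by simp
  next
    case False
    then show ?thesis by (auto intro!: sum.cong)
  qed
  then show "chain N (m(b := Suc (m b))) x = (chain N m x + of_bool (x = b)) + of_bool (x = nxt b)"
    by (auto simp: chain_def)
qed

text \<open>
  The edge inserted between the heads of two siblings runs inside the face between them. As a chain
  it is replaced by the two arcs from \<open>tail G a\<close>, and the multiplicity \<open>m\<close> records that the corner of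
  the face at \<open>tail G a\<close> was cut off.
\<close>

definition sib_edge :: "('b \<Rightarrow> bool) \<Rightarrow> 'b \<Rightarrow> 'a \<times> 'a" where
  "sib_edge D a = (if D a then (head G (nxt a), head G a) else (head G a, head G (nxt a)))"

text \<open>Invariant of a walk from \<open>y\<close> to \<open>p\<close> inside
  \<open>\<Gamma>\<close>: its chain has odd degree exactly at the two ends, and nowhere if they
  coincide. Only the heads of \<open>b\<close> and \<open>nxt b\<close> must lie in
  \<open>\<Gamma>\<close>; their common tail, through which the chain also passes, is not a vertex
  of the walk.\<close>

definition linked :: "'b set \<Rightarrow> 'a set \<Rightarrow> 'a \<Rightarrow> 'a \<Rightarrow> ('b \<Rightarrow> nat) \<Rightarrow> ('b \<Rightarrow> nat) \<Rightarrow> bool" where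
  "linked M \<Gamma> y p N m \<longleftrightarrow>
     (\<forall>c. N c > 0 \<longrightarrow> tail G c \<in> \<Gamma> \<and> head G c \<in> \<Gamma>) \<and>
     (\<forall>b. m b > 0 \<longrightarrow> b \<in> M \<and> head G b \<in> \<Gamma> \<and> head G (nxt b) \<in> \<Gamma>) \<and>
     (\<forall>v. even (deg (chain N m) v + of_bool (v = y) + of_bool (v = p)))"

lemma linked_arc:
  assumes l: "linked M \<Gamma> y p N m" and c: "c \<in> arcs G" "tail G c = p" "p \<in> \<Gamma>" "head G c \<in> \<Gamma>"
  shows "linked M \<Gamma> y (head G c) (N(c := Suc (N c))) m"
proof -
  have "even (deg (chain N m) v + of_bool (inc c v) + of_bool (v = y) + of_bool (v = head G c))" for v
  proof -
    have "even (deg (chain N m) v + of_bool (v = y) + of_bool (v = p))" using l by (simp add: linked_def)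
    moreover have "deg (chain N m) v + of_bool (inc c v) + of_bool (v = y) + of_bool (v = head G c)
        = (deg (chain N m) v + of_bool (v = y) + of_bool (v = p)) + 2 * of_bool (v = head G c)"
      using c no_loops[OF c(1)] by (auto simp: inc_def)
    ultimately show ?thesis by (metis dvd_add dvd_triv_left)
  qed
  then have "even (deg (chain (N(c := Suc (N c))) m) v + of_bool (v = y) + of_bool (v = head G c))" for v
    by (simp only: chain_add_arc deg_add[OF c(1)])
  then show ?thesis using l c unfolding linked_def by auto
qed

text \<open>Both added arcs meet \<open>tail G b\<close>, so the parity changes at the two heads
  only, and the direction of the inserted edge is immaterial modulo 2.\<close>

lemma linked_sibling:
  assumes l: "linked M \<Gamma> y p N m" and b: "b \<in> siblings"
    and pq: "(p, q) = (head G b, head G (nxt b)) \<or> (q, p) = (head G b, head G (nxt b))"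
    and \<Gamma>: "p \<in> \<Gamma>" "q \<in> \<Gamma>"
  shows "linked (insert b M) \<Gamma> y q N (m(b := Suc (m b)))"
proof -
  have "even (deg (chain N m) v + of_bool (inc b v) + of_bool (inc (nxt b) v) + of_bool (v = y) + of_bool (v = q))" for v
  proof -
    have ar: "a + i + i' + e + f = (a + e + g) + 2 * (t' + f)"
      if "i = t' + h" "i' = t' + h'" "g + f = h + h'" for a i i' e f g t' h h' :: nat
      using that by simp
    have ev: "even (deg (chain N m) v + of_bool (v = y) + of_bool (v = p))" using l by (simp add: linked_def)
    have "of_bool (inc b v) = (of_bool (v = tail G b) + of_bool (v = head G b) :: nat)"
      using no_loops[OF siblings_arcs[OF b]] by (auto simp: inc_def)
    moreover have "of_bool (inc (nxt b) v) = (of_bool (v = tail G b) + of_bool (v = head G (nxt b)) :: nat)"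
      using no_loops[OF siblings_nxt[OF b]] siblings_tail[OF b] by (auto simp: inc_def)
    moreover have "of_bool (v = p) + of_bool (v = q)
        = (of_bool (v = head G b) + of_bool (v = head G (nxt b)) :: nat)"
      using pq by auto
    ultimately have "deg (chain N m) v + of_bool (inc b v) + of_bool (inc (nxt b) v) + of_bool (v = y) + of_bool (v = q)
        = (deg (chain N m) v + of_bool (v = y) + of_bool (v = p)) + 2 * (of_bool (v = tail G b) + of_bool (v = q))"
      by (rule ar)
    with ev show ?thesis by (metis dvd_add dvd_triv_left)
  qed
  then have "even (deg (chain N (m(b := Suc (m b)))) v + of_bool (v = y) + of_bool (v = q))" for v
    by (simp only: chain_add_sibling[OF b] deg_add[OF siblings_arcs[OF b]] deg_add[OF siblings_nxt[OF b]])
  then show ?thesis using l pq \<Gamma> unfolding linked_def by auto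
qed

text \<open>\<open>\<Gamma>\<close> consists of all vertices between \<open>y\<close> and
  \<open>x\<close>, not only those on one walk. It thus stays fixed during the induction, and
  membership yields paths from \<open>y\<close> and to \<open>x\<close>.\<close>

lemma linked_path:
  assumes MS: "M \<subseteq> siblings" and path: "(y, p) \<in> (arcs_ends G \<union> sib_edge D ` M)\<^sup>*"
    and px: "(p, x) \<in> (arcs_ends G \<union> sib_edge D ` M)\<^sup>*"
  shows "\<exists>N m. linked M {p. (y, p) \<in> (arcs_ends G \<union> sib_edge D ` M)\<^sup>* \<and> (p, x) \<in> (arcs_ends G \<union> sib_edge D ` M)\<^sup>*} y p N m"
  using path px
proof (induction rule: rtrancl_induct)
  case base
  have "linked M \<Gamma> y y (\<lambda>_. 0) (\<lambda>_. 0)" for \<Gamma>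
    by (auto simp: linked_def chain_0 deg_def)
  then show ?case by blast
next
  case (step p q)
  let ?H = "arcs_ends G \<union> sib_edge D ` M"
  let ?\<Gamma> = "{p. (y, p) \<in> ?H\<^sup>* \<and> (p, x) \<in> ?H\<^sup>*}"
  have pG: "p \<in> ?\<Gamma>" using step by (auto intro: converse_rtrancl_into_rtrancl)
  have qG: "q \<in> ?\<Gamma>" using step by (auto intro: rtrancl_into_rtrancl)
  obtain N m where l: "linked M ?\<Gamma> y p N m" using step pG by blast
  from step(2) show ?case
  proof
    assume "(p, q) \<in> arcs_ends G"
    then obtain c where "c \<in> arcs G" "tail G c = p" "head G c = q" by (auto simp: arcs_ends_conv)
    then show ?thesis using linked_arc[OF l, of c] pG qG by blast
  next
    assume "(p, q) \<in> sib_edge D ` M"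
    then obtain b where b: "b \<in> M" "(p, q) = sib_edge D b" by auto
    then have "linked (insert b M) ?\<Gamma> y q N (m(b := Suc (m b)))"
      using MS pG qG by (intro linked_sibling[OF l]) (auto simp: sib_edge_def split: if_splits)
    then show ?thesis using b by (auto simp: insert_absorb)
  qed
qed

text \<open>By \<open>siblings_sink\<close> the condition on \<open>D\<close> says that no inserted
  edge leaves the sink of its face; in a face whose sink is neither head, both directions are
  allowed.\<close>

lemma acyclic_siblings:
  assumes "finite M" "M \<subseteq> siblings"
    and "\<And>a. a \<in> M \<Longrightarrow> if D a then \<not> sink_right (nxt a) else \<not> sink_left a"
  shows "acyclic (arcs_ends G \<union> sib_edge D ` M)"
  using assms
proof (induction M rule: finite_induct)
  case empty
  then show ?case using acyclic by simp
next
  case (insert a M)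
  let ?H = "arcs_ends G \<union> sib_edge D ` M"
  have aS: "a \<in> siblings" and MS: "M \<subseteq> siblings" using insert.prems by auto
  have H: "acyclic ?H" using insert by simp
  obtain x y where xy: "sib_edge D a = (x, y)" by fastforce
  then have xy': "(x, y) = (head G a, head G (nxt a)) \<or> (y, x) = (head G a, head G (nxt a))"
    by (auto simp: sib_edge_def split: if_splits)
  obtain w where w: "w \<in> TF" "face w = face (a, False)"
    and reach: "(head G a, dend w) \<in> (arcs_ends G)\<^sup>*" "(head G (nxt a), dend w) \<in> (arcs_ends G)\<^sup>*"
    and lr: "sink_left a \<longleftrightarrow> head G a = dend w" "sink_right (nxt a) \<longleftrightarrow> head G (nxt a) = dend w"
    by (rule siblings_sink[OF aS]) blast
  have xw: "x \<noteq> dend w" "(x, dend w) \<in> (arcs_ends G)\<^sup>*"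
    using insert.prems(2)[of a] xy lr reach by (auto simp: sib_edge_def split: if_splits)
  have "(y, x) \<notin> ?H\<^sup>*"
  proof
    assume yx: "(y, x) \<in> ?H\<^sup>*"
    let ?\<Gamma> = "{p. (y, p) \<in> ?H\<^sup>* \<and> (p, x) \<in> ?H\<^sup>*}"
    define \<Gamma> where "\<Gamma> = ?\<Gamma>"
    have xG: "x \<in> \<Gamma>" "y \<in> \<Gamma>" using yx by (auto simp: \<Gamma>_def)
    obtain N m0 where l0: "linked M \<Gamma> y x N m0"
      unfolding \<Gamma>_def using linked_path[OF MS yx] by blast
    define m where "m = m0(a := Suc (m0 a))"
    have l: "linked (insert a M) \<Gamma> y y N m"
      unfolding m_def by (rule linked_sibling[OF l0 aS]) (use xy' xG in auto)
    \<comment> \<open>The walk from \<open>y\<close> to \<open>x\<close> uses earlier edges only, so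
      the closed walk passes the new edge exactly once. This odd multiplicity yields the
      contradiction at the end.\<close>
    have "m0 a = 0" using l0 insert.hyps(2) by (auto simp: linked_def)
    then have ma: "m a = 1" by (simp add: m_def)
    have N: "N c = 0" if "tail G c \<notin> \<Gamma> \<or> head G c \<notin> \<Gamma>" for c
      using l that unfolding linked_def by blast
    have m: "m b = 0" if "b \<notin> siblings \<or> head G b \<notin> \<Gamma> \<or> head G (nxt b) \<notin> \<Gamma>" for b
      using l that insert.prems(1) unfolding linked_def by blast
    have "even (deg (chain N m) v)" for v
    proof -
      have "even (deg (chain N m) v + of_bool (v = y) + of_bool (v = y))"
        using l unfolding linked_def by blast
      then show ?thesis by auto
    qed
    then obtain X where X: "\<And>c. c \<in> arcs G \<Longrightarrow>
        odd (chain N m c) \<longleftrightarrow> (face (c, True) \<in> X) \<noteq> (face (c, False) \<in> X)"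
      by (rule even_chain_boundary) blast
    \<comment> \<open>The side of the closed walk on which the corner following \<open>d\<close>
      lies. A corner cut off an odd number of times is on the other side from the rest of its
      face.\<close>
    define val where "val d \<longleftrightarrow> (face d \<in> X) \<noteq> (\<not> snd d \<and> odd (m (fst d)))" for d
    have flag: "snd d \<or> m (fst d) = 0" if d: "d \<in> darts G" "\<not> snd (fs d)" for d
    proof (cases "snd d")
      case False
      then have "d = (fst d, False)" by (cases d) auto
      then have "fst d \<notin> siblings" using d siblings_fs by (metis snd_conv)
      then show ?thesis using m[of "fst d"] by simp
    qed simp
    \<comment> \<open>Off \<open>\<Gamma>\<close>, an arc out of \<open>v\<close> carries only the
      inserted edges on its two sides, which are the corrections made by \<open>val\<close> at the
      two adjacent corners; an arc into \<open>v\<close> carries nothing. So the side does not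
      change around \<open>v\<close>.\<close>
    have step: "val d \<longleftrightarrow> val (rev_dart (fs d))"
      if d: "d \<in> darts G" "dend d = v" "v \<notin> \<Gamma>" for d v
    proof -
      obtain c b where cb: "fs d = (c, b)" by fastforce
      have c: "c \<in> arcs G" using fs_darts[OF d(1)] cb by simp
      have fd: "face d = face (c, b)" using face_fs[OF d(1)] cb by simp
      show ?thesis
      proof (cases b)
        case True
        have tc: "tail G c = v" using dstart_fs[OF d(1)] cb d True by simp
        have "(\<Sum>b\<in>{b \<in> siblings. nxt b = c}. m b) = (if \<not> snd d then m (fst d) else 0)"
        proof (cases "\<not> snd d \<and> fst d \<in> siblings")
          case T: True
          then have "d = (fst d, False)" by (cases d) auto
          then have "nxt (fst d) = c" using siblings_fs[of "fst d"] T cb by simp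
          then show ?thesis using T pre_nxt[of "fst d"] by simp
        next
          case False
          have "{b \<in> siblings. nxt b = c} = {}"
          proof (rule equals0I)
            fix b assume b: "b \<in> {b \<in> siblings. nxt b = c}"
            then have "fs (b, False) = fs d" using siblings_fs[of b] cb True by simp
            then have "(b, False) = d" using inj_onD[OF fs_inj] b d by simp
            then show False using False b by auto
          qed
          then have "(\<Sum>b\<in>{b \<in> siblings. nxt b = c}. m b) = 0" by (simp only: sum.empty)
          then show ?thesis using False m[of "fst d"] by auto
        qed
        then have "odd (chain N m c) \<longleftrightarrow> odd (m c) \<noteq> (\<not> snd d \<and> odd (m (fst d)))"
          using N[of c] tc d by (auto simp: chain_def)
        then show ?thesis using X[OF c] cb fd True by (auto simp: val_def rev_dart_def)
      next
        case False
        have hc: "head G c = v" using dstart_fs[OF d(1)] cb d False by simp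
        have "m b = 0" if "nxt b = c" for b using m[of b] that hc d by simp
        then have "(\<Sum>b\<in>{b \<in> siblings. nxt b = c}. m b) = 0" by simp
        then have "chain N m c = 0" using N[of c] m[of c] hc d by (simp add: chain_def)
        then show ?thesis using X[OF c] cb fd False flag[OF d(1)] by (auto simp: val_def rev_dart_def)
      qed
    qed
    have const: "val d \<longleftrightarrow> val d'"
      if "d \<in> darts G" "d' \<in> darts G" "dend d' = dend d" "dend d \<notin> \<Gamma>" for d d'
      by (rule const_at_vertex[of "dend d"]) (use that step in auto)
    \<comment> \<open>The face to the right of \<open>c\<close> has a corner at either end of
      \<open>c\<close>. The one at the head is no source of the face, and the one at the tail is not
      cut off because the head is off \<open>\<Gamma>\<close>; so both are on the same side.\<close>
    have edge: "val d \<longleftrightarrow> val d'"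
      if c: "c \<in> arcs G" and d: "d \<in> darts G" "dend d = tail G c" "tail G c \<notin> \<Gamma>"
        and d': "d' \<in> darts G" "dend d' = head G c" "head G c \<notin> \<Gamma>" for c d d'
    proof -
      have cd: "(c, False) \<in> darts G" using c by simp
      obtain e where e: "e \<in> darts G" "fs e = (c, False)" "face e = face (c, False)"
        by (rule face_pred[OF cd]) blast
      have "dend e = head G c" using dstart_fs[OF e(1)] e(2) by simp
      then have "val d' \<longleftrightarrow> val e" using const[of d' e] e d' by simp
      also have "\<dots> \<longleftrightarrow> face (c, False) \<in> X" using flag[OF e(1)] e by (auto simp: val_def)
      also have "\<dots> \<longleftrightarrow> val (c, False)" using m[of c] d' by (simp add: val_def)
      also have "\<dots> \<longleftrightarrow> val d" using const[of d "(c, False)"] c d by simp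
      finally show ?thesis by simp
    qed
    have path: "\<forall>d d'. d \<in> darts G \<longrightarrow> d' \<in> darts G \<longrightarrow> dend d = p \<longrightarrow> dend d' = q \<longrightarrow> (val d \<longleftrightarrow> val d')"
      if "(p, q) \<in> (arcs_ends G)\<^sup>*" "\<And>z. (p, z) \<in> (arcs_ends G)\<^sup>* \<Longrightarrow> (z, q) \<in> (arcs_ends G)\<^sup>* \<Longrightarrow> z \<notin> \<Gamma>" for p q
      using that
    proof (induction rule: rtrancl_induct)
      case base
      then have "p \<notin> \<Gamma>" by blast
      then show ?case by (intro allI impI) (rule const, simp_all)
    next
      case (step q r)
      obtain c where c: "c \<in> arcs G" "tail G c = q" "head G c = r"
        using step(2) by (auto simp: arcs_ends_conv)
      have q: "q \<notin> \<Gamma>" using step.prems[of q] step.hyps by blast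
      have r: "r \<notin> \<Gamma>" using step.prems[of r] step.hyps by (meson rtrancl.simps)
      have IH: "\<forall>d d'. d \<in> darts G \<longrightarrow> d' \<in> darts G \<longrightarrow> dend d = p \<longrightarrow> dend d' = q \<longrightarrow> (val d \<longleftrightarrow> val d')"
      proof (rule step.IH)
        fix z assume "(p, z) \<in> (arcs_ends G)\<^sup>*" "(z, q) \<in> (arcs_ends G)\<^sup>*"
        then show "z \<notin> \<Gamma>" using step.prems[of z] step.hyps(2) by (meson rtrancl.simps)
      qed
      have cq: "(c, False) \<in> darts G" "dend (c, False) = q" using c by auto
      show ?case
      proof (intro allI impI)
        fix d d' assume d: "d \<in> darts G" "d' \<in> darts G" "dend d = p" "dend d' = r"
        have "val d \<longleftrightarrow> val (c, False)" using IH cq d by blast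
        also have "\<dots> \<longleftrightarrow> val d'" by (rule edge[OF c(1) cq(1)]) (use c cq d q r in auto)
        finally show "val d \<longleftrightarrow> val d'" .
      qed
    qed
    let ?u = "tail G a"
    have HE: "(z, z') \<in> ?H\<^sup>*" if "(z, z') \<in> (arcs_ends G)\<^sup>*" for z z'
      using that by (rule rev_subsetD) (rule rtrancl_mono, blast)
    \<comment> \<open>A vertex of \<open>\<Gamma>\<close> is reachable from \<open>y\<close>, and
      \<open>y\<close> is the head of an arc from \<open>?u\<close>; a path on to \<open>?u\<close>
      would close a cycle that existed before the insertion.\<close>
    have u: "z \<notin> \<Gamma>" if "(z, ?u) \<in> (arcs_ends G)\<^sup>*" for z
    proof
      assume "z \<in> \<Gamma>"
      then have "(y, ?u) \<in> ?H\<^sup>*" using HE[OF that] by (auto simp: \<Gamma>_def)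
      moreover have "(?u, y) \<in> ?H"
        using arc_edge[of a] arc_edge[of "nxt a"] siblings_tail[OF aS] aS xy' by auto
      ultimately show False using H unfolding acyclic_def by (meson rtrancl_into_trancl1)
    qed
    \<comment> \<open>This is where the condition on \<open>D\<close> enters: \<open>x\<close> is
      not the sink of the face, hence reaches it by a nonempty path, and a vertex of
      \<open>\<Gamma>\<close> beyond the sink would lead back to \<open>x\<close>.\<close>
    have w': "z \<notin> \<Gamma>" if "(dend w, z) \<in> (arcs_ends G)\<^sup>*" for z
    proof
      assume "z \<in> \<Gamma>"
      then have "(dend w, x) \<in> ?H\<^sup>*" using HE[OF that] by (auto simp: \<Gamma>_def)
      moreover have "(x, dend w) \<in> ?H\<^sup>+"
        using HE[OF xw(2)] xw(1) by (meson rtranclD)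
      ultimately show False using H unfolding acyclic_def by (meson trancl_rtrancl_trancl)
    qed
    have wd: "w \<in> darts G" using TF_darts w by blast
    have a0d: "(a\<^sub>0, True) \<in> darts G" using a0 by simp
    obtain d0 where d0: "d0 \<in> darts G" "fs d0 = (a\<^sub>0, True)" "face d0 = face (a\<^sub>0, True)"
      by (rule face_pred[OF a0d]) blast
    have d0s: "dend d0 = s" using dstart_fs[OF d0(1)] d0(2) a0 by simp
    \<comment> \<open>The corner of the outer face at \<open>s\<close> is never cut off, because
      \<open>siblings\<close> excludes the predecessor of \<open>a\<^sub>0\<close>.\<close>
    have "m (fst d0) = 0 \<or> snd d0"
    proof (cases "snd d0")
      case False
      then obtain z where e: "d0 = (z, False)" by (cases d0) auto
      have "z \<notin> siblings"
      proof
        assume z: "z \<in> siblings"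
        then have "nxt z = a\<^sub>0" using siblings_fs[OF z] d0(2) e by simp
        then show False using z unfolding siblings_def by blast
      qed
      then show ?thesis using m[of z] e by simp
    qed simp
    then have vs: "val d0 \<longleftrightarrow> face (a\<^sub>0, True) \<in> X" using d0 by (auto simp: val_def)
    obtain d1 where d1: "d1 \<in> face (a\<^sub>0, True)" "dstart d1 = t" using outer_sink by blast
    have d1d: "d1 \<in> darts G" "face d1 = face (a\<^sub>0, True)" using d1 a0 by (auto simp: face_iff)
    obtain d2 where d2: "d2 \<in> darts G" "fs d2 = d1" "face d2 = face d1"
      by (rule face_pred[OF d1d(1)]) blast
    have d2t: "dend d2 = t" using dstart_fs[OF d2(1)] d2 d1 by simp
    then have "snd d2" using tail_neq_t[of "fst d2"] d2(1) by (cases d2) (auto simp: dart_end_def split: if_splits)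
    then have vt: "val d2 \<longleftrightarrow> face (a\<^sub>0, True) \<in> X" using d2 d1d by (simp add: val_def)
    have vw: "val w \<longleftrightarrow> face (a, False) \<in> X" using w by (auto simp: val_def TF_def)
    \<comment> \<open>The corner at the source of the face is cut off once and the corner at its
      sink is not, so they are on different sides, whereas the corners at \<open>s\<close> and
      \<open>t\<close> are on the same side.\<close>
    have vu: "val (a, False) \<longleftrightarrow> face (a, False) \<notin> X" using ma by (auto simp: val_def)
    have "(s, ?u) \<in> (arcs_ends G)\<^sup>*" using s_reaches[of ?u] aS by simp
    then have "val d0 \<longleftrightarrow> val (a, False)"
      by (rule path[rule_format]) (use u d0 d0s aS in simp_all)
    moreover have "(dend w, t) \<in> (arcs_ends G)\<^sup>*" using reaches_t[of "dend w"] wd by simp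
    then have "val w \<longleftrightarrow> val d2"
      by (rule path[rule_format]) (use w' wd d2 d2t in simp_all)
    ultimately show False using vs vt vw vu by simp
  qed
  then have "acyclic (insert (x, y) ?H)" using H by simp
  then show ?case using xy by simp
qed

end

section \<open>Successor lists\<close>

lemma dropWhile_all_not:
  assumes "\<And>i. Suc i < length zs \<Longrightarrow> \<not> P (zs ! i) \<Longrightarrow> \<not> P (zs ! Suc i)"
    and "x \<in> set (dropWhile P zs)"
  shows "\<not> P x"
proof -
  let ?k = "length (takeWhile P zs)"
  have eq: "dropWhile P zs = drop ?k zs" by (simp add: dropWhile_eq_drop)
  have "\<not> P (zs ! (?k + j))" if "?k + j < length zs" for j
    using that
  proof (induction j)
    case 0 then show ?case using nth_length_takeWhile[of P zs] by simp
  next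
    case (Suc j) then show ?case using assms(1)[of "?k + j"] by simp
  qed
  moreover obtain j where "j < length (drop ?k zs)" "x = drop ?k zs ! j"
    using assms(2) unfolding eq by (metis in_set_conv_nth)
  ultimately show ?thesis by (simp add: less_diff_conv add.commute)
qed

lemma bitonic_if_switch:
  assumes ne: "ps \<noteq> []"
    and D: "\<And>i j. D i \<Longrightarrow> i \<le> j \<Longrightarrow> D j"
    and step: "\<And>i. Suc i < length ps \<Longrightarrow> if D i then ps ! Suc i < ps ! i else ps ! i < ps ! Suc i"
  shows "bitonic ps"
proof -
  \<comment> \<open>The peak: the first index from which the list descends, or the last index if
    there is none. It counts from 0, whereas \<open>bitonic\<close> counts from 1.\<close>
  define h where "h = (LEAST i. D i \<or> Suc i = length ps)"
  have ex: "D (length ps - 1) \<or> Suc (length ps - 1) = length ps" using ne by (cases ps) auto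
  have h: "D h \<or> Suc h = length ps" unfolding h_def by (rule LeastI[of "\<lambda>i. D i \<or> Suc i = length ps", OF ex])
  have hl: "h < length ps"
    using Least_le[of "\<lambda>i. D i \<or> Suc i = length ps", OF ex] ne by (cases ps) (auto simp: h_def)
  have nh: "\<not> D i" if "i < h" for i
    using not_less_Least[of i "\<lambda>i. D i \<or> Suc i = length ps"] that by (auto simp: h_def)
  have "sorted_wrt (<) (take (Suc h) ps)"
    using hl nh step by (subst sorted_wrt_iff_nth_Suc_transp) (auto intro!: transpI)
  moreover have "sorted_wrt (>) (drop h ps)"
  proof (subst sorted_wrt_iff_nth_Suc_transp)
    show "transp ((>) :: nat \<Rightarrow> nat \<Rightarrow> bool)" by (auto intro!: transpI)
    show "\<forall>i. Suc i < length (drop h ps) \<longrightarrow> drop h ps ! i > drop h ps ! Suc i"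
    proof (intro allI impI)
      fix i assume i: "Suc i < length (drop h ps)"
      then have "D h" using h by auto
      then have "D (h + i)" using D by simp
      then show "drop h ps ! i > drop h ps ! Suc i" using step[of "h + i"] i by simp
    qed
  qed
  ultimately show ?thesis unfolding bitonic_def using hl by (intro bexI[of _ "Suc h"]) auto
qed

lemma bitonic_no_valley:
  assumes b: "bitonic ps" and i: "i \<le> j" "Suc j < length ps"
    and down: "ps ! Suc i < ps ! i" and up: "ps ! j < ps ! Suc j"
  shows False
proof -
  obtain h where h: "h \<in> {1..length ps}" "sorted_wrt (<) (take h ps)" "sorted_wrt (>) (drop (h - 1) ps)"
    using b by (auto simp: bitonic_def)
  show False
  proof (cases "Suc i < h")
    case True
    then show False using sorted_wrt_nth_less[OF h(2), of i "Suc i"] down h(1) i by simp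
  next
    case False
    obtain k where k: "h = Suc k" using h(1) by (cases h) auto
    have "j - k < Suc j - k" "Suc j - k < length (drop k ps)" using k False i by simp_all
    then have "drop k ps ! (j - k) > drop k ps ! (Suc j - k)"
      using sorted_wrt_nth_less[OF h(3), of "j - k" "Suc j - k"] k by simp
    then show False using up k False i by simp
  qed
qed

lemma same_cycle_same_hd:
  assumes d: "distinct zs" "distinct zs'" and c: "cycle_of_list zs = cycle_of_list zs'"
    and l: "length zs = length zs'" and h: "hd zs = hd zs'"
  shows "zs = zs'"
proof (rule nth_equalityI[OF l])
  fix i assume "i < length zs"
  then show "zs ! i = zs' ! i"
  proof (induction i)
    case 0 then show ?case using h l by (metis hd_conv_nth length_greater_0_conv)
  next
    case (Suc i)
    then show ?case
      using distinct_rotate1_cycle[OF d(1), of i] distinct_rotate1_cycle[OF d(2), of i] c l by simp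
  qed
qed

section \<open>Successor lists are well defined\<close>

context embedded_planar_st_graph
begin

text \<open>The condition inside the description operator of \<open>succ_arcs\<close>, with the
  incoming part \<open>ys\<close> exposed, so that existence and uniqueness of \<open>xs\<close> can
  be proved first.\<close>

definition succ_split :: "'a \<Rightarrow> 'b list \<Rightarrow> 'b list \<Rightarrow> bool" where
  "succ_split u xs ys \<longleftrightarrow> (\<exists>k. rotate k (\<rho> u) = xs @ ys \<and> set xs = out_arcs G u \<and> set ys = in_arcs G u \<and>
      (u = s \<longrightarrow> hd xs = a\<^sub>0))"

lemma not_in_and_out: "a \<in> in_arcs G u \<Longrightarrow> a \<notin> out_arcs G u"
  using no_loops[of a] by auto

lemma succ_split_rotation:
  assumes "u \<in> verts G" "succ_split u xs ys"
  shows "distinct (xs @ ys)" "cycle_of_list (xs @ ys) = nx u" "length (xs @ ys) = length (\<rho> u)"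
    "set xs = out_arcs G u" "set ys = in_arcs G u"
proof -
  obtain k where k: "rotate k (\<rho> u) = xs @ ys" "set xs = out_arcs G u" "set ys = in_arcs G u"
    using assms(2) unfolding succ_split_def by blast
  have d: "distinct (\<rho> u)" using assms(1) by simp
  show "distinct (xs @ ys)" using d distinct_rotate[of k "\<rho> u"] unfolding k(1) by simp
  show "cycle_of_list (xs @ ys) = nx u"
    using cycle_of_list_rotate_independent[OF d, of k] unfolding k(1) by simp
  show "length (xs @ ys) = length (\<rho> u)" using length_rotate[of k "\<rho> u"] unfolding k(1) .
qed (use assms(2) in \<open>auto simp: succ_split_def\<close>)

lemma TT_fs:
  assumes a: "a \<in> in_arcs G u" and b: "nx u a \<in> out_arcs G u"
  shows "(a, True) \<in> TT" "fs (a, True) = (nx u a, True)"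
  using assms by (auto simp: TT_def fs_eq)

text \<open>The list starts right after the turn from incoming to outgoing arcs. By
  \<open>TT_inj\<close> there is only one such corner at \<open>u\<close>, so it fixes the first
  entry whatever the starting point of \<open>\<rho> u\<close>.\<close>

lemma succ_split_first:
  assumes u: "u \<in> verts G" "u \<noteq> s" "out_arcs G u \<noteq> {}" and sp: "succ_split u xs ys"
  shows "(last ys, True) \<in> TT" "dend (last ys, True) = u" "fs (last ys, True) = (hd xs, True)"
proof -
  note r = succ_split_rotation[OF u(1) sp]
  have xs: "xs \<noteq> []" using r u by auto
  have ys: "ys \<noteq> []" using r ex_in_arc[OF u(1,2)] by auto
  have "cycle_of_list (xs @ ys) ((xs @ ys) ! (length (xs @ ys) - 1)) = (xs @ ys) ! 0"
    using distinct_rotate1_cycle[OF r(1), of "length (xs @ ys) - 1"] ys by (cases ys) auto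
  moreover have "(xs @ ys) ! (length (xs @ ys) - 1) = last ys"
    using ys by (metis append_is_Nil_conv last_appendR last_conv_nth)
  moreover have "(xs @ ys) ! 0 = hd xs" using xs by (simp add: nth_append hd_conv_nth)
  ultimately have n: "nx u (last ys) = hd xs" using r by simp
  have l: "last ys \<in> in_arcs G u" "hd xs \<in> out_arcs G u" using xs ys r by auto
  then show "(last ys, True) \<in> TT" "dend (last ys, True) = u" "fs (last ys, True) = (hd xs, True)"
    using TT_fs[OF l(1)] n by auto
qed

lemma succ_split_unique:
  assumes u: "u \<in> verts G" "out_arcs G u \<noteq> {}" and sp: "succ_split u xs ys" "succ_split u xs' ys'"
  shows "xs = xs'"
proof -
  note r = succ_split_rotation[OF u(1) sp(1)] and r' = succ_split_rotation[OF u(1) sp(2)]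
  have xs: "xs \<noteq> []" "xs' \<noteq> []" using r r' u by auto
  have h: "hd xs = hd xs'"
  proof (cases "u = s")
    case True then show ?thesis using sp by (simp add: succ_split_def)
  next
    case False
    note f = succ_split_first[OF u(1) False u(2) sp(1)] succ_split_first[OF u(1) False u(2) sp(2)]
    have "(last ys, True) = (last ys', True)" using inj_onD[OF TT_inj] f by metis
    then show ?thesis using f by simp
  qed
  then have "xs @ ys = xs' @ ys'"
    using r r' xs by (intro same_cycle_same_hd) (auto simp: hd_append)
  moreover have "length xs = length xs'"
    using r(1,4) r'(1,4) by (metis distinct_append distinct_card)
  ultimately show ?thesis by simp
qed

text \<open>The rotation is cut right after its corner in \<open>TT\<close>, at \<open>s\<close>
  before \<open>a\<^sub>0\<close>. If an outgoing arc came after a non-outgoing one, it would give a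
  second corner in \<open>TT\<close> at \<open>u\<close>.\<close>

lemma succ_split_exists:
  assumes u: "u \<in> verts G" "out_arcs G u \<noteq> {}"
  shows "\<exists>xs ys. succ_split u xs ys"
proof -
  have rot: "\<exists>k zs. rotate k (\<rho> u) = a # zs" if a: "a \<in> set (\<rho> u)" for a
  proof -
    obtain ps qs where "\<rho> u = ps @ a # qs" using split_list[OF a] by blast
    then show ?thesis using rotate_append[of ps "a # qs"] by (metis append_Cons)
  qed
  show ?thesis
  proof (cases "u = s")
    case True
    have "a\<^sub>0 \<in> set (\<rho> u)" using True a0 u by (simp add: set_rho_iff)
    then obtain k zs where k: "rotate k (\<rho> u) = a\<^sub>0 # zs" using rot by blast
    then have "set (a\<^sub>0 # zs) = set (\<rho> u)" by (metis set_rotate)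
    then have "succ_split u (a\<^sub>0 # zs) []"
      unfolding succ_split_def using k set_rho[OF u(1)] s_no_in True by auto
    then show ?thesis by blast
  next
    case False
    have "u \<noteq> t" using t_no_out u by auto
    then obtain d where d: "d \<in> TT" "dend d = u" using vertex_has_TT_FF[OF u(1) False] by blast
    then obtain x where x: "d = (x, True)" "x \<in> in_arcs G u" "nx u x \<in> out_arcs G u"
      using nx_in_rho[of d] u(1) by (cases d) (auto simp: TT_def fs_eq set_rho_iff)
    have "nx u x \<in> set (\<rho> u)" using x set_rho[OF u(1)] by simp
    then obtain k zs' where k: "rotate k (\<rho> u) = nx u x # zs'" using rot by blast
    define zs where "zs = nx u x # zs'"
    have zd: "distinct zs" "set zs = in_arcs G u \<union> out_arcs G u" "cycle_of_list zs = nx u"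
      using k set_rho[OF u(1)] distinct_rotate[of k "\<rho> u"] set_rotate[of k "\<rho> u"] u(1)
        cycle_of_list_rotate_independent[of "\<rho> u" k] by (simp_all add: zs_def)
    let ?P = "\<lambda>a. a \<in> out_arcs G u"
    have step: "\<not> ?P (zs ! Suc i)" if i: "Suc i < length zs" "\<not> ?P (zs ! i)" for i
    proof
      assume o: "?P (zs ! Suc i)"
      have n: "nx u (zs ! i) = zs ! Suc i" using distinct_rotate1_cycle[OF zd(1), of i] i zd(3) by simp
      have "zs ! i \<in> set zs" using i by simp
      then have zi: "zs ! i \<in> in_arcs G u" using zd(2) i(2) by blast
      have "(zs ! i, True) = d" using inj_onD[OF TT_inj, of "(zs ! i, True)" d] TT_fs[OF zi] n o d zi by auto
      then have "zs ! Suc i = zs ! 0" using n x by (simp add: zs_def)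
      moreover have "zs ! Suc i \<noteq> zs ! 0"
        using nth_eq_iff_index_eq[OF zd(1), of "Suc i" 0] i by (cases zs) auto
      ultimately show False by simp
    qed
    let ?xs = "takeWhile ?P zs" and ?ys = "dropWhile ?P zs"
    have ys: "set ?ys \<subseteq> - out_arcs G u" using dropWhile_all_not[of zs ?P, OF step] by blast
    have xs: "set ?xs \<subseteq> out_arcs G u" by (auto dest: set_takeWhileD)
    have un: "set ?xs \<union> set ?ys = in_arcs G u \<union> out_arcs G u"
      using zd(2) by (metis set_append takeWhile_dropWhile_id)
    have "set ?xs = out_arcs G u" "set ?ys = in_arcs G u"
      using xs ys un not_in_and_out by blast+
    then have "succ_split u ?xs ?ys"
      unfolding succ_split_def using False k takeWhile_dropWhile_id[of ?P zs] by (auto simp: zs_def)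
    then show ?thesis by blast
  qed
qed

abbreviation succs :: "'a \<Rightarrow> 'b list" where "succs \<equiv> succ_arcs G s \<rho> a\<^sub>0"

lemma succ_split_succs:
  assumes u: "u \<in> verts G" "out_arcs G u \<noteq> {}"
  shows "\<exists>ys. succ_split u (succs u) ys"
proof -
  obtain xs ys where sp: "succ_split u xs ys" using succ_split_exists[OF u] by blast
  have "succs u = (THE xs. \<exists>ys. succ_split u xs ys)"
    unfolding succ_arcs_def succ_split_def by (rule arg_cong[where f=The]) blast
  also have "\<dots> = xs"
    by (rule the_equality) (use sp succ_split_unique[OF u] in blast)+
  finally show ?thesis using sp by blast
qed

lemma succs_set: "u \<in> verts G \<Longrightarrow> out_arcs G u \<noteq> {} \<Longrightarrow> set (succs u) = out_arcs G u"
  and succs_distinct: "u \<in> verts G \<Longrightarrow> out_arcs G u \<noteq> {} \<Longrightarrow> distinct (succs u)"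
  and succs_s: "hd (succs s) = a\<^sub>0"
proof -
  show "set (succs u) = out_arcs G u" "distinct (succs u)" if "u \<in> verts G" "out_arcs G u \<noteq> {}"
    using succ_split_succs[OF that] succ_split_rotation[OF that(1)] by (auto simp: distinct_append)
  have "out_arcs G s \<noteq> {}" using a0 by auto
  then show "hd (succs s) = a\<^sub>0" using succ_split_succs[OF s_verts] by (auto simp: succ_split_def)
qed

lemma succs_hd:
  assumes "u \<in> verts G" "u \<noteq> s" "out_arcs G u \<noteq> {}"
  shows "\<exists>d\<in>TT. dend d = u \<and> fs d = (hd (succs u), True)"
  using succ_split_succs[OF assms(1,3)] succ_split_first[OF assms] by blast

lemma succs_nxt:
  assumes u: "u \<in> verts G" "out_arcs G u \<noteq> {}" and i: "Suc i < length (succs u)"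
  shows "succs u ! i \<in> siblings" "nxt (succs u ! i) = succs u ! Suc i"
proof -
  obtain ys where sp: "succ_split u (succs u) ys" using succ_split_succs[OF u] by blast
  note r = succ_split_rotation[OF u(1) sp]
  have si: "succs u ! i \<in> out_arcs G u" "succs u ! Suc i \<in> out_arcs G u"
    using i r(4) nth_mem by (metis Suc_lessD)+
  have n: "nx u (succs u ! i) = succs u ! Suc i"
    using distinct_rotate1_cycle[OF r(1), of i] i r(2) by (simp add: nth_append)
  then show e: "nxt (succs u ! i) = succs u ! Suc i" using si by simp
  have "succs u ! Suc i \<noteq> a\<^sub>0"
  proof
    assume e: "succs u ! Suc i = a\<^sub>0"
    then have "u = s" using si a0 by auto
    then have "succs u ! 0 = a\<^sub>0" using succs_s i by (metis hd_conv_nth length_0_conv less_nat_zero_code)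
    moreover have "succs u ! Suc i \<noteq> succs u ! 0"
      using nth_eq_iff_index_eq[of "succs u" "Suc i" 0] r(1) i by (cases "succs u") auto
    ultimately show False using e by simp
  qed
  then have "nxt (succs u ! i) \<noteq> a\<^sub>0" using e by simp
  moreover have "succs u ! i \<in> arcs G" using si by simp
  moreover have "fs (succs u ! i, False) = (succs u ! Suc i, True)"
    using fs_False[of "succs u ! i"] e si by simp
  ultimately show "succs u ! i \<in> siblings" unfolding siblings_def FT_def by simp
qed

text \<open>After the last outgoing arc the rotation meets an incoming arc or, at \<open>s\<close>,
  returns to \<open>a\<^sub>0\<close>. With \<open>succs_nxt\<close> this identifies
  \<open>siblings\<close> with the entries of successor lists that are not last.\<close>

lemma succs_last:
  assumes u: "u \<in> verts G" "out_arcs G u \<noteq> {}"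
  shows "last (succs u) \<notin> siblings"
proof
  assume l: "last (succs u) \<in> siblings"
  obtain ys where sp: "succ_split u (succs u) ys" using succ_split_succs[OF u] by blast
  note r = succ_split_rotation[OF u(1) sp]
  have xs: "succs u \<noteq> []" using r(4) u by auto
  let ?n = "length (succs u)"
  have lu: "tail G (last (succs u)) = u" using xs r(4) last_in_set by fastforce
  have "nx u (last (succs u)) = (succs u @ ys) ! (?n mod length (succs u @ ys))"
    using distinct_rotate1_cycle[OF r(1), of "?n - 1"] r(2) xs
    by (cases "succs u") (auto simp: nth_append last_conv_nth)
  then have n: "nxt (last (succs u)) = (if ys = [] then hd (succs u) else hd ys)"
    using xs lu by (auto simp: nth_append hd_conv_nth)
  show False
  proof (cases "ys = []")
    case True
    then have "in_arcs G u = {}" using r(5) by simp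
    then have "u = s" using ex_in_arc[OF u(1)] by (metis empty_iff in_in_arcs_conv)
    then have "nxt (last (succs u)) = a\<^sub>0" using n True succs_s by simp
    then show False using l unfolding siblings_def by blast
  next
    case False
    then have "hd ys \<in> in_arcs G u" using r(5) by auto
    then show False using siblings_tail[OF l] n False lu no_loops[of "hd ys"] by auto
  qed
qed

lemma siblings_out: "a \<in> siblings \<Longrightarrow> tail G a \<in> verts G \<and> out_arcs G (tail G a) \<noteq> {}"
  using siblings_arcs[of a] by (metis empty_iff in_out_arcs_conv tail_in_verts)

lemma sibling_index:
  assumes a: "a \<in> siblings"
  obtains j where "Suc j < length (succs (tail G a))" "succs (tail G a) ! j = a"
proof -
  let ?u = "tail G a"
  have u: "?u \<in> verts G" "out_arcs G ?u \<noteq> {}" using siblings_out[of a] a by auto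
  have "a \<in> set (succs ?u)" using succs_set[OF u] a by simp
  then obtain j where j: "j < length (succs ?u)" "succs ?u ! j = a" by (metis in_set_conv_nth)
  moreover have "Suc j \<noteq> length (succs ?u)"
    using succs_last[OF u] a j by (metis diff_Suc_1 last_conv_nth length_0_conv less_nat_zero_code)
  ultimately show ?thesis using that[of j] by simp
qed

text \<open>
  The greedy direction: along the successors of a vertex, switch to decreasing at the first face that
  forces it.
\<close>

definition descends :: "'b \<Rightarrow> bool" where
  "descends a \<longleftrightarrow> (\<exists>i j. i \<le> j \<and> j < length (succs (tail G a)) \<and> succs (tail G a) ! j = a \<and>
     sink_left (succs (tail G a) ! i))"

lemma descends_nth:
  assumes u: "u \<in> verts G" "out_arcs G u \<noteq> {}" and j: "j < length (succs u)"
  shows "descends (succs u ! j) \<longleftrightarrow> (\<exists>i\<le>j. sink_left (succs u ! i))"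
proof -
  have "tail G (succs u ! j) = u" using succs_set[OF u] nth_mem[OF j] by auto
  then show ?thesis
    unfolding descends_def using succs_distinct[OF u] j by (auto simp: nth_eq_iff_index_eq)
qed

section \<open>The criterion: sufficiency and necessity\<close>

definition no_conflict :: bool where
  "no_conflict \<longleftrightarrow> (\<forall>a\<in>siblings. descends a \<longrightarrow> \<not> sink_right (nxt a))"

lemma finite_siblings: "finite siblings"
  by (rule finite_subset[OF _ finite_arcs]) auto

text \<open>The greedy rule meets the condition of \<open>acyclic_siblings\<close>: an ascending
  edge does not start at the sink, because \<open>sink_left a\<close> would have switched to descent
  at \<open>a\<close> itself, and a descending edge does not by \<open>no_conflict\<close>.\<close>

lemma acyclic_augmented:
  assumes no_conflict
  shows "acyclic (arcs_ends G \<union> sib_edge descends ` siblings)"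
proof (rule acyclic_siblings[OF finite_siblings subset_refl])
  fix a assume a: "a \<in> siblings"
  obtain j where j: "Suc j < length (succs (tail G a))" "succs (tail G a) ! j = a"
    by (rule sibling_index[OF a]) blast
  then have "sink_left a \<Longrightarrow> descends a" unfolding descends_def by (intro exI[of _ j]) auto
  then show "if descends a then \<not> sink_right (nxt a) else \<not> sink_left a"
    using assms a by (auto simp: no_conflict_def)
qed

lemma length_successors [simp]: "length (successors G s \<rho> a\<^sub>0 u) = length (succs u)"
  by (simp add: successors_def)

lemma bitonic_of_augmented:
  assumes bij: "bij_betw \<pi> (verts G) {1..card (verts G)}"
    and inc: "\<And>x y. (x, y) \<in> arcs_ends G \<union> sib_edge descends ` siblings \<Longrightarrow> \<pi> x < \<pi> y"
  shows "bitonic_st_ordering G s \<rho> a\<^sub>0 \<pi>"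
  unfolding bitonic_st_ordering_def st_ordering_def
proof (intro conjI ballI impI)
  show "bij_betw \<pi> (verts G) {1..card (verts G)}" by (rule bij)
  show "\<pi> (tail G a) < \<pi> (head G a)" if "a \<in> arcs G" for a
    using inc arc_edge[OF that] by blast
  fix u assume u: "u \<in> verts G" "out_arcs G u \<noteq> {}"
  let ?D = "\<lambda>j. \<exists>i\<le>j. sink_left (succs u ! i)"
  show "bitonic (map \<pi> (successors G s \<rho> a\<^sub>0 u))"
  proof (rule bitonic_if_switch[where D = ?D])
    show "map \<pi> (successors G s \<rho> a\<^sub>0 u) \<noteq> []"
      using succs_set[OF u] u by (auto simp: successors_def)
    show "?D i \<Longrightarrow> i \<le> j \<Longrightarrow> ?D j" for i j using order_trans by blast
    fix i assume "Suc i < length (map \<pi> (successors G s \<rho> a\<^sub>0 u))"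
    then have i: "Suc i < length (succs u)" by simp
    note n = succs_nxt[OF u i]
    have "sib_edge descends (succs u ! i) \<in> sib_edge descends ` siblings" using n by blast
    moreover have "descends (succs u ! i) \<longleftrightarrow> ?D i" using descends_nth[OF u] i by simp
    ultimately show "if ?D i then map \<pi> (successors G s \<rho> a\<^sub>0 u) ! Suc i < map \<pi> (successors G s \<rho> a\<^sub>0 u) ! i
      else map \<pi> (successors G s \<rho> a\<^sub>0 u) ! i < map \<pi> (successors G s \<rho> a\<^sub>0 u) ! Suc i"
      using inc i n by (auto simp: sib_edge_def successors_def split: if_splits)
  qed
qed

lemma reach_increasing:
  assumes inc: "\<And>a. a \<in> arcs G \<Longrightarrow> \<pi> (tail G a) < \<pi> (head G a)"
    and "(x, y) \<in> (arcs_ends G)\<^sup>*"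
  shows "\<pi> x \<le> (\<pi> y :: nat)"
  using assms(2)
proof (induction rule: rtrancl_induct)
  case (step y z)
  then obtain a where "a \<in> arcs G" "tail G a = y" "head G a = z" by (auto simp: arcs_ends_conv)
  then show ?case using inc[of a] step.IH by simp
qed simp

text \<open>A forced descent at \<open>i\<close> and a forced ascent at \<open>j \<ge> i\<close>
  make a valley. Reaching the sink of the face gives weak inequalities only; they are strict because
  distinct arcs from \<open>?u\<close> have distinct heads.\<close>

lemma no_conflict_of_bitonic:
  assumes b: "bitonic_st_ordering G s \<rho> a\<^sub>0 \<pi>"
  shows no_conflict
  unfolding no_conflict_def
proof (intro ballI impI notI)
  fix a assume a: "a \<in> siblings" "descends a" "sink_right (nxt a)"
  let ?u = "tail G a"
  have u: "?u \<in> verts G" "out_arcs G ?u \<noteq> {}" using siblings_out[of a] a by auto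
  have inc: "\<pi> (tail G a) < \<pi> (head G a)" if "a \<in> arcs G" for a
    using b that by (auto simp: bitonic_st_ordering_def st_ordering_def)
  have bij: "inj_on \<pi> (verts G)"
    using b by (auto simp: bitonic_st_ordering_def st_ordering_def bij_betw_def)
  let ?ps = "map \<pi> (successors G s \<rho> a\<^sub>0 ?u)"
  have bi: "bitonic ?ps" using b u by (auto simp: bitonic_st_ordering_def)
  have ne: "?ps ! i \<noteq> ?ps ! Suc i" if i: "Suc i < length (succs ?u)" for i
  proof -
    have "succs ?u ! i \<in> out_arcs G ?u" "succs ?u ! Suc i \<in> out_arcs G ?u"
      using i succs_set[OF u] by (metis Suc_lessD nth_mem)+
    moreover have "succs ?u ! i \<noteq> succs ?u ! Suc i"
      using i succs_distinct[OF u] by (simp add: nth_eq_iff_index_eq)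
    ultimately have "head G (succs ?u ! i) \<noteq> head G (succs ?u ! Suc i)"
      using no_multi_arcs[of "succs ?u ! i" "succs ?u ! Suc i"] by (auto simp: arc_to_ends_def)
    then show ?thesis using i \<open>succs ?u ! i \<in> _\<close> \<open>succs ?u ! Suc i \<in> _\<close> inj_onD[OF bij]
      by (auto simp: successors_def)
  qed
  obtain i j where ij: "i \<le> j" "j < length (succs ?u)" "succs ?u ! j = a" "sink_left (succs ?u ! i)"
    using a(2) unfolding descends_def by blast
  have j: "Suc j < length (succs ?u)"
    using sibling_index[OF a(1)] ij succs_distinct[OF u] by (metis nth_eq_iff_index_eq Suc_lessD)
  then have i: "Suc i < length (succs ?u)" using ij by simp
  have "?ps ! Suc i \<le> ?ps ! i"
  proof -
    note n = succs_nxt[OF u i]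
    obtain w where "(head G (nxt (succs ?u ! i)), dend w) \<in> (arcs_ends G)\<^sup>*"
      "sink_left (succs ?u ! i) \<longleftrightarrow> head G (succs ?u ! i) = dend w"
      by (rule siblings_sink[OF n(1)]) blast
    then show ?thesis using reach_increasing[OF inc] ij n i by (simp add: successors_def)
  qed
  moreover have "?ps ! j \<le> ?ps ! Suc j"
  proof -
    note n = succs_nxt[OF u j]
    obtain w where "(head G (succs ?u ! j), dend w) \<in> (arcs_ends G)\<^sup>*"
      "sink_right (nxt (succs ?u ! j)) \<longleftrightarrow> head G (nxt (succs ?u ! j)) = dend w"
      by (rule siblings_sink[OF n(1)]) blast
    then show ?thesis using reach_increasing[OF inc] ij n j a(3) by (simp add: successors_def)
  qed
  ultimately show False
    using bitonic_no_valley[OF bi ij(1)] ne[OF i] ne[OF j] j by simp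
qed

end

section \<open>Running programs\<close>

primrec loop_free :: "prog \<Rightarrow> bool" where
  "loop_free Skip = True"
| "loop_free (Write k e f) = True"
| "loop_free (Seq p q) = (loop_free p \<and> loop_free q)"
| "loop_free (If b p q) = (loop_free p \<and> loop_free q)"
| "loop_free (While b p) = False"

text \<open>Meant for loop bodies and other programs without loops; the value for
  \<open>While\<close> is a dummy.\<close>

primrec effect :: "prog \<Rightarrow> store \<Rightarrow> store" where
  "effect Skip \<sigma> = \<sigma>"
| "effect (Write k e f) \<sigma> = \<sigma>(k := (\<sigma> k)(exp_val e \<sigma> := exp_val f \<sigma>))"
| "effect (Seq p q) \<sigma> = effect q (effect p \<sigma>)"
| "effect (If b p q) \<sigma> = (if test_val b \<sigma> then effect p \<sigma> else effect q \<sigma>)"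
| "effect (While b p) \<sigma> = \<sigma>"

text \<open>Adding both branches of an \<open>If\<close> gives a bound that does not depend on the
  store.\<close>

primrec max_cost :: "prog \<Rightarrow> nat" where
  "max_cost Skip = 1"
| "max_cost (Write k e f) = exp_cost e + exp_cost f + 1"
| "max_cost (Seq p q) = max_cost p + max_cost q"
| "max_cost (If b p q) = test_cost b + max_cost p + max_cost q"
| "max_cost (While b p) = 0"

definition runs :: "prog \<Rightarrow> store \<Rightarrow> nat \<Rightarrow> store \<Rightarrow> bool" where
  "runs p \<sigma> B \<sigma>' \<longleftrightarrow> (\<exists>T\<le>B. exec p \<sigma> T \<sigma>')"

lemma runs_loop_free: "loop_free p \<Longrightarrow> runs p \<sigma> (max_cost p) (effect p \<sigma>)"
proof (induction p arbitrary: \<sigma>)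
  case Skip then show ?case unfolding runs_def by (intro exI[of _ 1]) (simp add: exec.Skip[simplified])
next
  case (Write k e f) show ?case
    unfolding runs_def by (intro exI[of _ "exp_cost e + exp_cost f + 1"]) (use exec.Write in simp)
next
  case (Seq p q)
  then obtain T U where "T \<le> max_cost p" "exec p \<sigma> T (effect p \<sigma>)"
    "U \<le> max_cost q" "exec q (effect p \<sigma>) U (effect q (effect p \<sigma>))"
    unfolding runs_def by (metis loop_free.simps(3))
  then show ?case unfolding runs_def by (intro exI[of _ "T + U"]) (auto intro: exec.Seq)
next
  case (If b p q)
  then obtain T U where t: "T \<le> max_cost p" "exec p \<sigma> T (effect p \<sigma>)"
    "U \<le> max_cost q" "exec q \<sigma> U (effect q \<sigma>)"
    unfolding runs_def by (metis loop_free.simps(4))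
  show ?case
  proof (cases "test_val b \<sigma>")
    case True
    then show ?thesis using t unfolding runs_def
      by (intro exI[of _ "test_cost b + T"]) (auto intro: exec.IfTrue)
  next
    case False
    then show ?thesis using t unfolding runs_def
      by (intro exI[of _ "test_cost b + U"]) (auto intro: exec.IfFalse)
  qed
qed simp

lemma runs_Seq: "runs p \<sigma> B \<sigma>' \<Longrightarrow> runs q \<sigma>' C \<sigma>'' \<Longrightarrow> runs (Seq p q) \<sigma> (B + C) \<sigma>''"
  unfolding runs_def by (meson add_mono exec.Seq)

lemma runs_mono: "runs p \<sigma> B \<sigma>' \<Longrightarrow> B \<le> C \<Longrightarrow> runs p \<sigma> C \<sigma>'"
  unfolding runs_def using order_trans by blast

lemma runs_If: "runs (if test_val b \<sigma> then p else q) \<sigma> B \<sigma>' \<Longrightarrow> runs (If b p q) \<sigma> (test_cost b + B) \<sigma>'"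
  unfolding runs_def by (cases "test_val b \<sigma>") (auto dest: exec.IfTrue[of b \<sigma> p _ _ q] exec.IfFalse[of b \<sigma> q _ _ p] intro: add_left_mono)

text \<open>The ghost state \<open>g\<close> describes the store abstractly, and the measure
  \<open>\<mu>\<close> is taken of it. Since \<open>\<mu>\<close> drops by at least one in each
  round, it bounds the number of rounds.\<close>

lemma runs_While:
  assumes body: "loop_free p"
    and step: "\<And>g \<sigma>. I g \<sigma> \<Longrightarrow> test_val b \<sigma> \<Longrightarrow> \<exists>g'. I g' (effect p \<sigma>) \<and> \<mu> g' < (\<mu> g :: nat)"
    and init: "I g \<sigma>"
  shows "\<exists>g' \<sigma>'. runs (While b p) \<sigma> ((test_cost b + max_cost p) * \<mu> g + test_cost b) \<sigma>' \<and>
    I g' \<sigma>' \<and> \<not> test_val b \<sigma>'"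
  using init
proof (induction "\<mu> g" arbitrary: g \<sigma> rule: less_induct)
  case less
  show ?case
  proof (cases "test_val b \<sigma>")
    case False
    then show ?thesis using less.prems unfolding runs_def
      by (intro exI[of _ g] exI[of _ \<sigma>]) (auto intro!: exI[of _ "test_cost b"] exec.WhileFalse)
  next
    case True
    obtain h where h: "I h (effect p \<sigma>)" "\<mu> h < \<mu> g" using step[OF less.prems True] by blast
    obtain g' \<sigma>' where w: "runs (While b p) (effect p \<sigma>) ((test_cost b + max_cost p) * \<mu> h + test_cost b) \<sigma>'"
      "I g' \<sigma>'" "\<not> test_val b \<sigma>'"
      using less.hyps[OF h(2,1)] by blast
    obtain U where U: "exec (While b p) (effect p \<sigma>) U \<sigma>'"
      "U \<le> (test_cost b + max_cost p) * \<mu> h + test_cost b"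
      using w(1) unfolding runs_def by blast
    obtain T where T: "exec p \<sigma> T (effect p \<sigma>)" "T \<le> max_cost p"
      using runs_loop_free[OF body] unfolding runs_def by blast
    have "(test_cost b + max_cost p) * Suc (\<mu> h) \<le> (test_cost b + max_cost p) * \<mu> g"
      using h(2) by (intro mult_le_mono2) simp
    then have "test_cost b + T + U \<le> (test_cost b + max_cost p) * \<mu> g + test_cost b"
      using U(2) T(2) by simp
    then have "runs (While b p) \<sigma> ((test_cost b + max_cost p) * \<mu> g + test_cost b) \<sigma>'"
      unfolding runs_def using exec.WhileTrue[OF True T(1) U(1)] by blast
    then show ?thesis using w by blast
  qed
qed

abbreviation Var :: "nat \<Rightarrow> exp" where "Var k \<equiv> Cell k (Const 0)"
abbreviation Assign :: "nat \<Rightarrow> exp \<Rightarrow> prog" where "Assign k e \<equiv> Write k (Const 0) e"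

section \<open>Topological sorting\<close>

text \<open>With \<open>f\<close> the array of tails, this is the head of the list of edges leaving
  \<open>v\<close> after the first \<open>k\<close> edges were linked, increased by one so that
  \<open>0\<close> means the empty list.\<close>

primrec last_below :: "(nat \<Rightarrow> nat) \<Rightarrow> nat \<Rightarrow> nat \<Rightarrow> nat" where
  "last_below f v 0 = 0"
| "last_below f v (Suc k) = (if f k = v then Suc k else last_below f v k)"

lemma last_below_le: "last_below f v k \<le> k"
  by (induction k) auto

lemma last_below_pos: "last_below f v k > 0 \<Longrightarrow> f (last_below f v k - 1) = v"
  by (induction k) (auto split: if_splits)

lemma less_last_below: "e < k \<Longrightarrow> f e = v \<Longrightarrow> e < last_below f v k"
  by (induction k) (auto simp: less_Suc_eq)

lemma last_below_iff: "f e = v \<Longrightarrow> e < last_below f v k \<longleftrightarrow> e < k"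
  using less_last_below last_below_le by (meson order_less_le_trans)

text \<open>
  The edges are numbered; their tails are in array 1 and their heads in array 2, and their number
  is in array 17. The edges leaving a vertex are linked in decreasing order, starting at \<open>20\<close> and
  continuing with \<open>19\<close>. Array 21 counts the incoming edges that have not been traversed.
  Array 23 is the queue, read at position 24 and extended at position 25, and variable 26 is one more
  than the next edge to traverse (\<open>0\<close> if there is none).
\<close>

definition adjacency_prog :: prog where
  "adjacency_prog = While (Less (Var 22) (Var 17))
     (Seq (Write 19 (Var 22) (Cell 20 (Cell 1 (Var 22))))
     (Seq (Write 20 (Cell 1 (Var 22)) (Inc (Var 22)))
     (Seq (Write 21 (Cell 2 (Var 22)) (Inc (Cell 21 (Cell 2 (Var 22)))))
          (Assign 22 (Inc (Var 22))))))"

definition sort_body :: prog where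
  "sort_body = If (Eq (Var 26) (Const 0))
     (Seq (Write 6 (Cell 23 (Var 24)) (Inc (Var 24)))
     (Seq (Assign 26 (Cell 20 (Cell 23 (Var 24))))
          (Assign 24 (Inc (Var 24)))))
     (Seq (Assign 13 (Cell 2 (Dec (Var 26))))
     (Seq (Write 21 (Var 13) (Dec (Cell 21 (Var 13))))
     (Seq (If (Eq (Cell 21 (Var 13)) (Const 0))
            (Seq (Write 23 (Var 25) (Var 13)) (Assign 25 (Inc (Var 25))))
            Skip)
          (Assign 26 (Cell 19 (Dec (Var 26)))))))"

text \<open>The queue starts with the tail of \<open>a\<^sub>0\<close>, which is
  \<open>s\<close>.\<close>

definition sort_prog :: prog where
  "sort_prog =
     Seq (Seq (Write 23 (Const 0) (Cell 1 (Cell 0 (Const 2)))) (Assign 25 (Const 1)))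
         (While (Not (And (Eq (Var 24) (Var 25)) (Eq (Var 26) (Const 0)))) sort_body)"

lemma adjacency_correct:
  assumes z: "\<sigma> 20 = (\<lambda>_. 0)" "\<sigma> 21 = (\<lambda>_. 0)" "\<sigma> 22 0 = 0"
  shows "\<exists>\<sigma>'. runs adjacency_prog \<sigma> (50 * \<sigma> 17 0 + 50) \<sigma>' \<and>
    (\<forall>k. k \<notin> {19, 20, 21, 22} \<longrightarrow> \<sigma>' k = \<sigma> k) \<and>
    (\<forall>v. \<sigma>' 20 v = last_below (\<sigma> 1) v (\<sigma> 17 0)) \<and>
    (\<forall>e<\<sigma> 17 0. \<sigma>' 19 e = last_below (\<sigma> 1) (\<sigma> 1 e) e) \<and>
    (\<forall>w. \<sigma>' 21 w = card {e. e < \<sigma> 17 0 \<and> \<sigma> 2 e = w})"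
proof -
  define cnt where "cnt e w = card {e'. e' < e \<and> \<sigma> 2 e' = w}" for e w
  define I where "I e \<tau> \<longleftrightarrow> e \<le> \<sigma> 17 0 \<and> \<tau> 22 0 = e \<and> (\<forall>k. k \<notin> {19, 20, 21, 22} \<longrightarrow> \<tau> k = \<sigma> k) \<and>
    (\<forall>v. \<tau> 20 v = last_below (\<sigma> 1) v e) \<and> (\<forall>e'<e. \<tau> 19 e' = last_below (\<sigma> 1) (\<sigma> 1 e') e') \<and>
    (\<forall>w. \<tau> 21 w = cnt e w)" for e \<tau>
  let ?b = "Less (Var 22) (Var 17)"
  let ?p = "Seq (Write 19 (Var 22) (Cell 20 (Cell 1 (Var 22))))
     (Seq (Write 20 (Cell 1 (Var 22)) (Inc (Var 22)))
     (Seq (Write 21 (Cell 2 (Var 22)) (Inc (Cell 21 (Cell 2 (Var 22)))))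
          (Assign 22 (Inc (Var 22)))))"
  have "\<exists>g' \<sigma>'. runs (While ?b ?p) \<sigma> ((test_cost ?b + max_cost ?p) * (\<sigma> 17 0 - 0) + test_cost ?b) \<sigma>' \<and>
    I g' \<sigma>' \<and> \<not> test_val ?b \<sigma>'"
  proof (rule runs_While[where \<mu> = "\<lambda>e. \<sigma> 17 0 - e"])
    show "I 0 \<sigma>" using z by (simp add: I_def cnt_def)
    fix e \<tau> assume I: "I e \<tau>" and b: "test_val ?b \<tau>"
    have e: "e < \<sigma> 17 0" "\<tau> 22 0 = e" "\<tau> 1 = \<sigma> 1" "\<tau> 2 = \<sigma> 2" using I b by (auto simp: I_def)
    have "{e'. e' < Suc e \<and> \<sigma> 2 e' = w} = (if \<sigma> 2 e = w then insert e {e'. e' < e \<and> \<sigma> 2 e' = w} else {e'. e' < e \<and> \<sigma> 2 e' = w})" for w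
      by (auto simp: less_Suc_eq)
    then have c: "cnt (Suc e) w = cnt e w + of_bool (\<sigma> 2 e = w)" for w
      by (auto simp: cnt_def)
    have "I (Suc e) (effect ?p \<tau>)"
      using I e unfolding I_def by (auto simp: c less_Suc_eq)
    then show "\<exists>g'. I g' (effect ?p \<tau>) \<and> \<sigma> 17 0 - g' < \<sigma> 17 0 - e" using e by (intro exI[of _ "Suc e"]) auto
  qed simp
  then obtain g \<tau> where r: "runs (While ?b ?p) \<sigma> ((test_cost ?b + max_cost ?p) * (\<sigma> 17 0 - 0) + test_cost ?b) \<tau>"
    and I: "I g \<tau>" and nb: "\<not> test_val ?b \<tau>" by blast
  have "g = \<sigma> 17 0" using I nb by (auto simp: I_def)
  moreover have "runs adjacency_prog \<sigma> (50 * \<sigma> 17 0 + 50) \<tau>"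
    unfolding adjacency_prog_def by (rule runs_mono[OF r]) simp
  ultimately show ?thesis using I unfolding I_def cnt_def by blast
qed

text \<open>Edges are indexed, not a set of pairs, since an inserted edge may be parallel to an arc
  of the graph; counters and lists then treat the two separately.\<close>

locale topsort =
  fixes n K s :: nat and tl hd :: "nat \<Rightarrow> nat"
  assumes tl: "\<And>e. e < K \<Longrightarrow> tl e < n" and hd: "\<And>e. e < K \<Longrightarrow> hd e < n" and s: "s < n"
    and src: "\<And>w. w < n \<Longrightarrow> (\<forall>e<K. hd e \<noteq> w) \<longleftrightarrow> w = s"
    and acyc: "acyclic {(tl e, hd e) | e. e < K}"
begin

text \<open>The edges not yet traversed, where \<open>qh\<close> vertices have left the queue
  \<open>qs\<close>. Lists are linked in decreasing order, so the vertex removed last still has its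
  edges below \<open>cur\<close>.\<close>

definition U :: "nat list \<times> nat \<times> nat \<Rightarrow> nat set" where
  "U = (\<lambda>(qs, qh, cur). {e. e < K \<and> (tl e \<notin> set (take qh qs) \<or> (qh > 0 \<and> tl e = qs ! (qh - 1) \<and> e < cur))})"

text \<open>Nothing is erased from \<open>qs\<close>, so a position in it is the final number of the
  vertex, up to one.\<close>

definition I :: "nat list \<times> nat \<times> nat \<Rightarrow> store \<Rightarrow> bool" where
  "I g \<tau> \<longleftrightarrow> (case g of (qs, qh, cur) \<Rightarrow>
     \<tau> 2 = hd \<and> (\<forall>v. \<tau> 20 v = last_below tl v K) \<and> (\<forall>e<K. \<tau> 19 e = last_below tl (tl e) e) \<and>
     \<tau> 24 0 = qh \<and> \<tau> 25 0 = length qs \<and> \<tau> 26 0 = cur \<and> (\<forall>j<length qs. \<tau> 23 j = qs ! j) \<and>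
     distinct qs \<and> set qs \<subseteq> {..<n} \<and> qh \<le> length qs \<and>
     (cur > 0 \<longrightarrow> qh > 0 \<and> cur \<le> K \<and> tl (cur - 1) = qs ! (qh - 1)) \<and>
     (\<forall>w. \<tau> 21 w = card {e \<in> U g. hd e = w}) \<and>
     (\<forall>w<n. w \<in> set qs \<longleftrightarrow> (\<forall>e\<in>U g. hd e \<noteq> w)) \<and>
     (\<forall>i<qh. \<tau> 6 (qs ! i) = Suc i) \<and>
     (\<forall>j<length qs. \<forall>e<K. hd e = qs ! j \<longrightarrow> (\<exists>i<j. tl e = qs ! i)))"

definition \<mu> :: "nat list \<times> nat \<times> nat \<Rightarrow> nat" where
  "\<mu> g = (n - fst (snd g)) + card (U g)"

lemma finite_U: "finite (U g)"
  by (cases g) (auto simp: U_def)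

lemma length_le:
  assumes "distinct qs" "set qs \<subseteq> {..<n}"
  shows "length qs \<le> n"
  using card_mono[OF _ assms(2)] distinct_card[OF assms(1)] by simp

text \<open>Removing a vertex from the queue traverses nothing: its edges now count as untraversed
  because they are below the start \<open>?c\<close> of its list. Hence only \<open>qh\<close> makes
  the measure drop.\<close>

lemma step_pop:
  assumes I: "I (qs, qh, 0) \<tau>" and lt: "qh < length qs"
  shows "\<exists>g'. I g' (effect sort_body \<tau>) \<and> \<mu> g' < \<mu> (qs, qh, 0)"
proof -
  let ?v = "qs ! qh"
  let ?c = "last_below tl ?v K"
  have d: "distinct qs" "set qs \<subseteq> {..<n}" using I by (auto simp: I_def)
  have q: "\<tau> 23 qh = ?v" "\<tau> 24 0 = qh" "\<tau> 26 0 = 0" "\<tau> 20 ?v = ?c" using I lt by (auto simp: I_def)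
  have tk: "take (Suc qh) qs = take qh qs @ [?v]" using lt by (simp add: take_Suc_conv_app_nth)
  have "?v \<notin> set (take qh qs)" using d(1) lt by (metis distinct_take tk distinct_append disjoint_insert(1) list.simps(15))
  then have U: "U (qs, Suc qh, ?c) = U (qs, qh, 0)"
    unfolding U_def by (auto simp: tk last_below_iff)
  have eff: "effect sort_body \<tau> = \<tau>(6 := (\<tau> 6)(?v := Suc qh), 26 := (\<tau> 26)(0 := ?c), 24 := (\<tau> 24)(0 := Suc qh))"
    unfolding sort_body_def using q by simp
  have cur: "?c > 0 \<longrightarrow> Suc qh > 0 \<and> ?c \<le> K \<and> tl (?c - 1) = qs ! (Suc qh - 1)"
    using last_below_pos[of tl ?v K] last_below_le[of tl ?v K] by simp
  have lab: "\<forall>i<Suc qh. ((\<tau> 6)(?v := Suc qh)) (qs ! i) = Suc i"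
    using I lt d(1) by (auto simp: I_def less_Suc_eq nth_eq_iff_index_eq)
  have "I (qs, Suc qh, ?c) (effect sort_body \<tau>)"
    using I lt cur lab unfolding I_def eff U by simp
  moreover have "\<mu> (qs, Suc qh, ?c) < \<mu> (qs, qh, 0)"
    using lt length_le[OF d] unfolding \<mu>_def U by simp
  ultimately show ?thesis by blast
qed

lemma step_edge:
  assumes I: "I (qs, qh, cur) \<tau>" and c: "cur > 0"
  shows "\<exists>g'. I g' (effect sort_body \<tau>) \<and> \<mu> g' < \<mu> (qs, qh, cur)"
proof -
  let ?g = "(qs, qh, cur)"
  define e0 where "e0 = cur - 1"
  define v where "v = qs ! (qh - 1)"
  define w where "w = hd e0"
  define c' where "c' = last_below tl v e0"
  have e0: "e0 < K" "cur = Suc e0" "tl e0 = v" "qh > 0" using I c by (auto simp: I_def e0_def v_def)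
  have d: "distinct qs" "set qs \<subseteq> {..<n}" "qh \<le> length qs" using I by (auto simp: I_def)
  have q: "\<tau> 2 e0 = w" "\<tau> 19 e0 = c'" "\<tau> 26 0 = Suc e0" "\<tau> 25 0 = length qs"
    using I e0 by (auto simp: I_def w_def c'_def)
  have wn: "w < n" using hd e0 by (simp add: w_def)
  have e0U: "e0 \<in> U ?g" using e0 by (simp add: U_def v_def)
  then have wq: "w \<notin> set qs" using I wn by (auto simp: I_def w_def)
  have vq: "v \<in> set (take qh qs)" using e0(4) d(3) nth_mem[of "qh - 1" "take qh qs"] by (simp add: v_def)
  \<comment> \<open>The jump from \<open>e0\<close> to \<open>c'\<close> skips only edges with other
    tails, so exactly \<open>e0\<close> leaves the set.\<close>
  have U': "U (xs, qh, c') = U ?g - {e0}" if "take qh xs = take qh qs" "xs ! (qh - 1) = v" for xs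
    using that e0 vq unfolding U_def c'_def
    by (auto simp: last_below_iff v_def less_Suc_eq)
  have Ux: "U (qs, qh, c') = U ?g - {e0}" "U (qs @ [w], qh, c') = U ?g - {e0}"
  proof -
    have "qh - 1 < length qs" "take qh (qs @ [w]) = take qh qs" using e0(4) d(3) by simp_all
    then show "U (qs, qh, c') = U ?g - {e0}" "U (qs @ [w], qh, c') = U ?g - {e0}"
      using U'[of qs] U'[of "qs @ [w]"] by (simp_all add: v_def nth_append)
  qed
  have cu: "c' > 0 \<longrightarrow> qh > 0 \<and> c' \<le> K \<and> tl (c' - 1) = v"
    using last_below_pos[of tl v e0] last_below_le[of tl v e0] e0 by (simp add: c'_def)
  have cnt: "card {e \<in> U ?g - {e0}. hd e = x} = (if x = w then \<tau> 21 w - 1 else \<tau> 21 x)" for x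
  proof (cases "x = w")
    case True
    have "{e \<in> U ?g - {e0}. hd e = w} = {e \<in> U ?g. hd e = w} - {e0}" by auto
    then show ?thesis using True e0U I finite_U[of ?g] by (simp add: I_def w_def card_Diff_singleton)
  next
    case False
    then have "{e \<in> U ?g - {e0}. hd e = x} = {e \<in> U ?g. hd e = x}" by (auto simp: w_def)
    then show ?thesis using False I by (simp add: I_def)
  qed
  have zero: "\<tau> 21 w - 1 = 0 \<longleftrightarrow> (\<forall>e\<in>U ?g - {e0}. hd e \<noteq> w)"
  proof -
    have fin: "finite {e \<in> U ?g - {e0}. hd e = w}" using finite_U[of ?g] by simp
    have "\<tau> 21 w - 1 = 0 \<longleftrightarrow> card {e \<in> U ?g - {e0}. hd e = w} = 0" using cnt[of w] by presburger
    also have "\<dots> \<longleftrightarrow> (\<forall>e\<in>U ?g - {e0}. hd e \<noteq> w)" unfolding card_0_eq[OF fin] by blast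
    finally show ?thesis .
  qed
  have other: "(\<forall>e\<in>U ?g - {e0}. hd e \<noteq> x) \<longleftrightarrow> (\<forall>e\<in>U ?g. hd e \<noteq> x)" if "x \<noteq> w" for x
    using that by (auto simp: w_def)
  have mu: "\<mu> (xs, qh, c') < \<mu> ?g" if "U (xs, qh, c') = U ?g - {e0}" for xs
    unfolding \<mu>_def that using card_Diff1_less[OF finite_U e0U] by simp
  show ?thesis
  proof (cases "\<tau> 21 w - 1 = 0")
    case True
    have eff: "effect sort_body \<tau> = \<tau>(13 := (\<tau> 13)(0 := w), 21 := (\<tau> 21)(w := \<tau> 21 w - 1),
        23 := (\<tau> 23)(length qs := w), 25 := (\<tau> 25)(0 := Suc (length qs)), 26 := (\<tau> 26)(0 := c'))"
      unfolding sort_body_def using q True by (auto simp: fun_eq_iff)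
    \<comment> \<open>\<open>w\<close> is enqueued when its last incoming edge is traversed; by then
      the tails of all of them have left the queue.\<close>
    have pre: "\<exists>i<length qs. tl e = qs ! i" if "e < K" "hd e = w" for e
    proof -
      have "e \<notin> U ?g \<or> e = e0" using zero True that by blast
      then have "tl e \<in> set (take qh qs)" using that vq e0 by (auto simp: U_def)
      then have "tl e \<in> set qs" by (rule in_set_takeD)
      then show ?thesis by (metis in_set_conv_nth)
    qed
    have ord: "\<forall>j<length (qs @ [w]). \<forall>e<K. hd e = (qs @ [w]) ! j \<longrightarrow> (\<exists>i<j. tl e = (qs @ [w]) ! i)"
    proof (intro allI impI)
      fix j e assume j: "j < length (qs @ [w])" "e < K" "hd e = (qs @ [w]) ! j"
      show "\<exists>i<j. tl e = (qs @ [w]) ! i"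
      proof (cases "j < length qs")
        case True
        then have "hd e = qs ! j" using j by (simp add: nth_append)
        moreover have "\<forall>j<length qs. \<forall>e<K. hd e = qs ! j \<longrightarrow> (\<exists>i<j. tl e = qs ! i)"
          using I unfolding I_def prod.case by (elim conjE) assumption
        ultimately obtain i where "i < j" "tl e = qs ! i" using True j(2) by blast
        then show ?thesis using True by (intro exI[of _ i]) (simp add: nth_append)
      next
        case False
        then have "j = length qs" using j by simp
        then show ?thesis using pre[of e] j by (auto simp: nth_append)
      qed
    qed
    have mem: "\<forall>x<n. x \<in> set (qs @ [w]) \<longleftrightarrow> (\<forall>e\<in>U ?g - {e0}. hd e \<noteq> x)"
    proof (intro allI impI)
      fix x assume x: "x < n"
      show "x \<in> set (qs @ [w]) \<longleftrightarrow> (\<forall>e\<in>U ?g - {e0}. hd e \<noteq> x)"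
      proof (cases "x = w")
        case True then show ?thesis using zero \<open>\<tau> 21 w - 1 = 0\<close> by simp
      next
        case False
        then show ?thesis using other[OF False] I x unfolding I_def by simp
      qed
    qed
    have "I (qs @ [w], qh, c') (effect sort_body \<tau>)"
      using I ord mem cu wq wn d e0 unfolding I_def eff Ux cnt
      by (auto simp: nth_append v_def less_Suc_eq)
    then show ?thesis using mu[OF Ux(2)] by blast
  next
    case False
    have eff: "effect sort_body \<tau> = \<tau>(13 := (\<tau> 13)(0 := w), 21 := (\<tau> 21)(w := \<tau> 21 w - 1), 26 := (\<tau> 26)(0 := c'))"
      unfolding sort_body_def using q False by (auto simp: fun_eq_iff)
    have mem: "\<forall>x<n. x \<in> set qs \<longleftrightarrow> (\<forall>e\<in>U ?g - {e0}. hd e \<noteq> x)"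
    proof (intro allI impI)
      fix x assume x: "x < n"
      show "x \<in> set qs \<longleftrightarrow> (\<forall>e\<in>U ?g - {e0}. hd e \<noteq> x)"
      proof (cases "x = w")
        case True then show ?thesis using zero False wq by simp
      next
        case False
        then show ?thesis using other[OF False] I x unfolding I_def by simp
      qed
    qed
    have "I (qs, qh, c') (effect sort_body \<tau>)"
      using I mem cu e0 unfolding I_def eff Ux cnt by (auto simp: v_def)
    then show ?thesis using mu[OF Ux(1)] by blast
  qed
qed

text \<open>Otherwise take a vertex of least rank that was never enqueued. Some untraversed edge
  enters it, and as the queue is exhausted, the tail of this edge was never enqueued either, but has
  smaller rank.\<close>

lemma all_reached:
  assumes I: "I (qs, length qs, 0) \<tau>"
  shows "set qs = {..<n}"
proof (rule ccontr)
  assume ne: "set qs \<noteq> {..<n}"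
  let ?R = "{(tl e, hd e) | e. e < K}"
  have fin: "finite ?R" by (rule finite_subset[of _ "(\<lambda>e. (tl e, hd e)) ` {..<K}"]) auto
  obtain r :: "nat \<Rightarrow> nat" where r: "\<forall>(x, y) \<in> ?R. r x < r y"
    using finite_acyclic_rank[OF fin acyc] by blast
  have sub: "set qs \<subseteq> {..<n}" using I by (simp add: I_def)
  have "{..<n} - set qs \<noteq> {}" using ne sub by blast
  then obtain w where w: "w \<in> {..<n} - set qs" and m: "\<And>x. x \<in> {..<n} - set qs \<Longrightarrow> r w \<le> r x"
    by (rule finite_has_min[OF finite_Diff[OF finite_lessThan], of n "set qs" r]) blast
  then obtain e where e: "e \<in> U (qs, length qs, 0)" "hd e = w" using I unfolding I_def by auto
  then have "e < K" "tl e \<in> {..<n} - set qs" using tl by (auto simp: U_def)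
  moreover then have "r (tl e) < r (hd e)" using r by blast
  ultimately show False using m e by fastforce
qed

lemma sort_correct:
  assumes z: "\<sigma> 24 0 = 0" "\<sigma> 26 0 = 0" "\<sigma> 2 = hd" "\<sigma> 1 (\<sigma> 0 2) = s"
    and adj: "\<And>v. \<sigma> 20 v = last_below tl v K" "\<And>e. e < K \<Longrightarrow> \<sigma> 19 e = last_below tl (tl e) e"
      "\<And>w. \<sigma> 21 w = card {e. e < K \<and> hd e = w}"
  shows "\<exists>\<sigma>'. runs sort_prog \<sigma> (100 * (n + K) + 100) \<sigma>' \<and>
    bij_betw (\<sigma>' 6) {..<n} {1..n} \<and> (\<forall>e<K. \<sigma>' 6 (tl e) < \<sigma>' 6 (hd e))"
proof -
  let ?b = "Not (And (Eq (Var 24) (Var 25)) (Eq (Var 26) (Const 0)))"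
  let ?i = "Seq (Write 23 (Const 0) (Cell 1 (Cell 0 (Const 2)))) (Assign 25 (Const 1))"
  have lf: "loop_free sort_body" by (simp add: sort_body_def)
  have U0: "U ([s], 0, 0) = {e. e < K}" by (simp add: U_def)
  have init: "I ([s], 0, 0) (effect ?i \<sigma>)"
    using z adj s src unfolding I_def U0 by auto
  have "\<exists>g' \<sigma>'. runs (While ?b sort_body) (effect ?i \<sigma>)
      ((test_cost ?b + max_cost sort_body) * \<mu> ([s], 0, 0) + test_cost ?b) \<sigma>' \<and> I g' \<sigma>' \<and> \<not> test_val ?b \<sigma>'"
  proof (rule runs_While[where I = I and \<mu> = \<mu> and b = ?b, OF lf _ init])
    fix g \<tau> assume I: "I g \<tau>" and b: "test_val ?b \<tau>"
    obtain qs qh cur where g: "g = (qs, qh, cur)" by (cases g) auto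
    show "\<exists>g'. I g' (effect sort_body \<tau>) \<and> \<mu> g' < \<mu> g"
    proof (cases "cur = 0")
      case True
      then have "qh < length qs" using I b unfolding g I_def by auto
      then show ?thesis using step_pop I True unfolding g by blast
    next
      case False
      then show ?thesis using step_edge I unfolding g by blast
    qed
  qed
  then obtain g \<tau> where r: "runs (While ?b sort_body) (effect ?i \<sigma>)
      ((test_cost ?b + max_cost sort_body) * \<mu> ([s], 0, 0) + test_cost ?b) \<tau>"
    and I: "I g \<tau>" and nb: "\<not> test_val ?b \<tau>" by blast
  obtain qs qh cur where g: "g = (qs, qh, cur)" by (cases g) auto
  have "qh = length qs" "cur = 0" using I nb unfolding g I_def by auto
  then have J: "I (qs, length qs, 0) \<tau>" using I g by simp
  have qs: "set qs = {..<n}" by (rule all_reached[OF J])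
  have d: "distinct qs" using J by (simp add: I_def)
  have len: "length qs = n" using distinct_card[OF d] qs by simp
  have lab: "\<tau> 6 (qs ! i) = Suc i" if "i < n" for i using J that len by (simp add: I_def)
  have inj: "inj_on (\<tau> 6) {..<n}"
  proof (rule inj_onI)
    fix x y assume "x \<in> {..<n}" "y \<in> {..<n}" and e: "\<tau> 6 x = \<tau> 6 y"
    then obtain i j where "i < n" "qs ! i = x" "j < n" "qs ! j = y" using qs len by (metis in_set_conv_nth)
    then show "x = y" using lab e by auto
  qed
  have "\<tau> 6 ` {..<n} = {1..n}"
  proof -
    have "{..<n} = (!) qs ` {..<n}" using qs len by (auto simp: set_conv_nth)
    then have "\<tau> 6 ` {..<n} = (\<lambda>i. \<tau> 6 (qs ! i)) ` {..<n}" by (metis image_image)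
    also have "\<dots> = Suc ` {..<n}" using lab by (intro image_cong) auto
    also have "\<dots> = {1..n}" by (simp add: lessThan_atLeast0 image_Suc_atLeastLessThan atLeastLessThanSuc_atLeastAtMost)
    finally show ?thesis .
  qed
  then have bij: "bij_betw (\<tau> 6) {..<n} {1..n}" using inj by (simp add: bij_betw_def)
  have mono: "\<tau> 6 (tl e) < \<tau> 6 (hd e)" if e: "e < K" for e
  proof -
    obtain j where j: "j < n" "qs ! j = hd e" using qs len hd[OF e] by (metis in_set_conv_nth lessThan_iff)
    have "\<forall>j<length qs. \<forall>e<K. hd e = qs ! j \<longrightarrow> (\<exists>i<j. tl e = qs ! i)"
      using J unfolding I_def prod.case by (elim conjE) assumption
    then obtain i where i: "i < j" "tl e = qs ! i" using j e len by metis
    then show ?thesis using lab[of i] lab[of j] j by simp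
  qed
  have "runs ?i \<sigma> (max_cost ?i) (effect ?i \<sigma>)" by (rule runs_loop_free) simp
  from runs_Seq[OF this r] have R: "runs sort_prog \<sigma> (max_cost ?i + ((test_cost ?b + max_cost sort_body) * \<mu> ([s], 0, 0) + test_cost ?b)) \<tau>"
    unfolding sort_prog_def .
  have "test_cost ?b + max_cost sort_body \<le> 100" "max_cost ?i + test_cost ?b \<le> 100"
    by (simp_all add: sort_body_def)
  then have le: "max_cost ?i + ((test_cost ?b + max_cost sort_body) * \<mu> ([s], 0, 0) + test_cost ?b)
      \<le> 100 * \<mu> ([s], 0, 0) + 100"
    using mult_le_mono1[of "test_cost ?b + max_cost sort_body" 100 "\<mu> ([s], 0, 0)"] by linarith
  have "\<mu> ([s], 0, 0) = n + K" by (simp add: \<mu>_def U0)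
  then have "runs sort_prog \<sigma> (100 * (n + K) + 100) \<tau>"
    using runs_mono[OF R le] by simp
  then show ?thesis using bij mono by blast
qed

end

section \<open>Reading off the corners\<close>

text \<open>
  The walk visits position \<open>p\<close> (variable 11) of the rotation of vertex \<open>v\<close> (variable 12). Arrays 7
  and 8 hold \<open>sink_right\<close> and \<open>sink_left\<close>; array 9 links siblings and array 10 points to the first
  outgoing arc, where \<open>0\<close> means that there is none and otherwise numbers are increased by one.
\<close>

definition corner_body :: prog where
  "corner_body = If (Eq (Var 11) (Cell 3 (Inc (Var 12))))
     (Assign 12 (Inc (Var 12)))
     (Seq (If (Eq (Inc (Var 11)) (Cell 3 (Inc (Var 12))))
            (Assign 13 (Cell 4 (Cell 3 (Var 12))))
            (Assign 13 (Cell 4 (Inc (Var 11)))))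
     (Seq (If (Eq (Cell 2 (Cell 4 (Var 11))) (Var 12))
            (If (Eq (Cell 2 (Var 13)) (Var 12))
              (Seq (Write 7 (Cell 4 (Var 11)) (Const 1)) (Write 8 (Var 13) (Const 1)))
              (Write 10 (Var 12) (Inc (Var 13))))
            (If (And (Eq (Cell 1 (Var 13)) (Var 12)) (Not (Eq (Var 13) (Cell 0 (Const 2)))))
              (Write 9 (Cell 4 (Var 11)) (Inc (Var 13)))
              Skip))
          (Assign 11 (Inc (Var 11)))))"

text \<open>The walk never finds the first arc of \<open>s\<close>, which has no incoming arc and
  thus no turn from incoming to outgoing; the final write supplies \<open>a\<^sub>0\<close>.\<close>

definition corner_prog :: prog where
  "corner_prog = Seq (While (Less (Var 12) (Var 0)) corner_body)
     (Write 10 (Cell 1 (Cell 0 (Const 2))) (Inc (Cell 0 (Const 2))))"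

section \<open>The input in memory\<close>

locale numbered_st_graph = embedded_planar_st_graph G s t \<rho> a\<^sub>0
  for G :: "(nat, nat) pre_digraph" and s t \<rho> a\<^sub>0 +
  assumes numbered: "numbered G"
begin

abbreviation n :: nat where "n \<equiv> card (verts G)"
abbreviation m :: nat where "m \<equiv> card (arcs G)"

lemma verts_iff: "v \<in> verts G \<longleftrightarrow> v < n"
  using numbered unfolding numbered_def by blast

lemma arcs_iff: "a \<in> arcs G \<longleftrightarrow> a < m"
  using numbered unfolding numbered_def by blast

definition start :: "nat \<Rightarrow> nat" where
  "start v = length (concat (map \<rho> [0..<v]))"

lemma start_0 [simp]: "start 0 = 0" by (simp add: start_def)

lemma start_Suc [simp]: "start (Suc v) = start v + length (\<rho> v)"
  by (simp add: start_def)

abbreviation \<sigma>0 :: store where "\<sigma>0 \<equiv> input_store G \<rho> a\<^sub>0"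

lemma input_scalars: "\<sigma>0 0 0 = n" "\<sigma>0 0 (Suc 0) = m" "\<sigma>0 0 2 = a\<^sub>0"
  by (simp_all add: input_store_def Let_def array_of_def)

lemma input_tail: "e < m \<Longrightarrow> \<sigma>0 1 e = tail G e"
  by (simp add: input_store_def Let_def array_of_def)

lemma input_head: "e < m \<Longrightarrow> \<sigma>0 2 e = head G e"
  by (simp add: input_store_def Let_def array_of_def)

lemma input_start: "v \<le> n \<Longrightarrow> \<sigma>0 3 v = start v"
  by (auto simp: input_store_def Let_def array_of_def start_def nth_append simp del: upt_Suc)

lemma input_rotation:
  assumes v: "v < n" and i: "i < length (\<rho> v)"
  shows "\<sigma>0 4 (start v + i) = \<rho> v ! i"
proof -
  have "[0..<n] = [0..<v] @ v # [Suc v..<n]"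
    using v upt_add_eq_append[of 0 v "n - v"] upt_conv_Cons[of v n] by simp
  then have c: "concat (map \<rho> [0..<n]) = concat (map \<rho> [0..<v]) @ \<rho> v @ concat (map \<rho> [Suc v..<n])"
    by simp
  show ?thesis
    using i by (simp add: input_store_def Let_def array_of_def c start_def nth_append)
qed

lemma input_zero: "5 \<le> k \<Longrightarrow> \<sigma>0 k = (\<lambda>_. 0)"
  by (auto simp: input_store_def Let_def)

text \<open>Contents of the tables as functions of the set \<open>S\<close> of darts whose corners
  were visited, so that one step of the walk is an insertion into \<open>S\<close>.\<close>

definition tab7 :: "nat dart set \<Rightarrow> nat \<Rightarrow> nat" where
  "tab7 S x = of_bool ((x, True) \<in> S \<inter> TF)"

definition tab8 :: "nat dart set \<Rightarrow> nat \<Rightarrow> nat" where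
  "tab8 S y = of_bool (\<exists>d\<in>S \<inter> TF. fs d = (y, False))"

definition tab9 :: "nat dart set \<Rightarrow> nat \<Rightarrow> nat" where
  "tab9 S x = (if (x, False) \<in> S \<and> x \<in> siblings then Suc (nxt x) else 0)"

definition tab10 :: "nat dart set \<Rightarrow> nat \<Rightarrow> nat" where
  "tab10 S u = (if \<exists>d\<in>S \<inter> TT. dend d = u then Suc (fst (fs (THE d. d \<in> TT \<and> dend d = u))) else 0)"

definition tables :: "nat dart set \<Rightarrow> store \<Rightarrow> bool" where
  "tables S \<tau> \<longleftrightarrow> \<tau> 7 = tab7 S \<and> \<tau> 8 = tab8 S \<and> \<tau> 9 = tab9 S \<and> \<tau> 10 = tab10 S"

text \<open>The four kinds of corners that the branches of \<open>corner_body\<close> tell apart by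
  heads and tails: sink of a face, turn to the outgoing arcs, pair of siblings, and the
  rest.\<close>

lemma tables_insert:
  assumes d: "d \<in> darts G" "dend d = v" "fst d = x" and y: "nx v x = y"
  shows "head G x = v \<Longrightarrow> head G y = v \<Longrightarrow>
      tab7 (insert d S) = (tab7 S)(x := 1) \<and> tab8 (insert d S) = (tab8 S)(y := 1) \<and>
      tab9 (insert d S) = tab9 S \<and> tab10 (insert d S) = tab10 S" (is "_ \<Longrightarrow> _ \<Longrightarrow> ?A")
    and "head G x = v \<Longrightarrow> head G y \<noteq> v \<Longrightarrow>
      tab7 (insert d S) = tab7 S \<and> tab8 (insert d S) = tab8 S \<and>
      tab9 (insert d S) = tab9 S \<and> tab10 (insert d S) = (tab10 S)(v := Suc y)" (is "_ \<Longrightarrow> _ \<Longrightarrow> ?B")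
    and "head G x \<noteq> v \<Longrightarrow> tail G y = v \<Longrightarrow> y \<noteq> a\<^sub>0 \<Longrightarrow>
      tab7 (insert d S) = tab7 S \<and> tab8 (insert d S) = tab8 S \<and>
      tab9 (insert d S) = (tab9 S)(x := Suc y) \<and> tab10 (insert d S) = tab10 S" (is "_ \<Longrightarrow> _ \<Longrightarrow> _ \<Longrightarrow> ?C")
    and "head G x \<noteq> v \<Longrightarrow> \<not> (tail G y = v \<and> y \<noteq> a\<^sub>0) \<Longrightarrow>
      tab7 (insert d S) = tab7 S \<and> tab8 (insert d S) = tab8 S \<and>
      tab9 (insert d S) = tab9 S \<and> tab10 (insert d S) = tab10 S" (is "_ \<Longrightarrow> _ \<Longrightarrow> ?D")
proof -
  have xa: "x \<in> arcs G" using d by auto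
  have f: "fs d = (y, tail G y = v)" using d y by (simp add: fs_eq)
  have yr: "y \<in> arcs G" "head G y = v \<or> tail G y = v"
    using nx_in_rho[of d] d y by (auto simp: set_rho_iff)
  have ht: "head G y = v \<longleftrightarrow> tail G y \<noteq> v" using yr no_loops[OF yr(1)] by auto
  have dT: "d = (x, True)" if "head G x = v"
    using d that no_loops[OF xa] by (cases d) (auto simp: dart_end_def split: if_splits)
  have dF: "d = (x, False)" "tail G x = v" if "head G x \<noteq> v"
    using d that by (cases d; auto simp: dart_end_def split: if_splits)+
  show ?A if h: "head G x = v" "head G y = v"
  proof -
    have "d \<in> TF" "d \<notin> TT" using dT h f ht d by (auto simp: TF_def TT_def)
    then show ?thesis using dT[OF h(1)] f ht h
      by (auto simp: tab7_def tab8_def tab9_def tab10_def fun_eq_iff)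
  qed
  show ?B if h: "head G x = v" "head G y \<noteq> v"
  proof -
    have T: "d \<notin> TF" "d \<in> TT" using dT h f ht d by (auto simp: TF_def TT_def)
    have "(THE d. d \<in> TT \<and> dend d = v) = d"
      using T d inj_onD[OF TT_inj] by (intro the_equality) auto
    then have "tab10 (insert d S) = (tab10 S)(v := Suc y)"
      using T d f by (auto simp: tab10_def fun_eq_iff)
    then show ?thesis using T dT[OF h(1)]
      by (auto simp: tab7_def tab8_def tab9_def fun_eq_iff)
  qed
  show ?C if h: "head G x \<noteq> v" "tail G y = v" "y \<noteq> a\<^sub>0"
  proof -
    have T: "d \<notin> TF" "d \<notin> TT" using dF[OF h(1)] by (auto simp: TF_def TT_def)
    have n: "nxt x = y" using dF[OF h(1)] y by simp
    have "(x, False) \<in> FT" using dF[OF h(1)] f h d by (auto simp: FT_def)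
    moreover have "nxt x \<noteq> a\<^sub>0" using n h by simp
    ultimately have "x \<in> siblings" unfolding siblings_def using xa by blast
    then show ?thesis using T dF[OF h(1)] n
      by (auto simp: tab7_def tab8_def tab9_def tab10_def fun_eq_iff)
  qed
  show ?D if h: "head G x \<noteq> v" "\<not> (tail G y = v \<and> y \<noteq> a\<^sub>0)"
  proof -
    have T: "d \<notin> TF" "d \<notin> TT" using dF[OF h(1)] by (auto simp: TF_def TT_def)
    have n: "nxt x = y" using dF[OF h(1)] y by simp
    have "x \<notin> siblings"
    proof
      assume xs: "x \<in> siblings"
      have "tail G y = v" using siblings_tail[OF xs] n dF[OF h(1)] by simp
      moreover have "nxt x \<noteq> a\<^sub>0" using xs unfolding siblings_def by blast
      ultimately show False using h n by simp
    qed
    then show ?thesis using T dF[OF h(1)]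
      by (auto simp: tab7_def tab8_def tab9_def tab10_def fun_eq_iff)
  qed
qed

text \<open>A position in the rotation of a vertex stands for the dart arriving there on that arc;
  in this way every dart has exactly one position.\<close>

definition visited :: "nat \<times> nat \<Rightarrow> nat dart set" where
  "visited = (\<lambda>(v, i). {d \<in> darts G. dend d < v \<or> (dend d = v \<and> fst d \<in> set (take i (\<rho> v)))})"

definition corner_inv :: "nat \<times> nat \<Rightarrow> store \<Rightarrow> bool" where
  "corner_inv g \<tau> \<longleftrightarrow> (case g of (v, i) \<Rightarrow> v \<le> n \<and> (v < n \<longrightarrow> i \<le> length (\<rho> v)) \<and>
     \<tau> 11 0 = start v + i \<and> \<tau> 12 0 = v \<and> tables (visited g) \<tau> \<and>
     (\<forall>k. k \<notin> {7, 8, 9, 10, 11, 12, 13} \<longrightarrow> \<tau> k = \<sigma>0 k))"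

definition corner_measure :: "nat \<times> nat \<Rightarrow> nat" where
  "corner_measure g = (n - fst g) + card (darts G - visited g)"

lemma corner_step:
  assumes I: "corner_inv g \<tau>" and b: "test_val (Less (Var 12) (Var 0)) \<tau>"
  shows "\<exists>g'. corner_inv g' (effect corner_body \<tau>) \<and> corner_measure g' < corner_measure g"
proof -
  obtain v i where g: "g = (v, i)" by (cases g)
  have fr: "\<tau> 0 = \<sigma>0 0" "\<tau> 1 = \<sigma>0 1" "\<tau> 2 = \<sigma>0 2" "\<tau> 3 = \<sigma>0 3" "\<tau> 4 = \<sigma>0 4"
    and sc: "\<tau> 11 0 = start v + i" "\<tau> 12 0 = v" and T: "tables (visited (v, i)) \<tau>"
    and frame: "\<And>k. k \<notin> {7, 8, 9, 10, 11, 12, 13} \<Longrightarrow> \<tau> k = \<sigma>0 k"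
    using I by (simp_all add: corner_inv_def g)
  have v: "v < n" using b fr sc input_scalars by simp
  then have i: "i \<le> length (\<rho> v)" using I by (simp add: corner_inv_def g)
  have st: "\<tau> 3 (Suc v) = start v + length (\<rho> v)" "\<tau> 3 v = start v"
    using v fr input_start[of "Suc v"] input_start[of v] by simp_all
  have vv: "v \<in> verts G" using v verts_iff by simp
  show ?thesis
  proof (cases "i = length (\<rho> v)")
    case True
    have eff: "effect corner_body \<tau> = \<tau>(12 := (\<tau> 12)(0 := Suc v))"
      unfolding corner_body_def using sc st True by simp
    have "visited (Suc v, 0) = visited (v, i)"
      using True dart_in_rho by (auto simp: visited_def less_Suc_eq)
    moreover from this have "corner_inv (Suc v, 0) (effect corner_body \<tau>)"
      using T frame sc v True unfolding corner_inv_def eff by (auto simp: tables_def)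
    ultimately show ?thesis using v g by (intro exI[of _ "(Suc v, 0)"]) (auto simp: corner_measure_def)
  next
    case False
    then have il: "i < length (\<rho> v)" using i by simp
    define x where "x = \<rho> v ! i"
    define y where "y = \<rho> v ! (Suc i mod length (\<rho> v))"
    define d where "d = (x, head G x = v)"
    have xr: "x \<in> set (\<rho> v)" using il by (simp add: x_def)
    have yr: "y \<in> set (\<rho> v)" unfolding y_def by (rule nth_mem, rule mod_less_divisor) (use il in auto)
    have xm: "x < m" and ym: "y < m" using xr yr vv by (simp_all add: set_rho_iff arcs_iff)
    have d: "d \<in> darts G" "dend d = v" "fst d = x"
      using xr vv by (auto simp: d_def set_rho_iff dart_end_def)
    have nxy: "nx v x = y" using distinct_rotate1_cycle[of "\<rho> v" i] il vv by (simp add: x_def y_def)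
    have rx: "\<tau> 4 (start v + i) = x" using fr input_rotation[OF v il] by (simp add: x_def)
    have ry: "(if Suc (start v + i) = start v + length (\<rho> v) then \<tau> 4 (start v) else \<tau> 4 (Suc (start v + i))) = y"
    proof (cases "Suc i = length (\<rho> v)")
      case True
      moreover have "0 < length (\<rho> v)" using il by linarith
      ultimately show ?thesis using fr input_rotation[OF v, of 0] by (simp add: y_def)
    next
      case False
      then show ?thesis using fr input_rotation[OF v, of "Suc i"] il by (simp add: y_def)
    qed
    have hd: "\<tau> 2 x = head G x" "\<tau> 2 y = head G y" "\<tau> 1 y = tail G y" "\<tau> 0 2 = a\<^sub>0"
      using fr input_head input_tail input_scalars xm ym by simp_all
    have vis: "visited (v, Suc i) = insert d (visited (v, i))"
    proof -
      have "set (take (Suc i) (\<rho> v)) = insert x (set (take i (\<rho> v)))"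
        using il by (simp add: take_Suc_conv_app_nth x_def)
      then have tk: "z \<in> set (take (Suc i) (\<rho> v)) \<longleftrightarrow> z = x \<or> z \<in> set (take i (\<rho> v))" for z by simp
      have eq: "e \<in> darts G \<and> dend e = v \<and> fst e = x \<longleftrightarrow> e = d" for e
        using d by (metis dart_eqI)
      have "e \<in> visited (v, Suc i) \<longleftrightarrow> e = d \<or> e \<in> visited (v, i)" for e
        unfolding visited_def prod.case mem_Collect_eq tk eq[of e, symmetric] by blast
      then show ?thesis by blast
    qed
    have "x \<notin> set (take i (\<rho> v))"
      using il vv distinct_rho[of v] by (auto simp: x_def in_set_conv_nth nth_eq_iff_index_eq)
    then have dn: "d \<notin> visited (v, i)" using d by (simp add: visited_def)
    have lt: "start v + i \<noteq> start v + length (\<rho> v)" using il by simp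
    let ?\<tau> = "effect corner_body \<tau>"
    have eff: "?\<tau> 11 0 = Suc (start v + i)" "?\<tau> 12 0 = v" "\<And>k. k \<notin> {7, 8, 9, 10, 11, 12, 13} \<Longrightarrow> ?\<tau> k = \<tau> k"
      "?\<tau> 7 = (if head G x = v \<and> head G y = v then (\<tau> 7)(x := 1) else \<tau> 7)"
      "?\<tau> 8 = (if head G x = v \<and> head G y = v then (\<tau> 8)(y := 1) else \<tau> 8)"
      "?\<tau> 10 = (if head G x = v \<and> head G y \<noteq> v then (\<tau> 10)(v := Suc y) else \<tau> 10)"
      "?\<tau> 9 = (if head G x \<noteq> v \<and> tail G y = v \<and> y \<noteq> a\<^sub>0 then (\<tau> 9)(x := Suc y) else \<tau> 9)"
      unfolding corner_body_def using sc st lt rx ry hd by (auto split: if_splits)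
    have "tables (visited (v, Suc i)) ?\<tau>"
      using T tables_insert[OF d nxy, of "visited (v, i)"] unfolding tables_def vis eff by auto
    then have "corner_inv (v, Suc i) ?\<tau>"
      using eff(1-3) frame v il by (auto simp: corner_inv_def)
    moreover have "corner_measure (v, Suc i) < corner_measure (v, i)"
    proof -
      have "darts G - visited (v, Suc i) \<subset> darts G - visited (v, i)" using d dn vis by blast
      then show ?thesis by (simp add: corner_measure_def psubset_card_mono)
    qed
    ultimately show ?thesis using g by blast
  qed
qed

lemma corner_correct:
  "\<exists>\<tau>. runs corner_prog \<sigma>0 (200 * (n + m) + 100) \<tau> \<and>
    (\<forall>k. k \<notin> {7, 8, 9, 10, 11, 12, 13} \<longrightarrow> \<tau> k = \<sigma>0 k) \<and>
    (\<forall>x<m. \<tau> 7 x = of_bool (sink_right x)) \<and> (\<forall>x<m. \<tau> 8 x = of_bool (sink_left x)) \<and>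
    (\<forall>x<m. \<tau> 9 x = (if x \<in> siblings then Suc (nxt x) else 0)) \<and>
    (\<forall>u<n. \<tau> 10 u = (if out_arcs G u = {} then 0 else Suc (hd (succs u))))"
proof -
  let ?b = "Less (Var 12) (Var 0)"
  let ?q = "Write 10 (Cell 1 (Cell 0 (Const 2))) (Inc (Cell 0 (Const 2)))"
  have lf: "loop_free corner_body" by (simp add: corner_body_def)
  have V0: "visited (0, 0) = {}" by (auto simp: visited_def)
  have init: "corner_inv (0, 0) \<sigma>0"
    using input_zero by (auto simp: corner_inv_def V0 tables_def tab7_def tab8_def tab9_def tab10_def)
  obtain g \<tau> where r: "runs (While ?b corner_body) \<sigma>0
      ((test_cost ?b + max_cost corner_body) * corner_measure (0, 0) + test_cost ?b) \<tau>"
    and I: "corner_inv g \<tau>" and nb: "\<not> test_val ?b \<tau>"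
    using runs_While[where I = corner_inv and \<mu> = corner_measure and b = ?b, OF lf corner_step init] by blast
  let ?\<tau> = "effect ?q \<tau>"
  have R: "runs corner_prog \<sigma>0 (((test_cost ?b + max_cost corner_body) * corner_measure (0, 0) + test_cost ?b) + max_cost ?q) ?\<tau>"
    unfolding corner_prog_def by (rule runs_Seq[OF r runs_loop_free]) simp
  have "test_cost ?b + max_cost corner_body \<le> 100" "test_cost ?b + max_cost ?q \<le> 100"
    by (simp_all add: corner_body_def)
  \<comment> \<open>There are \<open>n\<close> moves to the next vertex and one step for each of the
    \<open>2 * m\<close> darts.\<close>
  moreover have "corner_measure (0, 0) \<le> 2 * (n + m)"
    by (simp add: corner_measure_def V0 card_darts)
  ultimately have le: "((test_cost ?b + max_cost corner_body) * corner_measure (0, 0) + test_cost ?b) + max_cost ?q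
      \<le> 200 * (n + m) + 100"
    using mult_le_mono[of "test_cost ?b + max_cost corner_body" 100 "corner_measure (0, 0)" "2 * (n + m)"] by linarith
  obtain v i where g: "g = (v, i)" by (cases g)
  have fr: "\<And>k. k \<notin> {7, 8, 9, 10, 11, 12, 13} \<Longrightarrow> \<tau> k = \<sigma>0 k" and v: "v \<le> n" "\<tau> 12 0 = v"
    and T: "tables (visited g) \<tau>"
    using I by (simp_all add: corner_inv_def g)
  have f0: "\<tau> 0 = \<sigma>0 0" "\<tau> 1 = \<sigma>0 1" using fr by simp_all
  have "v = n" using nb v f0 input_scalars by simp
  then have V: "visited g = darts G" using verts_iff dend_verts by (auto simp: visited_def g)
  have a0m: "a\<^sub>0 < m" using a0 arcs_iff by simp
  have q: "?\<tau> = \<tau>(10 := (\<tau> 10)(s := Suc a\<^sub>0))"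
    using f0 input_scalars input_tail[OF a0m] a0 by simp
  have t7: "tab7 (darts G) x = of_bool (sink_right x)" for x
    by (auto simp: tab7_def sink_right_def TF_def)
  have t8: "tab8 (darts G) x = of_bool (sink_left x)" for x
    by (auto simp: tab8_def sink_left_def TF_def)
  have t9: "tab9 (darts G) x = (if x \<in> siblings then Suc (nxt x) else 0)" for x
    by (auto simp: tab9_def)
  have t10: "((tab10 (darts G))(s := Suc a\<^sub>0)) u = (if out_arcs G u = {} then 0 else Suc (hd (succs u)))"
    if u: "u < n" for u
  proof (cases "u = s")
    case True
    have "out_arcs G s \<noteq> {}" using a0 by auto
    then show ?thesis using True succs_s by simp
  next
    case us: False
    show ?thesis
    proof (cases "out_arcs G u = {}")
      case True
      have "dend d \<noteq> u" if "d \<in> TT" for d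
      proof
        assume e: "dend d = u"
        have dd: "d \<in> darts G" "snd (fs d)" using that by (auto simp: TT_def)
        then have "fst (fs d) \<in> out_arcs G u" using snd_fs[OF dd(1)] e fs_darts[OF dd(1)] by simp
        then show False using True by simp
      qed
      then show ?thesis using True us by (auto simp: tab10_def)
    next
      case False
      obtain d where d: "d \<in> TT" "dend d = u" "fs d = (hd (succs u), True)"
        using succs_hd[OF _ us False] u verts_iff by blast
      have "(THE d. d \<in> TT \<and> dend d = u) = d"
        using d inj_onD[OF TT_inj] by (intro the_equality) auto
      moreover have "d \<in> darts G" using d by (simp add: TT_def)
      ultimately show ?thesis using d us False by (auto simp: tab10_def)
    qed
  qed
  have "?\<tau> k = \<sigma>0 k" if "k \<notin> {7, 8, 9, 10, 11, 12, 13}" for k using fr[OF that] that by (simp add: q)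
  moreover have "?\<tau> 7 = tab7 (darts G)" "?\<tau> 8 = tab8 (darts G)" "?\<tau> 9 = tab9 (darts G)"
    "?\<tau> 10 = (tab10 (darts G))(s := Suc a\<^sub>0)"
    unfolding q using T by (simp_all add: tables_def V)
  ultimately show ?thesis
    using runs_mono[OF R le] t7 t8 t9 t10 by (intro exI[of _ ?\<tau>]) simp
qed

end

section \<open>The algorithm\<close>

text \<open>
  Variable 15 is one more than the current arc (\<open>0\<close> between two vertices), variable 16 tells whether
  the direction has switched to decreasing, and variable 18 records a conflict. The edges inserted
  between heads of siblings are appended to arrays 1 and 2.
\<close>

definition sibling_body :: prog where
  "sibling_body = If (Eq (Var 15) (Const 0))
     (Seq (Assign 15 (Cell 10 (Var 14))) (Seq (Assign 16 (Const 0)) (Assign 14 (Inc (Var 14)))))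
     (If (Eq (Cell 9 (Dec (Var 15))) (Const 0)) (Assign 15 (Const 0))
       (Seq (Assign 13 (Dec (Cell 9 (Dec (Var 15)))))
       (Seq (If (Eq (Cell 8 (Dec (Var 15))) (Const 1)) (Assign 16 (Const 1)) Skip)
       (Seq (If (Eq (Var 16) (Const 1))
              (Seq (Write 1 (Var 17) (Cell 2 (Var 13)))
              (Seq (Write 2 (Var 17) (Cell 2 (Dec (Var 15))))
                   (If (Eq (Cell 7 (Var 13)) (Const 1)) (Assign 18 (Const 1)) Skip)))
              (Seq (Write 1 (Var 17) (Cell 2 (Dec (Var 15))))
                   (Write 2 (Var 17) (Cell 2 (Var 13)))))
       (Seq (Assign 17 (Inc (Var 17)))
            (Assign 15 (Inc (Var 13))))))))"

definition sibling_test :: test where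
  "sibling_test = Not (And (Not (Less (Var 14) (Var 0))) (Eq (Var 15) (Const 0)))"

text \<open>In case of a conflict, array 5 keeps its initial 0, which is the negative
  answer.\<close>

definition bitonic_prog :: prog where
  "bitonic_prog = Seq corner_prog (Seq (Assign 17 (Cell 0 (Const 1))) (Seq (While sibling_test sibling_body)
     (If (Eq (Var 18) (Const 0)) (Seq adjacency_prog (Seq sort_prog (Assign 5 (Const 1)))) Skip)))"

lemma range_pairs_insert:
  assumes "l \<le> (K::nat)"
  shows "{((f(K := a)) e, (g(K := b)) e) | e. l \<le> e \<and> e < Suc K} = insert (a, b) {(f e, g e) | e. l \<le> e \<and> e < K}"
  using assms by (auto simp: less_Suc_eq)

section \<open>The walk along the successor lists\<close>

context numbered_st_graph
begin

definition walked :: "nat \<times> nat list \<Rightarrow> nat set" where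
  "walked g = {x \<in> arcs G. tail G x < fst g} - set (snd g)"

definition tabulated :: "store \<Rightarrow> bool" where
  "tabulated \<tau> \<longleftrightarrow> \<tau> 0 = \<sigma>0 0 \<and> \<tau> 5 = \<sigma>0 5 \<and> (\<forall>k\<ge>19. \<tau> k = (\<lambda>_. 0)) \<and>
    (\<forall>x<m. \<tau> 7 x = of_bool (sink_right x)) \<and> (\<forall>x<m. \<tau> 8 x = of_bool (sink_left x)) \<and>
    (\<forall>x<m. \<tau> 9 x = (if x \<in> siblings then Suc (nxt x) else 0)) \<and>
    (\<forall>u<n. \<tau> 10 u = (if out_arcs G u = {} then 0 else Suc (hd (succs u))))"

definition edges_inv :: "nat set \<Rightarrow> store \<Rightarrow> bool" where
  "edges_inv S \<tau> \<longleftrightarrow> \<tau> 17 0 = m + card S \<and> (\<forall>e<m. \<tau> 1 e = tail G e \<and> \<tau> 2 e = head G e) \<and>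
    {(\<tau> 1 e, \<tau> 2 e) | e. m \<le> e \<and> e < m + card S} = sib_edge descends ` S \<and>
    \<tau> 18 0 = of_bool (\<exists>x\<in>S. descends x \<and> sink_right (nxt x))"

text \<open>\<open>u\<close> is already one more than the vertex \<open>w\<close> of the list,
  because variable 14 is incremented when the list is begun. The bit \<open>b\<close> covers the
  entries strictly before \<open>j\<close>, as the current arc has not been tested yet.\<close>

definition position :: "nat \<Rightarrow> nat list \<Rightarrow> nat \<Rightarrow> bool" where
  "position u zs b \<longleftrightarrow> (zs \<noteq> [] \<longrightarrow> (\<exists>w j. u = Suc w \<and> out_arcs G w \<noteq> {} \<and> j < length (succs w) \<and>
     zs = drop j (succs w) \<and> b = of_bool (\<exists>i<j. sink_left (succs w ! i))))"

definition walk_inv :: "nat \<times> nat list \<Rightarrow> store \<Rightarrow> bool" where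
  "walk_inv g \<tau> \<longleftrightarrow> fst g \<le> n \<and> \<tau> 14 0 = fst g \<and> \<tau> 15 0 = (if snd g = [] then 0 else Suc (hd (snd g))) \<and>
     position (fst g) (snd g) (\<tau> 16 0) \<and> edges_inv (walked g \<inter> siblings) \<tau> \<and> tabulated \<tau>"

definition walk_measure :: "nat \<times> nat list \<Rightarrow> nat" where
  "walk_measure g = (n - fst g) + card (arcs G - walked g)"

lemma walk_step_vertex:
  assumes I: "walk_inv (u, []) \<tau>" and u: "u < n"
  shows "\<exists>g'. walk_inv g' (effect sibling_body \<tau>) \<and> walk_measure g' < walk_measure (u, [])"
proof -
  let ?zs = "if out_arcs G u = {} then [] else succs u"
  have uv: "u \<in> verts G" using u verts_iff by simp
  have st: "\<tau> 14 0 = u" "\<tau> 15 0 = 0" "\<tau> 10 u = (if out_arcs G u = {} then 0 else Suc (hd (succs u)))"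
    using I u by (auto simp: walk_inv_def tabulated_def)
  have eff: "effect sibling_body \<tau> = \<tau>(15 := (\<tau> 15)(0 := \<tau> 10 u), 16 := (\<tau> 16)(0 := 0), 14 := (\<tau> 14)(0 := Suc u))"
    unfolding sibling_body_def using st by simp
  have set: "set ?zs = out_arcs G u" using succs_set[OF uv] by simp
  have w: "walked (Suc u, ?zs) = walked (u, [])"
    unfolding walked_def fst_conv snd_conv set by (auto simp: less_Suc_eq)
  have ne: "succs u \<noteq> []" if "out_arcs G u \<noteq> {}" using succs_set[OF uv that] that by auto
  have pos: "position (Suc u) ?zs 0"
    unfolding position_def using ne by (auto intro!: exI[of _ u] exI[of _ 0])
  have "walk_inv (Suc u, ?zs) (effect sibling_body \<tau>)"
    using I u st ne pos unfolding walk_inv_def w eff by (auto simp: edges_inv_def tabulated_def)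
  moreover have "walk_measure (Suc u, ?zs) < walk_measure (u, [])"
    using u unfolding walk_measure_def w by simp
  ultimately show ?thesis by blast
qed

lemma walk_step_arc:
  assumes I: "walk_inv (u, zs) \<tau>" and zs: "zs \<noteq> []"
  shows "\<exists>g'. walk_inv g' (effect sibling_body \<tau>) \<and> walk_measure g' < walk_measure (u, zs)"
proof -
  obtain w j where wj: "u = Suc w" "out_arcs G w \<noteq> {}" "j < length (succs w)" "zs = drop j (succs w)"
    "\<tau> 16 0 = of_bool (\<exists>i<j. sink_left (succs w ! i))"
    using I zs unfolding walk_inv_def position_def by auto
  have un: "u \<le> n" using I by (simp add: walk_inv_def)
  then have wv: "w \<in> verts G" using wj verts_iff by simp
  define x where "x = succs w ! j"
  have zc: "zs = x # drop (Suc j) (succs w)" using wj by (simp add: x_def Cons_nth_drop_Suc)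
  have dz: "distinct zs" using wj succs_distinct[OF wv wj(2)] by simp
  have xo: "x \<in> out_arcs G w" using succs_set[OF wv wj(2)] nth_mem[OF wj(3)] by (simp add: x_def)
  then have xa: "x \<in> arcs G" "tail G x = w" by auto
  then have xm: "x < m" using arcs_iff by simp
  have wk: "walked (u, drop (Suc j) (succs w)) = insert x (walked (u, zs))" "x \<notin> walked (u, zs)"
    using dz xa wj(1) unfolding walked_def zc by auto
  have mu: "walk_measure (u, drop (Suc j) (succs w)) < walk_measure (u, zs)"
  proof -
    have "arcs G - insert x (walked (u, zs)) \<subset> arcs G - walked (u, zs)" using xa wk(2) by blast
    then show ?thesis unfolding walk_measure_def wk(1) by (simp add: psubset_card_mono)
  qed
  have T: "tabulated \<tau>" and E: "edges_inv (walked (u, zs) \<inter> siblings) \<tau>" and sc: "\<tau> 15 0 = Suc x" "\<tau> 14 0 = u"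
    using I zc by (simp_all add: walk_inv_def)
  show ?thesis
  proof (cases "x \<in> siblings")
    case False
    \<comment> \<open>Only the last arc of a list is not in \<open>siblings\<close>, so the missing
      link ends the list.\<close>
    have "Suc j = length (succs w)"
      using succs_nxt(1)[OF wv wj(2), of j] False wj(3) by (cases "Suc j < length (succs w)") (auto simp: x_def)
    then have d: "drop (Suc j) (succs w) = []" by simp
    have "\<tau> 9 x = 0" using T xm False by (simp add: tabulated_def)
    then have eff: "effect sibling_body \<tau> = \<tau>(15 := (\<tau> 15)(0 := 0))"
      unfolding sibling_body_def using sc by simp
    have "insert x (walked (u, zs)) \<inter> siblings = walked (u, zs) \<inter> siblings" using False by blast
    then have "walk_inv (u, []) (effect sibling_body \<tau>)"
      using un sc T E wk unfolding walk_inv_def eff d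
      by (simp add: position_def edges_inv_def tabulated_def)
    then show ?thesis using mu unfolding d by blast
  next
    case True
    have j: "Suc j < length (succs w)"
    proof (rule ccontr)
      assume "\<not> ?thesis"
      then have "x = last (succs w)" using wj(3) by (simp add: x_def last_conv_nth)
         (metis One_nat_def Suc_lessI diff_Suc_Suc diff_zero last_conv_nth length_0_conv not_less_zero)
      then show False using True succs_last[OF wv wj(2)] by simp
    qed
    define y where "y = nxt x"
    have yj: "y = succs w ! Suc j" using succs_nxt(2)[OF wv wj(2) j] by (simp add: x_def y_def)
    have zs': "drop (Suc j) (succs w) \<noteq> []" "hd (drop (Suc j) (succs w)) = y"
      using j yj by (simp_all add: hd_drop_conv_nth)
    have ym: "y < m" using siblings_nxt[OF True] arcs_iff by (simp add: y_def)
    define S where "S = walked (u, zs) \<inter> siblings"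
    have fin: "finite S" unfolding S_def using finite_siblings by blast
    have xS: "x \<notin> S" using wk(2) by (simp add: S_def)
    have S': "walked (u, drop (Suc j) (succs w)) \<inter> siblings = insert x S"
      unfolding wk(1) S_def using True by blast
    have card: "card (insert x S) = Suc (card S)" using fin xS by simp
    define K where "K = m + card S"
    have K: "\<tau> 17 0 = K" "m \<le> K" using E by (simp_all add: edges_inv_def S_def K_def)
    \<comment> \<open>The switch is updated with \<open>sink_left x\<close> before the direction is
      chosen; it then equals \<open>descends x\<close>, which is also the bit required at position
      \<open>Suc j\<close>.\<close>
    have dec: "descends x \<longleftrightarrow> (\<exists>i<j. sink_left (succs w ! i)) \<or> sink_left x"
      using descends_nth[OF wv wj(2,3)] unfolding x_def by (auto simp: order_le_less)
    have dec': "descends x \<longleftrightarrow> (\<exists>i<Suc j. sink_left (succs w ! i))"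
      using descends_nth[OF wv wj(2,3)] unfolding x_def by (simp add: less_Suc_eq_le)
    have rd: "\<tau> 9 x = Suc y" "\<tau> 8 x = of_bool (sink_left x)" "\<tau> 7 y = of_bool (sink_right y)"
      "\<tau> 2 x = head G x" "\<tau> 2 y = head G y"
      using T E xm ym True by (simp_all add: tabulated_def edges_inv_def y_def)
    have ne: "x \<noteq> K" "y \<noteq> K" using xm ym K(2) by simp_all
    obtain a b where ab: "sib_edge descends x = (a, b)" by fastforce
    let ?\<tau> = "effect sibling_body \<tau>"
    have eff: "?\<tau> 1 = (\<tau> 1)(K := a)" "?\<tau> 2 = (\<tau> 2)(K := b)" "?\<tau> 17 0 = Suc K" "?\<tau> 15 0 = Suc y"
      "?\<tau> 16 0 = of_bool (descends x)"
      "?\<tau> 18 0 = (if descends x \<and> sink_right y then 1 else \<tau> 18 0)"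
      "\<And>k. k \<notin> {1, 2, 13, 15, 16, 17, 18} \<Longrightarrow> ?\<tau> k = \<tau> k"
      unfolding sibling_body_def using sc rd K ne wj(5) ab dec
      by (auto simp: sib_edge_def y_def[symmetric] split: if_splits)
    have "edges_inv (insert x S) ?\<tau>"
    proof -
      have E': "\<forall>e<m. \<tau> 1 e = tail G e \<and> \<tau> 2 e = head G e"
        "{(\<tau> 1 e, \<tau> 2 e) | e. m \<le> e \<and> e < K} = sib_edge descends ` S"
        "\<tau> 18 0 = of_bool (\<exists>x\<in>S. descends x \<and> sink_right (nxt x))"
        using E by (simp_all add: edges_inv_def S_def K_def)
      have "{(?\<tau> 1 e, ?\<tau> 2 e) | e. m \<le> e \<and> e < Suc K} = sib_edge descends ` insert x S"
        unfolding eff range_pairs_insert[OF K(2)] using E'(2) ab by simp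
      moreover have "\<forall>e<m. ?\<tau> 1 e = tail G e \<and> ?\<tau> 2 e = head G e"
        using E'(1) K(2) unfolding eff by auto
      moreover have "?\<tau> 18 0 = of_bool (\<exists>x\<in>insert x S. descends x \<and> sink_right (nxt x))"
        unfolding eff using E'(3) by (auto simp: y_def)
      moreover have "?\<tau> 17 0 = m + card (insert x S)" unfolding eff card by (simp add: K_def)
      moreover have "m + card (insert x S) = Suc K" unfolding card by (simp add: K_def)
      ultimately show ?thesis unfolding edges_inv_def by simp
    qed
    moreover have "tabulated ?\<tau>" using T unfolding tabulated_def by (simp add: eff(7))
    moreover have "position u (drop (Suc j) (succs w)) (?\<tau> 16 0)"
      unfolding position_def eff(5) dec' using wj j by blast
    moreover have "?\<tau> 14 0 = u" using sc eff(7)[of 14] by simp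
    ultimately have "walk_inv (u, drop (Suc j) (succs w)) ?\<tau>"
      unfolding walk_inv_def fst_conv snd_conv S' using un zs' eff(4) by simp
    then show ?thesis using mu by blast
  qed
qed

lemma walk_correct:
  assumes T: "tabulated \<tau>" and z: "\<tau> 14 0 = 0" "\<tau> 15 0 = 0" "\<tau> 18 0 = 0" "\<tau> 17 0 = m"
    and e: "\<And>e. e < m \<Longrightarrow> \<tau> 1 e = tail G e \<and> \<tau> 2 e = head G e"
  shows "\<exists>\<tau>'. runs (While sibling_test sibling_body) \<tau> (200 * (n + m) + 200) \<tau>' \<and>
    edges_inv siblings \<tau>' \<and> tabulated \<tau>'"
proof -
  have lf: "loop_free sibling_body" by (simp add: sibling_body_def)
  have w0: "walked (0, []) = {}" by (simp add: walked_def)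
  have init: "walk_inv (0, []) \<tau>"
    using T z e by (simp add: walk_inv_def w0 edges_inv_def position_def)
  have step: "\<exists>g'. walk_inv g' (effect sibling_body \<tau>) \<and> walk_measure g' < walk_measure g"
    if I: "walk_inv g \<tau>" and b: "test_val sibling_test \<tau>" for g \<tau>
  proof -
    obtain u zs where g: "g = (u, zs)" by (cases g)
    show ?thesis
    proof (cases "zs = []")
      case True
      then have "u < n" using I b g input_scalars
        by (auto simp: walk_inv_def tabulated_def sibling_test_def)
      then show ?thesis using walk_step_vertex I True g by blast
    next
      case False
      then show ?thesis using walk_step_arc I g by blast
    qed
  qed
  obtain g \<tau>' where r: "runs (While sibling_test sibling_body) \<tau>
      ((test_cost sibling_test + max_cost sibling_body) * walk_measure (0, []) + test_cost sibling_test) \<tau>'"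
    and I: "walk_inv g \<tau>'" and nb: "\<not> test_val sibling_test \<tau>'"
    using runs_While[where I = walk_inv and \<mu> = walk_measure and b = sibling_test, OF lf step init] by blast
  obtain u zs where g: "g = (u, zs)" by (cases g)
  have "zs = []" "u = n"
    using I nb g input_scalars by (auto simp: walk_inv_def tabulated_def sibling_test_def split: if_splits)
  moreover have "tail G x < n" if "x \<in> arcs G" for x using that verts_iff[of "tail G x"] by simp
  ultimately have "walked g = arcs G" using g by (auto simp: walked_def)
  then have "edges_inv siblings \<tau>'" "tabulated \<tau>'"
    using I siblings_arcs by (auto simp: walk_inv_def Int_absorb1 subsetI)
  moreover have "test_cost sibling_test + max_cost sibling_body \<le> 200" "test_cost sibling_test \<le> 200"
    by (simp_all add: sibling_body_def sibling_test_def)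
  then have "(test_cost sibling_test + max_cost sibling_body) * walk_measure (0, []) + test_cost sibling_test
      \<le> 200 * walk_measure (0, []) + 200"
    by (intro add_mono mult_le_mono1)
  then have "(test_cost sibling_test + max_cost sibling_body) * walk_measure (0, []) + test_cost sibling_test
      \<le> 200 * (n + m) + 200"
    by (simp add: walk_measure_def w0)
  ultimately show ?thesis using runs_mono[OF r] by blast
qed

section \<open>Correctness and running time\<close>

lemma bitonic_prog_correct:
  "\<exists>\<tau>. runs bitonic_prog \<sigma>0 (2000 * (n + m)) \<tau> \<and>
    (if \<exists>\<pi>. bitonic_st_ordering G s \<rho> a\<^sub>0 \<pi>
     then \<tau> 5 0 = 1 \<and> bitonic_st_ordering G s \<rho> a\<^sub>0 (\<tau> 6)
     else \<tau> 5 0 = 0)"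
proof -
  obtain \<tau>1 where r1: "runs corner_prog \<sigma>0 (200 * (n + m) + 100) \<tau>1"
    and f1: "\<And>k. k \<notin> {7, 8, 9, 10, 11, 12, 13} \<Longrightarrow> \<tau>1 k = \<sigma>0 k"
    and t1: "\<forall>x<m. \<tau>1 7 x = of_bool (sink_right x)" "\<forall>x<m. \<tau>1 8 x = of_bool (sink_left x)"
      "\<forall>x<m. \<tau>1 9 x = (if x \<in> siblings then Suc (nxt x) else 0)"
      "\<forall>u<n. \<tau>1 10 u = (if out_arcs G u = {} then 0 else Suc (hd (succs u)))"
    using corner_correct by blast
  let ?q = "Assign 17 (Cell 0 (Const 1))"
  define \<tau>2 where "\<tau>2 = effect ?q \<tau>1"
  have r2: "runs ?q \<tau>1 (max_cost ?q) \<tau>2" unfolding \<tau>2_def by (rule runs_loop_free) simp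
  have e2: "\<tau>2 = \<tau>1(17 := (\<tau>1 17)(0 := m))"
    using f1[of 0] input_scalars by (simp add: \<tau>2_def)
  have T2: "tabulated \<tau>2" using t1 f1 input_zero by (simp add: tabulated_def e2)
  have "\<tau>2 14 0 = 0" "\<tau>2 15 0 = 0" "\<tau>2 18 0 = 0" "\<tau>2 17 0 = m"
    using f1 input_zero by (simp_all add: e2)
  moreover have "\<tau>2 1 e = tail G e \<and> \<tau>2 2 e = head G e" if "e < m" for e
    using f1[of 1] f1[of 2] input_tail[OF that] input_head[OF that] by (simp add: e2)
  ultimately obtain \<tau>3 where r3: "runs (While sibling_test sibling_body) \<tau>2 (200 * (n + m) + 200) \<tau>3"
    and E: "edges_inv siblings \<tau>3" and T: "tabulated \<tau>3"
    using walk_correct[OF T2] by blast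
  let ?K = "m + card siblings"
  \<comment> \<open>Inserted edges are named by arcs, so the augmented graph is still of linear
    size.\<close>
  have Km: "?K \<le> 2 * m" using card_mono[OF finite_arcs, of siblings] siblings_arcs by (simp add: subsetI)
  have E': "\<tau>3 17 0 = ?K" "\<forall>e<m. \<tau>3 1 e = tail G e \<and> \<tau>3 2 e = head G e"
    "{(\<tau>3 1 e, \<tau>3 2 e) | e. m \<le> e \<and> e < ?K} = sib_edge descends ` siblings"
    "\<tau>3 18 0 = of_bool (\<exists>x\<in>siblings. descends x \<and> sink_right (nxt x))"
    using E by (simp_all add: edges_inv_def)
  have n1: "1 \<le> n" using s_verts verts_iff by (cases n) auto
  let ?R = "{(\<tau>3 1 e, \<tau>3 2 e) | e. e < ?K}"
  have R: "?R = arcs_ends G \<union> sib_edge descends ` siblings"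
  proof -
    have i: "{e. e < ?K} = {e. e < m} \<union> {e. m \<le> e \<and> e < ?K}" by auto
    have "?R = {(\<tau>3 1 e, \<tau>3 2 e) | e. e < m} \<union> {(\<tau>3 1 e, \<tau>3 2 e) | e. m \<le> e \<and> e < ?K}"
      unfolding setcompr_eq_image i image_Un by (rule refl)
    moreover have "arcs_ends G = {(\<tau>3 1 e, \<tau>3 2 e) | e. e < m}"
    proof -
      have A: "arcs G = {e. e < m}" using arcs_iff by blast
      have "arcs_ends G = (\<lambda>e. (tail G e, head G e)) ` arcs G" by (rule arcs_ends_conv)
      also have "\<dots> = (\<lambda>e. (\<tau>3 1 e, \<tau>3 2 e)) ` arcs G"
        using E'(2) by (intro image_cong) (simp_all add: arcs_iff)
      also have "\<dots> = {(\<tau>3 1 e, \<tau>3 2 e) | e. e < m}"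
        unfolding setcompr_eq_image using A by (rule arg_cong)
      finally show ?thesis .
    qed
    ultimately show ?thesis using E'(3) by simp
  qed
  have nc: "\<tau>3 18 0 = 0 \<longleftrightarrow> no_conflict" using E'(4) by (auto simp: no_conflict_def)
  let ?a = "Seq adjacency_prog (Seq sort_prog (Assign 5 (Const 1)))"
  have "\<exists>\<tau>. runs (if test_val (Eq (Var 18) (Const 0)) \<tau>3 then ?a else Skip) \<tau>3 (400 * (n + m) + 400) \<tau> \<and>
    (if no_conflict then \<tau> 5 0 = 1 \<and> bitonic_st_ordering G s \<rho> a\<^sub>0 (\<tau> 6) else \<tau> 5 0 = 0)"
  proof (cases no_conflict)
    case False
    have "runs Skip \<tau>3 (max_cost Skip) (effect Skip \<tau>3)" by (rule runs_loop_free) simp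
    then have "runs Skip \<tau>3 (400 * (n + m) + 400) \<tau>3" 
      using runs_mono[of Skip \<tau>3 "max_cost Skip" "effect Skip \<tau>3" "400 * (n + m) + 400"] by simp
    moreover have "\<tau>3 5 0 = 0" using T input_zero by (simp add: tabulated_def)
    ultimately show ?thesis using False nc by auto
  next
    case True
    have z: "\<tau>3 k = (\<lambda>_. 0)" if "19 \<le> k" for k using T that by (simp add: tabulated_def)
    obtain \<tau>4 where r4: "runs adjacency_prog \<tau>3 (50 * \<tau>3 17 0 + 50) \<tau>4"
      and f4: "\<And>k. k \<notin> {19, 20, 21, 22} \<Longrightarrow> \<tau>4 k = \<tau>3 k"
      and a4: "\<And>v. \<tau>4 20 v = last_below (\<tau>3 1) v ?K" "\<And>e. e < ?K \<Longrightarrow> \<tau>4 19 e = last_below (\<tau>3 1) (\<tau>3 1 e) e"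
        "\<And>w. \<tau>4 21 w = card {e. e < ?K \<and> \<tau>3 2 e = w}"
      using adjacency_correct[of \<tau>3] z E'(1) by auto
    have in_verts: "x < n \<and> y < n" if "(x, y) \<in> ?R" for x y
    proof -
      have "(x, y) \<in> arcs_ends G \<or> (x, y) \<in> sib_edge descends ` siblings" using that R by blast
      then have "x \<in> verts G \<and> y \<in> verts G"
        by (auto simp: arcs_ends_conv sib_edge_def split: if_splits)
      then show ?thesis using verts_iff by simp
    qed
    \<comment> \<open>Inserted edges also end at heads of arcs, so \<open>s\<close> remains the only
      source.\<close>
    have no_s: "y \<noteq> s" if "(x, y) \<in> ?R" for x y
    proof -
      have "(x, y) \<in> arcs_ends G \<or> (x, y) \<in> sib_edge descends ` siblings" using that R by blast
      then show ?thesis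
      proof
        assume "(x, y) \<in> arcs_ends G"
        then show ?thesis using head_neq_s by (auto simp: arcs_ends_conv)
      next
        assume "(x, y) \<in> sib_edge descends ` siblings"
        then obtain a where a: "a \<in> siblings" "(x, y) = sib_edge descends a" by blast
        then show ?thesis
          using head_neq_s[OF siblings_arcs[OF a(1)]] head_neq_s[OF siblings_nxt[OF a(1)]]
          by (auto simp: sib_edge_def split: if_splits)
      qed
    qed
    interpret topsort n ?K s "\<tau>3 1" "\<tau>3 2"
    proof
      show "\<tau>3 1 e < n" "\<tau>3 2 e < n" if "e < ?K" for e using in_verts that by blast+
      show "s < n" using s_verts verts_iff by simp
      show "acyclic ?R" unfolding R by (rule acyclic_augmented[OF True])
      fix w assume w: "w < n"
      show "(\<forall>e<?K. \<tau>3 2 e \<noteq> w) \<longleftrightarrow> w = s"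
      proof
        assume no: "\<forall>e<?K. \<tau>3 2 e \<noteq> w"
        show "w = s"
        proof (rule ccontr)
          assume "w \<noteq> s"
          then obtain a where "a \<in> arcs G" "head G a = w" using ex_in_arc w verts_iff by blast
          then have "a < ?K" "\<tau>3 2 a = w" using E'(2) arcs_iff by auto
          then show False using no by blast
        qed
      next
        assume "w = s"
        then show "\<forall>e<?K. \<tau>3 2 e \<noteq> w" using no_s by blast
      qed
    qed
    have a0m: "a\<^sub>0 < m" using a0 arcs_iff by simp
    have "\<tau>4 24 0 = 0" "\<tau>4 26 0 = 0" "\<tau>4 2 = \<tau>3 2"
      using f4 z by simp_all
    moreover have "\<tau>4 1 (\<tau>4 0 2) = s"
      using f4[of 0] f4[of 1] T input_scalars E'(2) a0m a0 by (simp add: tabulated_def)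
    ultimately obtain \<tau>5 where r5: "runs sort_prog \<tau>4 (100 * (n + ?K) + 100) \<tau>5"
      and b5: "bij_betw (\<tau>5 6) {..<n} {1..n}" and m5: "\<And>e. e < ?K \<Longrightarrow> \<tau>5 6 (\<tau>3 1 e) < \<tau>5 6 (\<tau>3 2 e)"
      using sort_correct[of \<tau>4] a4 by blast
    let ?\<tau> = "effect (Assign 5 (Const 1)) \<tau>5"
    have r6: "runs (Assign 5 (Const 1)) \<tau>5 (max_cost (Assign 5 (Const 1))) ?\<tau>" by (rule runs_loop_free) simp
    have "runs ?a \<tau>3 ((50 * \<tau>3 17 0 + 50) + ((100 * (n + ?K) + 100) + max_cost (Assign 5 (Const 1)))) ?\<tau>"
      by (rule runs_Seq[OF r4 runs_Seq[OF r5 r6]])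
    then have "runs ?a \<tau>3 (400 * (n + m) + 400) ?\<tau>"
      by (rule runs_mono) (use E'(1) Km in simp)
    moreover have "bitonic_st_ordering G s \<rho> a\<^sub>0 (?\<tau> 6)"
    proof (rule bitonic_of_augmented)
      have "verts G = {..<n}" using verts_iff by blast
      then show "bij_betw (?\<tau> 6) (verts G) {1..n}" using b5 by simp
      fix x y assume "(x, y) \<in> arcs_ends G \<union> sib_edge descends ` siblings"
      then have "(x, y) \<in> ?R" using R by blast
      then show "?\<tau> 6 x < ?\<tau> 6 y" using m5 by auto
    qed
    ultimately show ?thesis using True nc by (intro exI[of _ ?\<tau>]) simp
  qed
  then obtain \<tau> where r: "runs (if test_val (Eq (Var 18) (Const 0)) \<tau>3 then ?a else Skip) \<tau>3 (400 * (n + m) + 400) \<tau>"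
    and res: "if no_conflict then \<tau> 5 0 = 1 \<and> bitonic_st_ordering G s \<rho> a\<^sub>0 (\<tau> 6) else \<tau> 5 0 = 0"
    by blast
  have "runs bitonic_prog \<sigma>0 ((200 * (n + m) + 100) + (max_cost ?q + ((200 * (n + m) + 200) +
      (test_cost (Eq (Var 18) (Const 0)) + (400 * (n + m) + 400))))) \<tau>"
    unfolding bitonic_prog_def by (rule runs_Seq[OF r1 runs_Seq[OF r2 runs_Seq[OF r3 runs_If[OF r]]]])
  \<comment> \<open>The partial bounds sum to \<open>800 * (n + m)\<close> plus a constant, which
    \<open>1 \<le> n\<close> absorbs into the factor 2000.\<close>
  then have "runs bitonic_prog \<sigma>0 (2000 * (n + m)) \<tau>"
    by (rule runs_mono) (use n1 in simp)
  \<comment> \<open>Sufficiency is witnessed by the computed ordering itself.\<close>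
  moreover have "no_conflict \<longleftrightarrow> (\<exists>\<pi>. bitonic_st_ordering G s \<rho> a\<^sub>0 \<pi>)"
    using res no_conflict_of_bitonic by auto
  ultimately show ?thesis using res by (intro exI[of _ \<tau>]) simp
qed

end

theorem theorem2:
  shows "\<exists>(p :: prog) (c :: nat).
    \<forall>(G :: (nat, nat) pre_digraph) s t \<rho> a\<^sub>0.
      embedded_planar_st_graph G s t \<rho> a\<^sub>0 \<and> numbered G \<longrightarrow>
      (\<exists>T \<sigma>. exec p (input_store G \<rho> a\<^sub>0) T \<sigma> \<and>
         T \<le> c * (card (verts G) + card (arcs G)) \<and>
         (if \<exists>\<pi>. bitonic_st_ordering G s \<rho> a\<^sub>0 \<pi>
          then \<sigma> 5 0 = 1 \<and> bitonic_st_ordering G s \<rho> a\<^sub>0 (\<sigma> 6)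
          else \<sigma> 5 0 = 0))"
proof (rule exI[of _ bitonic_prog], rule exI[of _ 2000], intro allI impI)
  fix G :: "(nat, nat) pre_digraph" and s t \<rho> a\<^sub>0
  assume "embedded_planar_st_graph G s t \<rho> a\<^sub>0 \<and> numbered G"
  then interpret numbered_st_graph G s t \<rho> a\<^sub>0
    by (simp add: numbered_st_graph_def numbered_st_graph_axioms_def)
  show "\<exists>T \<sigma>. exec bitonic_prog (input_store G \<rho> a\<^sub>0) T \<sigma> \<and>
         T \<le> 2000 * (card (verts G) + card (arcs G)) \<and>
         (if \<exists>\<pi>. bitonic_st_ordering G s \<rho> a\<^sub>0 \<pi>
          then \<sigma> 5 0 = 1 \<and> bitonic_st_ordering G s \<rho> a\<^sub>0 (\<sigma> 6)
          else \<sigma> 5 0 = 0)"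
    using bitonic_prog_correct unfolding runs_def by blast
qed

end
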